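(* Let $\Phi_1\in\mathscr{L}\cup\mathscr{U}$ and $\Phi_2\in\tilde{\mathscr{L}}\cup\tilde{\mathscr{U}}$, and assume $\Phi_2/\Phi_1$ is non-decreasing. Let $\alpha,\beta>-1$ and define for $1\le t<\infty$ $$\gamma(t)=\frac{\Phi_2^{-1}(t^{n+1+\beta})}{\Phi_1^{-1}(t^{n+1+\alpha})}.$$ (i) If $\gamma$ is non-decreasing on $[1,\infty)$, then $\mathcal{M}(A^{\Phi_1}_\alpha(\mathbb{B}^n),A^{\Phi_2}_\beta(\mathbb{B}^n))=\mathcal{H}^\infty_\omega(\mathbb{B}^n)$ with $\omega(s)=\gamma(1/s)$, $s\in(0,1]$. (ii) If $\gamma$ is equivalent to $1$ on $[1,\infty)$ (bounded above and below by positive constants), then $\mathcal{M}(A^{\Phi_1}_\alpha(\mathbb{B}^n),A^{\Phi_2}_\beta(\mathbb{B}^n))=H^\infty(\mathbb{B}^n)$. (iii) If $\gamma$ is non-increasing on $[1,\infty)$ and $\lim_{t\to\infty}\gamma(t)=0$, then $\mathcal{M}(A^{\Phi_1}_\alpha(\mathbb{B}^n),A^{\Phi_2}_\beta(\mathbb{B}^n))=\{0\}$.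
   Context: $\mathbb{B}^n$ is the open unit ball of $\mathbb{C}^n$. $d\nu$ is Lebesgue measure on $\mathbb{B}^n$ and $d\nu_\alpha(z)=c_\alpha(1-|z|^2)^\alpha d\nu(z)$ with $\nu_\alpha(\mathbb{B}^n)=1$. A growth function is a continuous non-decreasing function from $[0,\infty)$ onto $[0,\infty)$, normalized so that $\Phi(1)=1$. $\Phi$ is of upper type $q>0$ if $\Phi(st)\le Ct^q\Phi(s)$ for all $s>0,t\ge1$; of lower type $p>0$ if $\Phi(st)\le Ct^p\Phi(s)$ for all $s>0$, $0<t\le1$. $\mathscr{U}^q$ ($q\ge1$) is the set of growth functions of upper type $q$ with $\Phi(t)/t$ non-decreasing, $\mathscr{U}=\bigcup_{q\ge1}\mathscr{U}^q$; $\mathscr{L}_p$ ($0<p\le1$) is the set of growth functions of lower type $p$ with $\Phi(t)/t$ non-increasing, $\mathscr{L}=\bigcup_{0<p\le1}\mathscr{L}_p$. $\tilde{\mathscr{U}}$ is the set of $\Phi\in\mathscr{U}^q$ (for some $q\ge1$) such that (a1) there is $C_1>0$ with $\Phi(st)\le C_1\Phi(s)\Phi(t)$ for all $0<s\le1$, $t\ge1$, and (a2) there is $C_2>0$ with $\Phi(a/b)\le C_2\Phi(a)/b^q$ for all $a,b\ge1$. $\tilde{\mathscr{L}}$ is the set of $\Phi\in\mathscr{L}_p$ (for some $0<p\le1$) satisfying (a1) and such that there is $C_3>0$ with $\Phi(a/b)\le C_3 a^p/\Phi(b)$ for all $a,b\ge1$. $A^\Phi_\alpha(\mathbb{B}^n)$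 is the set of holomorphic $f$ on $\mathbb{B}^n$ with $\int\Phi(|f|)\,d\nu_\alpha<\infty$, with Luxemburg quasi-norm $\|f\|^{lux}_{\Phi,\alpha}=\inf\{\lambda>0:\int_{\mathbb{B}^n}\Phi(|f|/\lambda)\,d\nu_\alpha\le1\}$. $H^\infty(\mathbb{B}^n)$ is the space of bounded holomorphic functions. For $\omega:(0,1]\to(0,\infty)$, $\mathcal{H}^\infty_\omega(\mathbb{B}^n)$ is the space of holomorphic $f$ on $\mathbb{B}^n$ with $\sup_{z\in\mathbb{B}^n}|f(z)|/\omega(1-|z|)<\infty$. The multiplier set $\mathcal{M}(A^{\Phi_1}_\alpha(\mathbb{B}^n),A^{\Phi_2}_\beta(\mathbb{B}^n))$ is the set of holomorphic $g$ for which there is $C>0$ with $\|fg\|^{lux}_{\Phi_2,\beta}\le C\|f\|^{lux}_{\Phi_1,\alpha}$ (in particular $fg\in A^{\Phi_2}_\beta$) for all $f\in A^{\Phi_1}_\alpha(\mathbb{B}^n)$. *)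

theory Defs
  imports "HOL-Analysis.Analysis"
begin

definition growth_fun :: "(real \<Rightarrow> real) \<Rightarrow> bool" where
  "growth_fun \<Phi> \<longleftrightarrow> continuous_on {0..} \<Phi> \<and> mono_on {0..} \<Phi> \<and> \<Phi> ` {0..} = {0..} \<and> \<Phi> 1 = 1"

definition upper_type :: "real \<Rightarrow> (real \<Rightarrow> real) \<Rightarrow> bool" where
  "upper_type q \<Phi> \<longleftrightarrow> (\<exists>C>0. \<forall>s>0. \<forall>t\<ge>1. \<Phi> (s * t) \<le> C * t powr q * \<Phi> s)"

definition lower_type :: "real \<Rightarrow> (real \<Rightarrow> real) \<Rightarrow> bool" where
  "lower_type p \<Phi> \<longleftrightarrow> (\<exists>C>0. \<forall>s>0. \<forall>t. 0 < t \<and> t \<le> 1 \<longrightarrow> \<Phi> (s * t) \<le> C * t powr p * \<Phi> s)"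

definition classU :: "real \<Rightarrow> (real \<Rightarrow> real) \<Rightarrow> bool" where
  "classU q \<Phi> \<longleftrightarrow> 1 \<le> q \<and> growth_fun \<Phi> \<and> upper_type q \<Phi> \<and> mono_on {0<..} (\<lambda>t. \<Phi> t / t)"

definition classL :: "real \<Rightarrow> (real \<Rightarrow> real) \<Rightarrow> bool" where
  "classL p \<Phi> \<longleftrightarrow> 0 < p \<and> p \<le> 1 \<and> growth_fun \<Phi> \<and> lower_type p \<Phi> \<and> antimono_on {0<..} (\<lambda>t. \<Phi> t / t)"

definition inU :: "(real \<Rightarrow> real) \<Rightarrow> bool" where
  "inU \<Phi> \<longleftrightarrow> (\<exists>q. classU q \<Phi>)"

definition inL :: "(real \<Rightarrow> real) \<Rightarrow> bool" where
  "inL \<Phi> \<longleftrightarrow> (\<exists>p. classL p \<Phi>)"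

definition cond_a1 :: "(real \<Rightarrow> real) \<Rightarrow> bool" where
  "cond_a1 \<Phi> \<longleftrightarrow> (\<exists>C1>0. \<forall>s t. 0 < s \<and> s \<le> 1 \<and> 1 \<le> t \<longrightarrow> \<Phi> (s * t) \<le> C1 * \<Phi> s * \<Phi> t)"

definition inU_tilde :: "(real \<Rightarrow> real) \<Rightarrow> bool" where
  "inU_tilde \<Phi> \<longleftrightarrow> (\<exists>q. classU q \<Phi> \<and> cond_a1 \<Phi> \<and>
     (\<exists>C2>0. \<forall>a b. 1 \<le> a \<and> 1 \<le> b \<longrightarrow> \<Phi> (a / b) \<le> C2 * \<Phi> a / b powr q))"

definition inL_tilde :: "(real \<Rightarrow> real) \<Rightarrow> bool" where
  "inL_tilde \<Phi> \<longleftrightarrow> (\<exists>p. classL p \<Phi> \<and> cond_a1 \<Phi> \<and>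
     (\<exists>C3>0. \<forall>a b. 1 \<le> a \<and> 1 \<le> b \<longrightarrow> \<Phi> (a / b) \<le> C3 * a powr p / \<Phi> b))"

text \<open>Inverse of a growth function (generalized left inverse; it is the ordinary inverse
  whenever the growth function is strictly increasing).\<close>
definition ginv :: "(real \<Rightarrow> real) \<Rightarrow> real \<Rightarrow> real" where
  "ginv \<Phi> u = Inf {t. 0 \<le> t \<and> u \<le> \<Phi> t}"

definition holo_ball :: "(complex^'n::finite \<Rightarrow> complex) \<Rightarrow> bool" where
  "holo_ball f \<longleftrightarrow> (\<forall>z\<in>ball 0 1. \<exists>L. (f has_derivative L) (at z) \<and> (\<forall>c w. L (c *s w) = c * L w))"

definition nu_alpha :: "real \<Rightarrow> (complex^'n::finite) measure" where
  "nu_alpha \<alpha> =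
    (let c = 1 / enn2real (\<integral>\<^sup>+ (z::complex^'n). ennreal ((1 - (norm z)\<^sup>2) powr \<alpha>) \<partial>(restrict_space lborel (ball 0 1)))
     in density (restrict_space lborel (ball 0 1)) (\<lambda>z. ennreal (c * (1 - (norm z)\<^sup>2) powr \<alpha>)))"

definition orlicz_bergman :: "(real \<Rightarrow> real) \<Rightarrow> real \<Rightarrow> (complex^'n::finite \<Rightarrow> complex) set" where
  "orlicz_bergman \<Phi> \<alpha> = {f. holo_ball f \<and> (\<integral>\<^sup>+ z. ennreal (\<Phi> (norm (f z))) \<partial>(nu_alpha \<alpha> :: (complex^'n) measure)) < \<infinity>}"

definition lux_norm :: "(real \<Rightarrow> real) \<Rightarrow> real \<Rightarrow> (complex^'n::finite \<Rightarrow> complex) \<Rightarrow> real" where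
  "lux_norm \<Phi> \<alpha> f = Inf {r. 0 < r \<and> (\<integral>\<^sup>+ z. ennreal (\<Phi> (norm (f z) / r)) \<partial>(nu_alpha \<alpha> :: (complex^'n) measure)) \<le> 1}"

definition multipliers :: "(real \<Rightarrow> real) \<Rightarrow> real \<Rightarrow> (real \<Rightarrow> real) \<Rightarrow> real \<Rightarrow> (complex^'n::finite \<Rightarrow> complex) set" where
  "multipliers \<Phi>1 \<alpha> \<Phi>2 \<beta> = {g. holo_ball g \<and> (\<exists>C>0. \<forall>f\<in>orlicz_bergman \<Phi>1 \<alpha>.
      (\<lambda>z. f z * g z) \<in> orlicz_bergman \<Phi>2 \<beta> \<and>
      lux_norm \<Phi>2 \<beta> (\<lambda>z. f z * g z) \<le> C * lux_norm \<Phi>1 \<alpha> f)}"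

definition H_infty :: "(complex^'n::finite \<Rightarrow> complex) set" where
  "H_infty = {f. holo_ball f \<and> (\<exists>C. \<forall>z\<in>ball 0 1. norm (f z) \<le> C)}"

definition H_infty_omega :: "(real \<Rightarrow> real) \<Rightarrow> (complex^'n::finite \<Rightarrow> complex) set" where
  "H_infty_omega \<omega> = {f. holo_ball f \<and> (\<exists>C. \<forall>z\<in>ball 0 1. norm (f z) / \<omega> (1 - norm z) \<le> C)}"

definition mult_gamma :: "(real \<Rightarrow> real) \<Rightarrow> (real \<Rightarrow> real) \<Rightarrow> real \<Rightarrow> real \<Rightarrow> nat \<Rightarrow> real \<Rightarrow> real" where
  "mult_gamma \<Phi>1 \<Phi>2 \<alpha> \<beta> n t =
     ginv \<Phi>2 (t powr (real n + 1 + \<beta>)) / ginv \<Phi>1 (t powr (real n + 1 + \<alpha>))"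

end

theory Submission
  imports Defs "HOL-Complex_Analysis.Conformal_Mappings"
begin

text \<open>Write \<open>d = 1 - norm z\<close>. A function whose \<open>\<Phi>\<close>-modular is at most 1 satisfies
  \<open>norm (f z) \<le> C * ginv \<Phi> (d powr -(n + 1 + \<alpha>))\<close>, and the functions
  \<open>ginv \<Phi> (d powr -(n + 1 + \<alpha>)) * (d / (1 - cinner \<cdot> z)) ^ m\<close> with large \<open>m\<close> are bounded in quasi-norm and attain
  this order at \<open>z\<close>. Testing a multiplier \<open>g\<close> on them gives \<open>norm (g z) \<le> K * \<gamma> (1 / d)\<close>, which is the
  necessary condition in all three cases. Conversely, when \<open>\<gamma>\<close> is bounded below, this bound on \<open>g\<close>
  together with the pointwise bound on \<open>f\<close> yields
  \<open>\<Phi>2 (norm (f z * g z)) * d powr \<beta> \<le> C * \<Phi>1 (norm (f z)) * d powr \<alpha>\<close> up to normalising constants: the tilde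
  conditions make \<open>\<Phi>2\<close> behave like a power under dilations by factors at least 1, and monotonicity of
  \<open>\<Phi>2 / \<Phi>1\<close> compares the two growth functions below the maximal size of \<open>f\<close>.

  The exponent \<open>n + 1 + \<alpha>\<close> comes from anisotropic sets whose volumes are estimated using only
  translation invariance: from below by covering a Euclidean ball with translates, from above by
  packing disjoint translates into one.\<close>

section \<open>Isometry invariance of Lebesgue measure and the circle mean\<close>

text \<open>The lower type does both jobs instead. At t = 1/d the number \<gamma>(t) is s2/s1, where
  s2 and s1 are the orders of the largest values that the target and the source allow at distance d
  from the sphere. Sufficiency rests on a cancellation: up to constants, for u \<le> s1,
  \<Phi>2(\<gamma> u) \<le> \<gamma>^r \<Phi>2(u) \<le> \<gamma>^r \<Phi>1(u)
  \<Phi>2(s1)/\<Phi>1(s1), and \<gamma>^r \<Phi>2(s1) is comparable to (\<gamma> s1)^r = s2^r, hence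
  to \<Phi>2(s2). What remains is \<Phi>2(s2)/\<Phi>1(s1) = d^(\<alpha>-\<beta>), which exchanges
  the weights. The same exponent r must govern the dilation bound and both bounds of \<Phi>2 on
  [1,\<infinity>); this is what the tilde conditions give. Functions are total and arbitrary off the
  ball. Hence the indicators in the integrals, and hence the zero multiplier appears as the set of
  functions vanishing on the ball.\<close>

lemma isometry_image_ball:
  fixes T :: "'a::metric_space \<Rightarrow> 'a"
  assumes "bij T" "\<And>x y. dist (T x) (T y) = dist x y"
  shows "T ` ball x r = ball (T x) r"
proof (intro equalityI subsetI)
  fix y assume "y \<in> ball (T x) r"
  moreover obtain x' where x': "y = T x'" using assms(1) by (meson bij_is_surj surjE)
  ultimately have "x' \<in> ball x r" using assms(2)[of x x'] by simp
  then show "y \<in> T ` ball x r" using x' by blast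
qed (auto simp: assms(2))

lemma isometry_image_open:
  fixes T :: "'a::metric_space \<Rightarrow> 'a"
  assumes "bij T" "\<And>x y. dist (T x) (T y) = dist x y" "open U"
  shows "open (T ` U)"
  unfolding open_contains_ball
proof
  fix y assume "y \<in> T ` U"
  then obtain x where x: "x \<in> U" "y = T x" by auto
  then obtain e where "e > 0" "ball x e \<subseteq> U" using assms(3) by (auto simp: open_contains_ball)
  then show "\<exists>e>0. ball y e \<subseteq> T ` U"
    using isometry_image_ball[OF assms(1,2), of x e] x by (metis image_mono)
qed

lemma emeasure_lborel_open_le_isometry_image:
  fixes T :: "'a::euclidean_space \<Rightarrow> 'a"
  assumes T: "bij T" "\<And>x y. dist (T x) (T y) = dist x y" and U: "open U"
  shows "emeasure lborel U \<le> emeasure lborel (T ` U)"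
proof -
  define K where "K = {(x, r). r > 0 \<and> ball x r \<subseteq> U}"
  have cov: "\<exists>i. i \<in> K \<and> x \<in> ball (fst i) (snd i) \<and> snd i < d" if x: "x \<in> U" and d: "0 < d" for x and d :: real
  proof -
    obtain e where e: "e > 0" "ball x e \<subseteq> U" using U x by (auto simp: open_contains_ball)
    then have "ball x (min e (d/2)) \<subseteq> U" by auto
    then show ?thesis using e d
      by (intro exI[of _ "(x, min e (d/2))"]) (auto simp: K_def)
  qed
  obtain C where C: "countable C" "C \<subseteq> K"
     and pw: "pairwise (\<lambda>i j. disjnt (ball (fst i) (snd i)) (ball (fst j) (snd j))) C"
     and neg: "negligible (U - (\<Union>i\<in>C. ball (fst i) (snd i)))"
    using Vitali_covering_theorem_balls[of U K fst snd, OF cov] by blast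
  let ?V = "\<Union>i\<in>C. ball (fst i) (snd i)"
  have dj: "disjoint_family_on (\<lambda>i. ball (fst i) (snd i)) C"
    using pw by (auto simp: disjoint_family_on_def pairwise_def disjnt_def)
  have Tb: "T ` ball x r = ball (T x) r" for x r by (rule isometry_image_ball[OF T])
  have inj: "inj T" using T(1) by (rule bij_is_inj)
  have dj': "disjoint_family_on (\<lambda>i. ball (T (fst i)) (snd i)) C"
    unfolding disjoint_family_on_def Tb[symmetric]
    using dj by (simp add: disjoint_family_on_def image_Int[OF inj, symmetric])
  have "open ?V" by auto
  then have Vm: "?V \<in> sets borel" by (rule borel_open)
  have nV: "U - ?V \<in> null_sets lborel"
  proof -
    have "U - ?V \<in> sets lborel" using U Vm by (simp add: sets.Diff)
    with neg show ?thesis by (simp add: negligible_iff_null_sets null_sets_completion_iff)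
  qed
  have "emeasure lborel U \<le> emeasure lborel (?V \<union> (U - ?V))"
    using U nV Vm by (intro emeasure_mono sets.Un) (auto simp: null_sets_def)
  also have "\<dots> = emeasure lborel ?V"
    using nV Vm by (intro emeasure_Un_null_set) auto
  also have "\<dots> = (\<integral>\<^sup>+i. emeasure lborel (ball (fst i) (snd i)) \<partial>count_space C)"
    using C dj by (intro emeasure_UN_countable) auto
  also have "\<dots> = (\<integral>\<^sup>+i. emeasure lborel (ball (T (fst i)) (snd i)) \<partial>count_space C)"
    using C by (intro nn_integral_cong) (auto simp: K_def emeasure_ball)
  also have "\<dots> = emeasure lborel (\<Union>i\<in>C. ball (T (fst i)) (snd i))"
    using C dj' by (intro emeasure_UN_countable[symmetric]) auto
  also have "\<dots> \<le> emeasure lborel (T ` U)"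
  proof (intro emeasure_mono)
    show "(\<Union>i\<in>C. ball (T (fst i)) (snd i)) \<subseteq> T ` U"
    proof (clarify, unfold Tb[symmetric])
      fix a r x assume "(a, r) \<in> C" "x \<in> T ` ball (fst (a, r)) (snd (a, r))"
      moreover from this C have "ball a r \<subseteq> U" by (auto simp: K_def)
      ultimately show "x \<in> T ` U" by auto
    qed
    show "T ` U \<in> sets lborel" using isometry_image_open[OF T U] by simp
  qed
  finally show ?thesis .
qed

text \<open>The one-sided estimate, applied to T and to its inverse, gives equality on boxes, and
  boxes determine \<open>lborel\<close>.\<close>

lemma distr_lborel_isometry:
  fixes T :: "'a::euclidean_space \<Rightarrow> 'a"
  assumes T: "bij T" "\<And>x y. dist (T x) (T y) = dist x y"
  shows "distr lborel borel T = lborel"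
proof (rule lborel_eqI[symmetric])
  have cont: "continuous_on UNIV T"
    unfolding continuous_on_iff using T(2) by auto
  then have Tm: "T \<in> borel_measurable borel" by (rule borel_measurable_continuous_onI)
  fix l u :: 'a assume lu: "\<And>b. b \<in> Basis \<Longrightarrow> l \<bullet> b \<le> u \<bullet> b"
  have T': "bij (inv T)" "\<And>x y. dist (inv T x) (inv T y) = dist x y"
    using T(1) bij_imp_bij_inv apply blast
    by (metis T bij_is_surj surj_f_inv_f)
  have vi: "T -` U = inv T ` U" for U using T(1) by (simp add: bij_vimage_eq_inv_image)
  have op: "open (T -` box l u)" unfolding vi by (intro isometry_image_open[OF T']) auto
  have "emeasure lborel (T -` box l u) \<le> emeasure lborel (T ` (T -` box l u))"
    using op by (rule emeasure_lborel_open_le_isometry_image[OF T])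
  also have "T ` (T -` box l u) = box l u" using T(1) by (simp add: bij_is_surj surj_image_vimage_eq)
  finally have 1: "emeasure lborel (T -` box l u) \<le> emeasure lborel (box l u)" .
  have "emeasure lborel (box l u) \<le> emeasure lborel (T -` box l u)"
    unfolding vi by (rule emeasure_lborel_open_le_isometry_image[OF T']) auto
  with 1 have "emeasure lborel (T -` box l u) = emeasure lborel (box l u)" by simp
  then show "emeasure (distr lborel borel T) (box l u) = (\<Prod>b\<in>Basis. (u - l) \<bullet> b)"
    using Tm lu by (simp add: emeasure_distr emeasure_lborel_box)
qed simp

section \<open>Unimodular scalars and the mean over a circle\<close>

lemma norm_vector_scalar_mult [simp]:
  fixes v :: "complex^'n::finite"
  shows "norm (c *s v) = norm c * norm v"
proof -
  have "norm (c *s v) = sqrt (\<Sum>i\<in>UNIV. (norm c)\<^sup>2 * (norm (v$i))\<^sup>2)"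
    by (simp add: norm_vec_def L2_set_def norm_mult power_mult_distrib)
  also have "\<dots> = norm c * norm v"
    by (simp add: norm_vec_def L2_set_def real_sqrt_mult flip: sum_distrib_left)
  finally show ?thesis .
qed

lemma nn_integral_lborel_rotation:
  fixes F :: "complex^'n::finite \<Rightarrow> ennreal"
  assumes "F \<in> borel_measurable borel" and c: "norm c = 1"
  shows "(\<integral>\<^sup>+v. F (c *s v) \<partial>lborel) = (\<integral>\<^sup>+v. F v \<partial>lborel)"
proof -
  let ?T = "\<lambda>v::complex^'n. c *s v"
  have c0: "c \<noteq> 0" using c by auto
  have "bij ?T"
    by (rule bij_betw_byWitness[of _ "\<lambda>v. inverse c *s v"]) (use c0 in \<open>auto simp: vector_smult_assoc\<close>)
  moreover have iso: "dist (?T x) (?T y) = dist x y" for x y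
    by (simp add: dist_norm c flip: vector_ssub_ldistrib)
  ultimately have d: "distr lborel borel ?T = lborel" by (rule distr_lborel_isometry)
  have cont: "continuous_on UNIV ?T"
    unfolding continuous_on_iff using iso by auto
  then have "?T \<in> borel_measurable borel" by (rule borel_measurable_continuous_onI)
  then have "(\<integral>\<^sup>+v. F v \<partial>distr lborel borel ?T) = (\<integral>\<^sup>+v. F (?T v) \<partial>lborel)"
    by (intro nn_integral_distr) (use assms in auto)
  then show ?thesis by (simp add: d)
qed

text \<open>Cauchy's formula at the centre, with absolute values taken inside. The non-negative
  integral is used so that the later exchange of integrals needs no integrability.\<close>

lemma circle_mean_value_le:
  fixes h :: "complex \<Rightarrow> complex"
  assumes cont: "continuous_on (cball 0 1) h" and hol: "h holomorphic_on ball 0 1"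
  shows "ennreal (norm (h 0)) * ennreal (2 * pi) \<le> (\<integral>\<^sup>+t\<in>{0..2*pi}. ennreal (norm (h (cis t))) \<partial>lborel)"
proof -
  have "((\<lambda>u. h u / (u - 0)) has_contour_integral (2 * of_real pi * \<i> * h 0)) (circlepath 0 1)"
    by (rule Cauchy_integral_circlepath[OF cont hol]) simp
  \<comment> \<open>The factor \<open>cis t\<close> of the derivative of the path cancels the
    denominator, leaving \<open>h (cis t) * \<i>\<close>.\<close>
  then have "((\<lambda>t. h (0 + of_real 1 * cis t) / (0 + of_real 1 * cis t - 0) * of_real 1 * \<i> * cis t) has_integral (2 * of_real pi * \<i> * h 0)) {0..2*pi}"
    unfolding circlepath_def by (subst (asm) has_contour_integral_part_circlepath_iff) auto
  then have hi: "((\<lambda>t. h (cis t) * \<i>) has_integral (2 * of_real pi * \<i> * h 0)) {0..2*pi}"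
    by (simp add: field_simps)
  have contc: "continuous_on {0..2*pi} (\<lambda>t. h (cis t))"
    by (rule continuous_on_compose2[OF cont]) (auto intro!: continuous_intros)
  have contn: "continuous_on {0..2*pi} (\<lambda>t. norm (h (cis t)))"
    by (intro continuous_intros contc)
  have io: "(\<lambda>t. norm (h (cis t))) integrable_on {0..2*pi}"
    using contn by (rule integrable_continuous_interval)
  have "norm (integral {0..2*pi} (\<lambda>t. h (cis t) * \<i>)) \<le> integral {0..2*pi} (\<lambda>t. norm (h (cis t)))"
    using hi io by (intro integral_norm_bound_integral) (auto simp: norm_mult)
  then have le: "2 * pi * norm (h 0) \<le> integral {0..2*pi} (\<lambda>t. norm (h (cis t)))"
    using integral_unique[OF hi] by (simp add: norm_mult)
  have "(\<integral>\<^sup>+t\<in>{0..2*pi}. ennreal (norm (h (cis t))) \<partial>lborel) = ennreal (integral {0..2*pi} (\<lambda>t. norm (h (cis t))))"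
  proof -
    have "(\<lambda>t. indicator {0..2*pi} t *\<^sub>R norm (h (cis t))) \<in> borel_measurable borel"
      by (intro borel_measurable_continuous_on_indicator contn) auto
    then have "(\<lambda>t. norm (h (cis t)) * indicator {0..2*pi} t) \<in> borel_measurable borel"
      by (simp add: mult.commute)
    moreover have "((\<lambda>t. norm (h (cis t)) * indicator {0..2*pi} t) has_integral integral {0..2*pi} (\<lambda>t. norm (h (cis t)))) UNIV"
      using has_integral_restrict_UNIV[of "{0..2*pi}" "\<lambda>t. norm (h (cis t))" "integral {0..2*pi} (\<lambda>t. norm (h (cis t)))"] io
      by (simp add: indicator_def of_bool_def if_distrib[of "\<lambda>x. _ * x"] integrable_integral cong: if_cong)
    ultimately have "(\<integral>\<^sup>+t. ennreal (norm (h (cis t)) * indicator {0..2*pi} t) \<partial>lborel) = ennreal (integral {0..2*pi} (\<lambda>t. norm (h (cis t))))"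
      by (intro nn_integral_has_integral_lborel) auto
    then show ?thesis by (simp add: ennreal_mult'' ennreal_indicator)
  qed
  then show ?thesis using le by (simp add: ennreal_mult'[symmetric] mult.commute ennreal_leI)
qed

section \<open>Sub-mean values over circular gauge balls\<close>

lemma continuous_on_vector_scalar_mult [continuous_intros]:
  fixes g :: "'a::topological_space \<Rightarrow> complex^'n::finite"
  assumes "continuous_on S c" "continuous_on S g"
  shows "continuous_on S (\<lambda>x. c x *s g x)"
  unfolding vector_scalar_mult_def by (intro continuous_intros assms)

lemma holo_ball_continuous_on:
  assumes "holo_ball f"
  shows "continuous_on (ball 0 1) f"
proof -
  have "isCont f z" if "z \<in> ball 0 1" for z
    using assms that unfolding holo_ball_def by (meson has_derivative_continuous)
  then show ?thesis by (simp add: continuous_at_imp_continuous_on)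
qed

text \<open>Complex homogeneity of the derivative makes the slice complex differentiable. S may be
  closed, because f is differentiable in a full neighbourhood sense at each point of the
  slice.\<close>

lemma holo_ball_slice:
  fixes f :: "complex^'n::finite \<Rightarrow> complex"
  assumes f: "holo_ball f" and S: "\<And>\<zeta>. \<zeta> \<in> S \<Longrightarrow> a + \<zeta> *s v \<in> ball 0 1"
  shows "(\<lambda>\<zeta>. f (a + \<zeta> *s v)) holomorphic_on S"
proof -
  have "\<exists>D. ((\<lambda>\<zeta>. f (a + \<zeta> *s v)) has_field_derivative D) (at \<zeta> within S)" if \<zeta>: "\<zeta> \<in> S" for \<zeta>
  proof -
    obtain L where L: "(f has_derivative L) (at (a + \<zeta> *s v))" "\<And>c w. L (c *s w) = c * L w"
      using f S[OF \<zeta>] unfolding holo_ball_def by blast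
    have "bounded_linear (\<lambda>\<zeta>. \<zeta> *s v)"
      by (rule bounded_linear_intro[of _ "norm v"])
        (auto simp: vec_eq_iff ring_distribs)
    then have "((\<lambda>\<zeta>. a + \<zeta> *s v) has_derivative (\<lambda>h. 0 + h *s v)) (at \<zeta>)"
      by (intro has_derivative_add has_derivative_const bounded_linear_imp_has_derivative)
    then have "((\<lambda>\<zeta>. f (a + \<zeta> *s v)) has_derivative (\<lambda>h. L (0 + h *s v))) (at \<zeta>)"
      using L(1) by (rule has_derivative_compose[where g = f])
    moreover have "(\<lambda>h. L (0 + h *s v)) = (*) (L v)"
      by (auto simp: L(2) mult.commute)
    ultimately have "((\<lambda>\<zeta>. f (a + \<zeta> *s v)) has_derivative (*) (L v)) (at \<zeta>)"
      by simp
    then have "((\<lambda>\<zeta>. f (a + \<zeta> *s v)) has_field_derivative L v) (at \<zeta>)"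
      by (simp add: has_field_derivative_def)
    then show ?thesis using DERIV_subset by blast
  qed
  then show ?thesis by (auto simp: holomorphic_on_def field_differentiable_def)
qed

text \<open>These are the complex norms on the space, with continuity and the comparison with
  \<open>norm\<close> built in. Homogeneity under complex scalars makes sublevel sets circular, so
  every slice through the centre is a disc; the lower bound makes them compact.\<close>

definition circular_gauge :: "(complex^'n::finite \<Rightarrow> real) \<Rightarrow> bool" where
  "circular_gauge N \<longleftrightarrow> continuous_on UNIV N \<and> (\<forall>v w. N (v + w) \<le> N v + N w)
     \<and> (\<forall>c v. N (c *s v) = norm c * N v) \<and> (\<exists>m>0. \<forall>v. m * norm v \<le> N v)"

lemma circular_gauge_nonneg: "circular_gauge N \<Longrightarrow> 0 \<le> N v"
  unfolding circular_gauge_def by (metis mult_nonneg_nonneg norm_ge_zero order_trans less_imp_le)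

lemma circular_gauge_zero: "circular_gauge N \<Longrightarrow> N 0 = 0"
  unfolding circular_gauge_def by (metis mult_zero_left norm_zero vector_smult_lzero)

lemma circular_gauge_scaleR: "circular_gauge N \<Longrightarrow> N (r *\<^sub>R v) = \<bar>r\<bar> * N v"
proof -
  assume "circular_gauge N"
  then have "N (of_real r *s v) = \<bar>r\<bar> * N v" unfolding circular_gauge_def by (metis norm_of_real)
  moreover have "of_real r *s v = r *\<^sub>R v"
    by (simp add: vec_eq_iff scaleR_conv_of_real[symmetric])
  ultimately show ?thesis by simp
qed

lemma circular_gauge_open:
  assumes "circular_gauge N"
  shows "open {v. N v < \<delta>}"
  using assms unfolding circular_gauge_def by (intro open_Collect_less continuous_on_const) auto

lemma circular_gauge_compact:
  assumes "circular_gauge N"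
  shows "compact {v. N v \<le> \<delta>}"
proof -
  obtain m where m: "m > 0" "\<And>v. m * norm v \<le> N v" using assms unfolding circular_gauge_def by blast
  have "closed {v. N v \<le> \<delta>}"
    using assms unfolding circular_gauge_def by (intro closed_Collect_le continuous_on_const) auto
  moreover have "norm v \<le> \<delta> / m" if "N v \<le> \<delta>" for v
    using m(1) m(2)[of v] that by (simp add: field_simps)
  then have "bounded {v. N v \<le> \<delta>}" unfolding bounded_iff by blast
  ultimately show ?thesis by (simp add: compact_eq_bounded_closed)
qed

lemma circular_gauge_emeasure_finite:
  assumes "circular_gauge N"
  shows "emeasure lborel {v. N v < \<delta>} < \<infinity>"
proof -
  have "bounded {v. N v < \<delta>}"
    by (rule bounded_subset[OF compact_imp_bounded[OF circular_gauge_compact[OF assms, of \<delta>]]]) auto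
  then show ?thesis by (rule emeasure_bounded_finite)
qed

section \<open>Lebesgue measure under translation and dilation\<close>

lemma nn_integral_lborel_translate:
  fixes F :: "'a::euclidean_space \<Rightarrow> ennreal"
  assumes "F \<in> borel_measurable borel"
  shows "(\<integral>\<^sup>+v. F (a + v) \<partial>lborel) = (\<integral>\<^sup>+v. F v \<partial>lborel)"
proof -
  have "distr lborel borel (\<lambda>v. a + v) = lborel" by (rule lborel_distr_plus)
  then have "(\<integral>\<^sup>+v. F v \<partial>lborel) = (\<integral>\<^sup>+v. F v \<partial>distr lborel borel (\<lambda>v. a + v))" by simp
  also have "\<dots> = (\<integral>\<^sup>+v. F (a + v) \<partial>lborel)"
    by (intro nn_integral_distr) (use assms in auto)
  finally show ?thesis by simp
qed

lemma emeasure_lborel_translate_vimage: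
  fixes A :: "'a::euclidean_space set"
  assumes "A \<in> sets borel"
  shows "(+) a -` A \<in> sets borel" "emeasure lborel ((+) a -` A) = emeasure lborel A"
proof -
  have m: "(+) a \<in> borel_measurable borel" by simp
  show "(+) a -` A \<in> sets borel" using measurable_sets_borel[OF m assms] .
  have "emeasure lborel A = emeasure (distr lborel borel ((+) a)) A"
    by (simp only: lborel_distr_plus)
  also have "\<dots> = emeasure lborel ((+) a -` A)"
    by (subst emeasure_distr) (use assms in auto)
  finally show "emeasure lborel ((+) a -` A) = emeasure lborel A" ..
qed

lemma emeasure_lborel_scale_vimage:
  fixes A :: "'a::euclidean_space set"
  assumes c: "c > 0" and [measurable]: "A \<in> sets borel"
  shows "emeasure lborel A = ennreal (c ^ DIM('a)) * emeasure lborel {x. c *\<^sub>R x \<in> A}"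
proof -
  have "emeasure lborel A = emeasure (density (distr lborel borel (\<lambda>x. 0 + c *\<^sub>R x)) (\<lambda>_. \<bar>c\<bar>^DIM('a))) A"
    using c lborel_affine[of c "0::'a"] by simp
  also have "\<dots> = ennreal (c ^ DIM('a)) * emeasure (distr lborel borel (\<lambda>x. c *\<^sub>R x)) A"
    using c by (subst emeasure_density_const) auto
  also have "emeasure (distr lborel borel (\<lambda>x. c *\<^sub>R x)) A = emeasure lborel {x. c *\<^sub>R x \<in> A}"
    by (subst emeasure_distr) (auto simp: vimage_def)
  finally show ?thesis .
qed

lemma circular_gauge_emeasure_scale:
  fixes N :: "complex^'n::finite \<Rightarrow> real"
  assumes N: "circular_gauge N" and d: "\<delta> > 0"
  shows "emeasure lborel {v. N v < \<delta>} = ennreal (\<delta> ^ DIM(complex^'n)) * emeasure lborel {v. N v < 1}"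
proof -
  have "{x. \<delta> *\<^sub>R x \<in> {v. N v < \<delta>}} = {v. N v < 1}"
    using d by (auto simp: circular_gauge_scaleR[OF N])
  then show ?thesis
    using emeasure_lborel_scale_vimage[OF d, of "{v. N v < \<delta>}"] circular_gauge_open[OF N] by simp
qed

text \<open>Nothing is known about u off the unit ball, so measurability on the whole space holds
  only after cutting with an indicator.\<close>

lemma borel_measurable_shifted_indicator:
  fixes u :: "'a::euclidean_space \<Rightarrow> real"
  assumes "continuous_on (ball 0 1) u" "open E" "\<And>v. v \<in> E \<Longrightarrow> w + v \<in> ball 0 1"
  shows "(\<lambda>v. ennreal (u (w + v)) * indicator E v) \<in> borel_measurable borel"
proof -
  have "continuous_on E (\<lambda>v. u (w + v))"
    by (rule continuous_on_compose2[OF assms(1)]) (auto intro!: continuous_intros dest: assms(3))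
  then have "(\<lambda>v. indicator E v *\<^sub>R u (w + v)) \<in> borel_measurable borel"
    by (rule borel_measurable_continuous_on_indicator[rotated]) (use assms in auto)
  then have "(\<lambda>v. ennreal (indicator E v *\<^sub>R u (w + v))) \<in> borel_measurable borel" by simp
  moreover have "(\<lambda>v. ennreal (indicator E v *\<^sub>R u (w + v))) = (\<lambda>v. ennreal (u (w + v)) * indicator E v)"
    by (auto simp: indicator_def)
  ultimately show ?thesis by simp
qed

text \<open>Averaging over the circles \<open>cis t *s v\<close> gives the estimate for each v;
  integrating in v and exchanging the integrals, rotation invariance makes the inner integral
  independent of t, and the length 2 pi of the parameter interval cancels.\<close>

lemma holo_ball_submean:
  fixes f :: "complex^'n::finite \<Rightarrow> complex"
  assumes f: "holo_ball f" and N: "circular_gauge N" and sub: "\<And>v. N v < \<delta> \<Longrightarrow> w + v \<in> ball 0 1"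
  shows "ennreal (norm (f w)) * emeasure lborel {v. N v < \<delta>}
           \<le> (\<integral>\<^sup>+v. ennreal (norm (f (w + v))) * indicator {v. N v < \<delta>} v \<partial>lborel)"
proof -
  let ?E = "{v. N v < \<delta>}"
  define F where "F v = ennreal (norm (f (w + v))) * indicator ?E v" for v
  have Nc: "N (c *s v) = norm c * N v" for c v using N unfolding circular_gauge_def by blast
  have Em [measurable]: "?E \<in> sets borel" using circular_gauge_open[OF N] by (rule borel_open)
  have Fm [measurable]: "F \<in> borel_measurable borel"
    unfolding F_def
    by (rule borel_measurable_shifted_indicator)
      (use holo_ball_continuous_on[OF f] circular_gauge_open[OF N] sub in \<open>auto intro!: continuous_intros\<close>)
  \<comment> \<open>The mean value inequality for the slice through w in direction v; its closed
    unit disc stays in \<open>?E\<close> by homogeneity of N.\<close>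
  have pt: "ennreal (norm (f w)) * ennreal (2*pi) * indicator ?E v
      \<le> (\<integral>\<^sup>+t. F (cis t *s v) * indicator {0..2*pi} t \<partial>lborel)" for v
  proof (cases "v \<in> ?E")
    case True
    have in_E: "\<zeta> *s v \<in> ?E" if "norm \<zeta> \<le> 1" for \<zeta>
      using True that circular_gauge_nonneg[OF N, of v] mult_right_mono[of "norm \<zeta>" 1 "N v"] by (simp add: Nc)
    then have hol: "(\<lambda>\<zeta>. f (w + \<zeta> *s v)) holomorphic_on (cball 0 1)"
      by (intro holo_ball_slice[OF f] sub) auto
    have "ennreal (norm (f w)) * ennreal (2 * pi) \<le> (\<integral>\<^sup>+t\<in>{0..2*pi}. ennreal (norm (f (w + cis t *s v))) \<partial>lborel)"
      using circle_mean_value_le[of "\<lambda>\<zeta>. f (w + \<zeta> *s v)"] holomorphic_on_imp_continuous_on[OF hol]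
        holomorphic_on_subset[OF hol] by auto
    also have "\<dots> = (\<integral>\<^sup>+t. F (cis t *s v) * indicator {0..2*pi} t \<partial>lborel)"
      using in_E by (intro nn_integral_cong) (auto simp: F_def)
    finally show ?thesis using True by simp
  qed auto
  have jm: "(\<lambda>x. F (cis (fst x) *s snd x) * indicator {0..2*pi} (fst x)) \<in> borel_measurable (lborel \<Otimes>\<^sub>M lborel)"
  proof -
    have "(\<lambda>x. cis (fst x) *s (snd x :: complex^'n)) \<in> borel_measurable borel"
      by (intro borel_measurable_continuous_onI continuous_intros)
    then have [measurable]: "(\<lambda>x. cis (fst x) *s (snd x :: complex^'n)) \<in> borel_measurable (borel \<Otimes>\<^sub>M borel)"
      by (simp add: borel_prod)
    show ?thesis by measurable
  qed
  have "ennreal (2*pi) * (ennreal (norm (f w)) * emeasure lborel ?E)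
      = (\<integral>\<^sup>+v. ennreal (norm (f w)) * ennreal (2*pi) * indicator ?E v \<partial>lborel)"
    by (subst nn_integral_cmult_indicator) (auto simp: mult_ac)
  also have "\<dots> \<le> (\<integral>\<^sup>+v. (\<integral>\<^sup>+t. F (cis t *s v) * indicator {0..2*pi} t \<partial>lborel) \<partial>lborel)"
    by (intro nn_integral_mono pt)
  also have "\<dots> = (\<integral>\<^sup>+t. (\<integral>\<^sup>+v. F (cis t *s v) * indicator {0..2*pi} t \<partial>lborel) \<partial>lborel)"
    using lborel_pair.Fubini[OF jm] by simp
  also have "\<dots> = (\<integral>\<^sup>+t. (\<integral>\<^sup>+v. F v \<partial>lborel) * indicator {0..2*pi} t \<partial>lborel)"
  proof (intro nn_integral_cong)
    fix t :: real
    have "(\<lambda>v::complex^'n. cis t *s v) \<in> borel_measurable borel"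
      by (intro borel_measurable_continuous_onI continuous_intros)
    then have [measurable]: "(\<lambda>v. F (cis t *s v)) \<in> borel_measurable borel" by measurable
    have "(\<integral>\<^sup>+v. F (cis t *s v) * indicator {0..2*pi} t \<partial>lborel) = (\<integral>\<^sup>+v. F (cis t *s v) \<partial>lborel) * indicator {0..2*pi} t"
      by (rule nn_integral_multc) simp
    then show "(\<integral>\<^sup>+v. F (cis t *s v) * indicator {0..2*pi} t \<partial>lborel) = (\<integral>\<^sup>+v. F v \<partial>lborel) * indicator {0..2*pi} t"
      by (simp add: nn_integral_lborel_rotation)
  qed
  also have "\<dots> = ennreal (2*pi) * (\<integral>\<^sup>+v. F v \<partial>lborel)"
    by (subst nn_integral_cmult_indicator) (auto simp: mult.commute)
  finally show ?thesis
    by (subst (asm) ennreal_mult_le_mult_iff) (auto simp: F_def[abs_def])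
qed

section \<open>Growth functions\<close>

text \<open>The common ground of the two classes: lower class p gives exponents (p, 1), upper class
  q gives (1, q). The estimates for single spaces use nothing else about \<Phi>.\<close>

definition two_sided_type :: "real \<Rightarrow> real \<Rightarrow> real \<Rightarrow> (real \<Rightarrow> real) \<Rightarrow> bool" where
  "two_sided_type p q C \<Phi> \<longleftrightarrow> growth_fun \<Phi> \<and> 0 < p \<and> 0 < q \<and> 1 \<le> C \<and> (\<forall>s>0. 0 < \<Phi> s)
     \<and> (\<forall>s>0. \<forall>t\<ge>1. \<Phi> (s * t) \<le> C * t powr q * \<Phi> s)
     \<and> (\<forall>s>0. \<forall>t. 0 < t \<and> t \<le> 1 \<longrightarrow> \<Phi> (s * t) \<le> C * t powr p * \<Phi> s)"

lemma two_sided_type_lower: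
  "two_sided_type p q C \<Phi> \<Longrightarrow> 0 < s \<Longrightarrow> 0 < t \<Longrightarrow> t \<le> 1 \<Longrightarrow> \<Phi> (s * t) \<le> C * t powr p * \<Phi> s"
  by (auto simp: two_sided_type_def)

lemma two_sided_type_upper:
  "two_sided_type p q C \<Phi> \<Longrightarrow> 0 < s \<Longrightarrow> 1 \<le> t \<Longrightarrow> \<Phi> (s * t) \<le> C * t powr q * \<Phi> s"
  by (auto simp: two_sided_type_def)

lemma growth_fun_mono: "growth_fun \<Phi> \<Longrightarrow> 0 \<le> s \<Longrightarrow> s \<le> t \<Longrightarrow> \<Phi> s \<le> \<Phi> t"
  by (auto simp: growth_fun_def mono_on_def)

lemma growth_fun_nonneg: "growth_fun \<Phi> \<Longrightarrow> 0 \<le> s \<Longrightarrow> 0 \<le> \<Phi> s"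
  unfolding growth_fun_def by (metis atLeast_iff image_eqI)

lemma growth_fun_zero:
  assumes "growth_fun \<Phi>" shows "\<Phi> 0 = 0"
proof -
  have "0 \<in> \<Phi> ` {0..}" using assms by (simp add: growth_fun_def)
  then obtain t where "t \<ge> 0" "\<Phi> t = 0" by auto
  then show ?thesis using growth_fun_mono[OF assms, of 0 t] growth_fun_nonneg[OF assms, of 0] by simp
qed

text \<open>Lower type 1 is the monotonicity of \<Phi>(t)/t. A zero of \<Phi> at some s in (0,1)
  would, by upper type with factor 1/s, force \<Phi>(1) = 0.\<close>

lemma classU_two_sided_type:
  assumes "classU q \<Phi>" shows "\<exists>C. two_sided_type 1 q C \<Phi>"
proof -
  obtain C where C: "C > 0" "\<And>s t. s > 0 \<Longrightarrow> t \<ge> 1 \<Longrightarrow> \<Phi> (s * t) \<le> C * t powr q * \<Phi> s"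
    using assms unfolding classU_def upper_type_def by blast
  have g: "growth_fun \<Phi>" "q \<ge> 1" "mono_on {0<..} (\<lambda>t. \<Phi> t / t)" using assms by (auto simp: classU_def)
  have pos: "0 < \<Phi> s" if "s > 0" for s
  proof (cases "s \<ge> 1")
    case True
    then show ?thesis using growth_fun_mono[OF g(1), of 1 s] g(1) by (simp add: growth_fun_def)
  next
    case False
    then have "1 \<le> C * (1/s) powr q * \<Phi> s"
      using C(2)[of s "1/s"] that g(1) by (simp add: growth_fun_def)
    then show ?thesis using C(1) growth_fun_nonneg[OF g(1), of s] that
      by (cases "\<Phi> s = 0") auto
  qed
  have lo: "\<Phi> (s * t) \<le> t * \<Phi> s" if "s > 0" "0 < t" "t \<le> 1" for s t
  proof -
    have "\<Phi> (s * t) / (s * t) \<le> \<Phi> s / s"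
      using g(3) that by (intro mono_onD[OF g(3)]) (auto simp: mult_le_cancel_left1)
    then show ?thesis using that by (simp add: field_simps)
  qed
  have "two_sided_type 1 q (max 1 C) \<Phi>"
    unfolding two_sided_type_def
  proof (intro conjI allI impI)
    fix s t :: real assume "0 < s" "1 \<le> t"
    have "\<Phi> (s * t) \<le> C * t powr q * \<Phi> s" using C \<open>0 < s\<close> \<open>1 \<le> t\<close> by auto
    also have "\<dots> \<le> max 1 C * t powr q * \<Phi> s"
      using pos[OF \<open>0 < s\<close>] by (intro mult_right_mono) auto
    finally show "\<Phi> (s * t) \<le> max 1 C * t powr q * \<Phi> s" .
  next
    fix s t :: real assume *: "0 < s" "0 < t \<and> t \<le> 1"
    have "\<Phi> (s * t) \<le> 1 * (t * \<Phi> s)" using lo * by auto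
    also have "\<dots> \<le> max 1 C * (t * \<Phi> s)"
      using pos[OF \<open>0 < s\<close>] * by (intro mult_right_mono) auto
    finally show "\<Phi> (s * t) \<le> max 1 C * t powr 1 * \<Phi> s" using * by (simp add: mult_ac)
  qed (use g pos in auto)
  then show ?thesis ..
qed

text \<open>The mirror image: upper type 1 comes from the monotonicity of \<Phi>(t)/t, and comparing
  s with 1 then gives \<Phi>(s) \<ge> s below 1.\<close>

lemma classL_two_sided_type:
  assumes "classL p \<Phi>" shows "\<exists>C. two_sided_type p 1 C \<Phi>"
proof -
  obtain C where C: "C > 0" "\<And>s t. s > 0 \<Longrightarrow> 0 < t \<Longrightarrow> t \<le> 1 \<Longrightarrow> \<Phi> (s * t) \<le> C * t powr p * \<Phi> s"
    using assms unfolding classL_def lower_type_def by blast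
  have g: "growth_fun \<Phi>" "p > 0" "antimono_on {0<..} (\<lambda>t. \<Phi> t / t)" using assms by (auto simp: classL_def)
  have up: "\<Phi> (s * t) \<le> t * \<Phi> s" if "s > 0" "1 \<le> t" for s t
  proof -
    have "\<Phi> (s * t) / (s * t) \<le> \<Phi> s / s"
      using that by (intro monotone_onD[OF g(3)]) (auto simp: mult_le_cancel_left1)
    then show ?thesis using that by (simp add: field_simps)
  qed
  have pos: "0 < \<Phi> s" if "s > 0" for s
  proof (cases "s \<ge> 1")
    case True
    then show ?thesis using growth_fun_mono[OF g(1), of 1 s] g(1) by (simp add: growth_fun_def)
  next
    case False
    then have "1 \<le> (1/s) * \<Phi> s"
      using up[of s "1/s"] that g(1) by (simp add: growth_fun_def)
    then show ?thesis using that by (simp add: field_simps)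
  qed
  have "two_sided_type p 1 (max 1 C) \<Phi>"
    unfolding two_sided_type_def
  proof (intro conjI allI impI)
    fix s t :: real assume "0 < s" "1 \<le> t"
    have "\<Phi> (s * t) \<le> 1 * (t * \<Phi> s)" using up \<open>0 < s\<close> \<open>1 \<le> t\<close> by auto
    also have "\<dots> \<le> max 1 C * (t * \<Phi> s)"
      using pos[OF \<open>0 < s\<close>] \<open>1 \<le> t\<close> by (intro mult_right_mono) auto
    finally show "\<Phi> (s * t) \<le> max 1 C * t powr 1 * \<Phi> s" using \<open>1 \<le> t\<close> by (simp add: mult_ac)
  next
    fix s t :: real assume *: "0 < s" "0 < t \<and> t \<le> 1"
    have "\<Phi> (s * t) \<le> C * t powr p * \<Phi> s" using C * by auto
    also have "\<dots> \<le> max 1 C * t powr p * \<Phi> s"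
      using pos[OF \<open>0 < s\<close>] * by (intro mult_right_mono) auto
    finally show "\<Phi> (s * t) \<le> max 1 C * t powr p * \<Phi> s" .
  qed (use g pos in auto)
  then show ?thesis ..
qed

text \<open>The exponent \<open>\<kappa>\<close> is chosen so that the weight at the maximum point compensates the volume of the
  shrunken gauge ball there, which replaces convexity of \<open>\<Phi>\<close>.\<close>

lemma holo_ball_growth_submean:
  assumes \<Phi>: "two_sided_type p q C \<Phi>"
  shows "\<exists>A>0. \<forall>(f :: complex^'n::finite \<Rightarrow> complex) N z. holo_ball f \<longrightarrow> circular_gauge N \<longrightarrow>
     (\<forall>v. N v \<le> 1 \<longrightarrow> z + v \<in> ball 0 1) \<longrightarrow>
     ennreal (\<Phi> (norm (f z))) * emeasure lborel {v. N v < 1}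
       \<le> ennreal A * (\<integral>\<^sup>+v. ennreal (\<Phi> (norm (f (z + v)))) * indicator {v. N v < 1} v \<partial>lborel)"
proof -
  define D where "D = DIM(complex^'n)"
  define \<kappa> where "\<kappa> = D / p"
  \<comment> \<open>The factor 2^\<kappa> bounds f near the maximum point of \<open>G\<close>
    relative to its size y there; C 2^q is the price of halving the argument of \<Phi>.\<close>
  define B where "B = 2 powr \<kappa> * C * 2 powr q"
  have pq: "p > 0" "q > 0" "C \<ge> 1" and g: "growth_fun \<Phi>" and pos: "\<And>s. s > 0 \<Longrightarrow> 0 < \<Phi> s"
    and up: "\<And>s t. s > 0 \<Longrightarrow> t \<ge> 1 \<Longrightarrow> \<Phi> (s * t) \<le> C * t powr q * \<Phi> s"
    and lo: "\<And>s t. s > 0 \<Longrightarrow> 0 < t \<Longrightarrow> t \<le> 1 \<Longrightarrow> \<Phi> (s * t) \<le> C * t powr p * \<Phi> s"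
    using \<Phi> by (auto simp: two_sided_type_def)
  have kp: "\<kappa> > 0" using pq by (simp add: \<kappa>_def D_def DIM_positive)
  have Bp: "B > 0" using pq by (simp add: B_def)
  define A where "A = C * 2 ^ D * (2 * B)"
  have Ap: "A > 0" using Bp pq by (simp add: A_def)
  have main: "ennreal (\<Phi> (norm (f z))) * emeasure lborel {v. N v < 1}
       \<le> ennreal A * (\<integral>\<^sup>+v. ennreal (\<Phi> (norm (f (z + v)))) * indicator {v. N v < 1} v \<partial>lborel)"
    if f: "holo_ball f" and N: "circular_gauge N" and sub: "\<And>v. N v \<le> 1 \<Longrightarrow> z + v \<in> ball 0 1"
    for f :: "complex^'n \<Rightarrow> complex" and N z
  proof -
    let ?K = "{v. N v \<le> 1}"
    define G where "G v = (1 - N v) powr \<kappa> * norm (f (z + v))" for v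
    have N0: "N 0 = 0" by (rule circular_gauge_zero[OF N])
    have Nadd: "N (v + w) \<le> N v + N w" for v w using N by (auto simp: circular_gauge_def)
    have Nge: "0 \<le> N v" for v by (rule circular_gauge_nonneg[OF N])
    have Nc: "continuous_on S N" for S
      using N continuous_on_subset[of UNIV N S] by (auto simp: circular_gauge_def)
    have fc: "continuous_on ?K (\<lambda>v. f (z + v))"
      by (rule continuous_on_compose2[OF holo_ball_continuous_on[OF f]])
        (auto intro!: continuous_intros dest: sub)
    have Gc: "continuous_on ?K G"
      unfolding G_def using kp by (intro continuous_intros continuous_on_powr' Nc fc) auto
    have "0 \<in> ?K" by (simp add: N0)
    then obtain v0 where v0: "v0 \<in> ?K" and max: "\<And>v. v \<in> ?K \<Longrightarrow> G v \<le> G v0"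
      using continuous_attains_sup[OF circular_gauge_compact[OF N] _ Gc] by blast
    define y where "y = norm (f (z + v0))"
    show ?thesis
    proof (cases "G v0 = 0")
      case True
      then have "norm (f z) \<le> 0" using max[OF \<open>0 \<in> ?K\<close>] by (auto simp: N0 G_def)
      then have "\<Phi> (norm (f z)) = 0" by (simp add: growth_fun_zero[OF g])
      then show ?thesis by simp
    next
      case False
      then have y: "y > 0" and Nv0: "N v0 < 1"
        using v0 by (auto simp: G_def y_def less_le)
      \<comment> \<open>Half the gauge distance of v0 from the boundary: within gauge distance
        \<delta> of v0 the weight in \<open>G\<close> drops by at most the factor 2^\<kappa>, so
        maximality of \<open>G\<close> at v0 controls f by y.\<close>
      define \<delta> where "\<delta> = (1 - N v0) / 2"
      have d: "\<delta> > 0" "2 * \<delta> \<le> 1" "1 - N v0 = 2 * \<delta>" using Nv0 Nge[of v0] by (auto simp: \<delta>_def)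
      have shift: "N (v0 + u) < 1 - \<delta>" if "N u < \<delta>" for u
        using Nadd[of v0 u] that d by simp
      have bound: "norm (f (z + v0 + u)) \<le> 2 powr \<kappa> * y" if "N u < \<delta>" for u
      proof -
        have "\<delta> powr \<kappa> * norm (f (z + v0 + u)) \<le> (1 - N (v0 + u)) powr \<kappa> * norm (f (z + v0 + u))"
          using shift[OF that] d kp by (intro mult_right_mono powr_mono2) auto
        also have "\<dots> \<le> (2 * \<delta>) powr \<kappa> * y"
          using max[of "v0 + u"] shift[OF that] d by (simp add: G_def y_def add.assoc)
        also have "\<dots> = \<delta> powr \<kappa> * (2 powr \<kappa> * y)" using d by (simp add: powr_mult)
        finally show ?thesis using d by (simp add: mult_le_cancel_left_pos)
      qed
      let ?E = "{u. N u < \<delta>}"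
      have Eo: "open ?E" by (rule circular_gauge_open[OF N])
      have Em [measurable]: "?E \<in> sets borel" using Eo by (rule borel_open)
      have sub': "z + v0 + u \<in> ball 0 1" if "N u < \<delta>" for u
        using sub[of "v0 + u"] shift[OF that] d by (simp add: add.assoc)
      have \<Phi>fc: "continuous_on (ball 0 1) (\<lambda>z. \<Phi> (norm (f z)))"
        using g holo_ball_continuous_on[OF f] unfolding growth_fun_def
        by (intro continuous_on_compose2[of "{0..}" \<Phi> _ "\<lambda>z. norm (f z)"]) (auto intro!: continuous_intros)
      define I where "I = (\<integral>\<^sup>+u. ennreal (\<Phi> (norm (f (z + v0 + u)))) * indicator ?E u \<partial>lborel)"
      define e where "e = measure lborel ?E"
      have eE: "emeasure lborel ?E = ennreal e" "e \<ge> 0"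
        using circular_gauge_emeasure_finite[OF N, of \<delta>] by (auto simp: e_def emeasure_eq_ennreal_measure less_top[symmetric])
      \<comment> \<open>Split the mean of \<open>norm f\<close> at the level y/2. The lower part is
        absorbed into the left side. On the upper part \<Phi>(y) is at most C 2^q \<Phi>(X), and X
        \<le> 2^\<kappa> y, so X is bounded by a multiple of (y/\<Phi>(y)) \<Phi>(X): linear means
        become means of \<Phi>.\<close>
      have key: "\<Phi> y * e \<le> 2 * B * i" if i: "I = ennreal i" "i \<ge> 0" for i
      proof -
        have pt: "ennreal (norm (f (z + v0 + u))) * indicator ?E u
            \<le> ennreal (y/2) * indicator ?E u + ennreal (B * y / \<Phi> y) * (ennreal (\<Phi> (norm (f (z + v0 + u)))) * indicator ?E u)" for u
        proof (cases "u \<in> ?E")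
          case True
          define X where "X = norm (f (z + v0 + u))"
          have "X \<le> y/2 + B * y / \<Phi> y * \<Phi> X"
          proof (cases "X < y/2")
            case True
            then show ?thesis using Bp y pos[OF y] growth_fun_nonneg[OF g, of X]
              by (smt (verit) X_def divide_nonneg_pos mult_nonneg_nonneg norm_ge_zero)
          next
            case False
            have "\<Phi> y \<le> C * 2 powr q * \<Phi> (y/2)" using up[of "y/2" 2] y by simp
            also have "\<dots> \<le> C * 2 powr q * \<Phi> X"
              using False pq y by (intro mult_left_mono growth_fun_mono[OF g]) auto
            finally have 1: "\<Phi> y \<le> C * 2 powr q * \<Phi> X" .
            have "X \<le> 2 powr \<kappa> * y" using bound True by (simp add: X_def)
            also have "\<dots> = (2 powr \<kappa> * y / \<Phi> y) * \<Phi> y" using pos[OF y] by simp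
            also have "\<dots> \<le> (2 powr \<kappa> * y / \<Phi> y) * (C * 2 powr q * \<Phi> X)"
              using 1 y pos[OF y] by (intro mult_left_mono) auto
            also have "\<dots> = B * y / \<Phi> y * \<Phi> X" by (simp add: B_def)
            finally show ?thesis using y by simp
          qed
          then have "ennreal X \<le> ennreal (y/2 + B * y / \<Phi> y * \<Phi> X)" by (rule ennreal_leI)
          also have "\<dots> = ennreal (y/2) + ennreal (B * y / \<Phi> y) * ennreal (\<Phi> X)"
            using y Bp pos[OF y] growth_fun_nonneg[OF g, of X]
            by (simp add: ennreal_plus ennreal_mult[symmetric] X_def)
          finally show ?thesis using True by (simp add: X_def)
        qed auto
        have [measurable]: "(\<lambda>u. ennreal (\<Phi> (norm (f (z + v0 + u)))) * indicator ?E u) \<in> borel_measurable borel"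
          by (rule borel_measurable_shifted_indicator[OF \<Phi>fc Eo]) (use sub' in auto)
        have "ennreal y * ennreal e \<le> (\<integral>\<^sup>+u. ennreal (norm (f (z + v0 + u))) * indicator ?E u \<partial>lborel)"
          unfolding y_def eE(1)[symmetric] by (rule holo_ball_submean[OF f N sub'])
        also have "\<dots> \<le> (\<integral>\<^sup>+u. ennreal (y/2) * indicator ?E u + ennreal (B * y / \<Phi> y) * (ennreal (\<Phi> (norm (f (z + v0 + u)))) * indicator ?E u) \<partial>lborel)"
          by (intro nn_integral_mono pt)
        also have "\<dots> = ennreal (y/2) * ennreal e + ennreal (B * y / \<Phi> y) * I"
          by (subst nn_integral_add) (auto simp: nn_integral_cmult I_def nn_integral_cmult_indicator eE)
        also have "\<dots> = ennreal (y/2 * e + B * y / \<Phi> y * i)"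
          using y Bp pos[OF y] i eE by (simp add: ennreal_plus ennreal_mult[symmetric])
        finally have "ennreal (y * e) \<le> ennreal (y/2 * e + B * y / \<Phi> y * i)"
          by (metis ennreal_mult' less_imp_le y)
        moreover have "0 \<le> y/2 * e + B * y / \<Phi> y * i"
          using y Bp pos[OF y] i eE by simp
        ultimately have "y * e \<le> y/2 * e + B * y / \<Phi> y * i"
          by (simp only: ennreal_le_iff)
        then have "y * e \<le> y * (e / 2 + B / \<Phi> y * i)" by (simp add: algebra_simps)
        then have "e \<le> e / 2 + B / \<Phi> y * i" using y by (simp only: mult_le_cancel_left_pos)
        then show ?thesis using pos[OF y] by (simp add: field_simps)
      qed
      have scale: "e = \<delta> ^ D * measure lborel {v. N v < 1}"
        using circular_gauge_emeasure_scale[OF N d(1)] d by (simp add: e_def measure_def enn2real_mult D_def)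
      define e1 where "e1 = measure lborel {v. N v < 1}"
      have e1: "emeasure lborel {v. N v < 1} = ennreal e1" "e1 \<ge> 0"
        using circular_gauge_emeasure_finite[OF N, of 1] by (auto simp: e1_def emeasure_eq_ennreal_measure less_top[symmetric])
      let ?J = "(\<integral>\<^sup>+v. ennreal (\<Phi> (norm (f (z + v)))) * indicator {v. N v < 1} v \<partial>lborel)"
      have IJ: "I \<le> ?J"
      proof -
        have sub1: "{u. N (u - v0) < \<delta>} \<subseteq> {v. N v < 1}" using shift d by (fastforce dest: shift)
        have o: "open {u. N (u - v0) < \<delta>}"
          by (intro open_Collect_less continuous_on_compose2[OF Nc[of UNIV]] continuous_intros) auto
        have m: "(\<lambda>u. ennreal (\<Phi> (norm (f (z + u)))) * indicator {u. N (u - v0) < \<delta>} u) \<in> borel_measurable borel"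
          by (rule borel_measurable_shifted_indicator[OF \<Phi>fc o]) (use sub1 sub in force)
        have "I = (\<integral>\<^sup>+u. ennreal (\<Phi> (norm (f (z + (v0 + u))))) * indicator {u. N (u - v0) < \<delta>} (v0 + u) \<partial>lborel)"
          unfolding I_def by (intro nn_integral_cong) (auto simp: add.assoc indicator_def)
        also have "\<dots> = (\<integral>\<^sup>+u. ennreal (\<Phi> (norm (f (z + u)))) * indicator {u. N (u - v0) < \<delta>} u \<partial>lborel)"
          using nn_integral_lborel_translate[OF m, of v0] by simp
        also have "\<dots> \<le> ?J" using sub1 by (intro nn_integral_mono) (auto simp: indicator_def)
        finally show ?thesis .
      qed
      \<comment> \<open>Here \<kappa> = D/p pays off: the weight (2 \<delta>)^\<kappa>, raised to
        the lower exponent p, is (2 \<delta>)^D, and \<delta>^D is the volume ratio of the small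
        gauge ball to the unit one.\<close>
      have fz: "\<Phi> (norm (f z)) \<le> C * (2 * \<delta>) ^ D * \<Phi> y"
      proof -
        have "norm (f z) \<le> y * (2 * \<delta>) powr \<kappa>" using max[OF \<open>0 \<in> ?K\<close>] d by (simp add: G_def N0 y_def mult.commute)
        then have "\<Phi> (norm (f z)) \<le> \<Phi> (y * (2 * \<delta>) powr \<kappa>)" by (intro growth_fun_mono[OF g]) auto
        also have "\<dots> \<le> C * ((2 * \<delta>) powr \<kappa>) powr p * \<Phi> y"
          using d kp y by (intro lo) (auto intro!: powr_le1)
        also have "((2 * \<delta>) powr \<kappa>) powr p = (2 * \<delta>) ^ D"
          using d pq by (simp add: powr_powr \<kappa>_def powr_realpow)
        finally show ?thesis .
      qed
      show ?thesis
      proof (cases "I = \<infinity>")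
        case True
        then have "?J = \<infinity>" using IJ by (simp add: top_unique)
        then show ?thesis using Ap by (simp add: ennreal_mult_top)
      next
        case False
        then obtain i where i: "I = ennreal i" "i \<ge> 0" by (cases I) auto
        have "\<Phi> (norm (f z)) * e1 \<le> C * (2 * \<delta>) ^ D * \<Phi> y * e1"
          using fz e1 by (intro mult_right_mono)
        also have "\<dots> = C * 2 ^ D * (\<Phi> y * e)" by (simp add: scale e1_def power_mult_distrib)
        also have "\<dots> \<le> C * 2 ^ D * (2 * B * i)" using key[OF i] pq by (intro mult_left_mono) auto
        also have "\<dots> = A * i" by (simp add: A_def)
        finally have "ennreal (\<Phi> (norm (f z)) * e1) \<le> ennreal (A * i)" by (rule ennreal_leI)
        then have "ennreal (\<Phi> (norm (f z))) * ennreal e1 \<le> ennreal A * I"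
          using i Ap e1 growth_fun_nonneg[OF g, of "norm (f z)"] by (simp add: ennreal_mult)
        also have "\<dots> \<le> ennreal A * ?J" by (intro mult_left_mono IJ) auto
        finally show ?thesis by (simp add: e1)
      qed
    qed
  qed
  show ?thesis using Ap main by blast
qed

section \<open>The pointwise estimate\<close>

definition cinner :: "complex^'n::finite \<Rightarrow> complex^'n \<Rightarrow> complex" where
  "cinner v z = (\<Sum>i\<in>UNIV. v $ i * cnj (z $ i))"

lemma cinner_add: "cinner (v + w) z = cinner v z + cinner w z"
  by (simp add: cinner_def sum.distrib ring_distribs)

lemma cinner_diff: "cinner (v - w) z = cinner v z - cinner w z"
  by (simp add: cinner_def sum_subtractf ring_distribs)

lemma cinner_scale: "cinner (c *s v) z = c * cinner v z"
  by (simp add: cinner_def sum_distrib_left mult.assoc)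

lemma Re_cinner: "Re (cinner v z) = inner v z"
  by (simp add: cinner_def inner_vec_def inner_complex_def)

lemma norm_cinner_le: "norm (cinner v z) \<le> norm v * norm z"
proof (cases "cinner v z = 0")
  case False
  \<comment> \<open>Rotating v by u makes the product real and non-negative, which reduces the claim
    to the real Cauchy-Schwarz inequality.\<close>
  define u where "u = cnj (cinner v z) / norm (cinner v z)"
  have u: "norm u = 1" using False by (simp add: u_def norm_divide)
  have "cnj (cinner v z) * cinner v z = of_real ((norm (cinner v z))\<^sup>2)"
    by (metis complex_norm_square mult.commute)
  then have "u * cinner v z = of_real (norm (cinner v z))"
    using False by (simp add: u_def power2_eq_square)
  then have "norm (cinner v z) = Re (cinner (u *s v) z)"
    by (simp add: cinner_scale)
  also have "\<dots> \<le> norm (u *s v) * norm z" unfolding Re_cinner by (rule norm_cauchy_schwarz)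
  finally show ?thesis by (simp add: u)
qed simp

lemma cinner_self: "cinner z z = of_real ((norm z)\<^sup>2)"
proof -
  have "Im (cinner z z) = 0" by (simp add: cinner_def)
  then show ?thesis by (simp add: complex_eq_iff Re_cinner power2_norm_eq_inner)
qed

lemma continuous_on_cinner [continuous_intros]:
  assumes "continuous_on S f" shows "continuous_on S (\<lambda>x. cinner (f x) z)"
  unfolding cinner_def by (intro continuous_intros assms)

lemma norm_one_minus_cinner_ge:
  assumes "norm z \<le> 1" shows "1 - norm a \<le> norm (1 - cinner z a)" "1 - norm z * norm a \<le> norm (1 - cinner z a)"
proof -
  have "1 - norm (cinner z a) \<le> norm (1 - cinner z a)"
    using norm_triangle_ineq2[of 1 "cinner z a"] by simp
  then show "1 - norm z * norm a \<le> norm (1 - cinner z a)" using norm_cinner_le[of z a] by linarith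
  moreover have "norm z * norm a \<le> norm a" using assms by (simp add: mult_left_le_one_le)
  ultimately show "1 - norm a \<le> norm (1 - cinner z a)" by linarith
qed

text \<open>With \<open>d = 1 - norm z\<close>, the unit ball of this gauge has extent of order \<open>d\<close> in the complex
  direction of \<open>z\<close> and of order \<open>sqrt d\<close> in the orthogonal ones: a substitute for a Bergman ball that
  needs no automorphisms.\<close>

definition koranyi_gauge :: "complex^'n::finite \<Rightarrow> complex^'n \<Rightarrow> real" where
  "koranyi_gauge z v = max (norm (cinner v z) / ((1 - norm z) / 6)) (norm v / sqrt ((1 - norm z) / 6))"

lemma circular_gauge_koranyi:
  assumes "norm z < 1" shows "circular_gauge (koranyi_gauge z)"
  unfolding circular_gauge_def
proof (intro conjI allI)
  let ?d = "1 - norm z"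
  have d: "?d > 0" using assms by simp
  show "continuous_on UNIV (koranyi_gauge z)"
    unfolding koranyi_gauge_def using d by (intro continuous_intros) auto
  show "koranyi_gauge z (v + w) \<le> koranyi_gauge z v + koranyi_gauge z w" for v w
  proof -
    have "norm (cinner (v + w) z) / (?d/6) \<le> norm (cinner v z) / (?d/6) + norm (cinner w z) / (?d/6)"
      using d by (subst add_divide_distrib[symmetric], intro divide_right_mono) (auto simp: cinner_add norm_triangle_ineq)
    moreover have "norm (v + w) / sqrt (?d/6) \<le> norm v / sqrt (?d/6) + norm w / sqrt (?d/6)"
      using d by (subst add_divide_distrib[symmetric], intro divide_right_mono) (auto simp: norm_triangle_ineq)
    ultimately show ?thesis unfolding koranyi_gauge_def by linarith
  qed
  show "koranyi_gauge z (c *s v) = norm c * koranyi_gauge z v" for c v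
    unfolding koranyi_gauge_def cinner_scale norm_mult norm_vector_scalar_mult
    by (simp add: max_mult_distrib_left)
  show "\<exists>m>0. \<forall>v. m * norm v \<le> koranyi_gauge z v"
    by (rule exI[of _ "1 / sqrt (?d/6)"]) (use d in \<open>auto simp: koranyi_gauge_def\<close>)
qed

text \<open>Expanding \<open>norm (z + v)\<close> squared, the gauge bounds the mixed term by d/3
  and the square of v by d/6. Since 1 - |z|^2 = 2d - d^2 \<ge> d, at least d/2 remains; this
  explains the divisor 6 in the gauge. All distances to the sphere in the gauge ball are thus
  comparable to d.\<close>

lemma koranyi_gauge_le_1:
  assumes z: "norm z < 1" and "koranyi_gauge z v \<le> 1"
  shows "z + v \<in> ball 0 1" "(1 - norm z) / 4 \<le> 1 - norm (z + v)" "1 - norm (z + v) \<le> 3 * (1 - norm z)"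
proof -
  define d where "d = 1 - norm z"
  have d: "d > 0" "d \<le> 1" using z by (auto simp: d_def)
  have 1: "norm (cinner v z) \<le> d / 6" and 2: "norm v \<le> sqrt (d / 6)"
    using assms d by (auto simp: koranyi_gauge_def d_def[symmetric] divide_le_eq)
  have v2: "(norm v)\<^sup>2 \<le> d / 6" using 2 d by (metis norm_ge_zero power_mono real_sqrt_pow2_iff divide_nonneg_nonneg less_imp_le zero_le_numeral)
  have r: "\<bar>inner v z\<bar> \<le> d / 6" using 1 abs_Re_le_cmod[of "cinner v z"] by (simp add: Re_cinner)
  have e: "(norm (z + v))\<^sup>2 = (norm z)\<^sup>2 + 2 * inner v z + (norm v)\<^sup>2"
    by (simp add: power2_norm_eq_inner inner_add_left inner_add_right inner_commute)
  have z2: "(norm z)\<^sup>2 = 1 - 2 * d + d\<^sup>2" by (simp add: d_def power2_eq_square algebra_simps)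
  have d2: "d\<^sup>2 \<le> d" using d by (simp add: power2_eq_square mult_left_le_one_le)
  have lo: "d / 2 \<le> 1 - (norm (z + v))\<^sup>2" using e r v2 z2 d2 by linarith
  have hi: "1 - (norm (z + v))\<^sup>2 \<le> 3 * d" using e r z2 d zero_le_power2[of d] zero_le_power2[of "norm v"] by linarith
  have "(norm (z + v))\<^sup>2 < 1\<^sup>2" using lo d by simp
  then have lt: "norm (z + v) < 1" by (rule power2_less_imp_less) simp
  then show "z + v \<in> ball 0 1" by simp
  have f: "1 - (norm (z + v))\<^sup>2 = (1 - norm (z + v)) * (1 + norm (z + v))"
    by (simp add: power2_eq_square algebra_simps)
  have "(1 - norm (z + v)) * (1 + norm (z + v)) \<le> (1 - norm (z + v)) * 2"
    using lt by (intro mult_left_mono) auto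
  then have "d / 2 \<le> (1 - norm (z + v)) * 2" using lo unfolding f by linarith
  then show "(1 - norm z) / 4 \<le> 1 - norm (z + v)" by (simp add: d_def)
  have "(1 - norm (z + v)) * 1 \<le> (1 - norm (z + v)) * (1 + norm (z + v))"
    using lt by (intro mult_left_mono) auto
  then have "1 - norm (z + v) \<le> 3 * d" using hi unfolding f mult_1_right by (rule order_trans)
  then show "1 - norm (z + v) \<le> 3 * (1 - norm z)" by (simp add: d_def)
qed

text \<open>A Euclidean ball of radius comparable to \<open>sqrt d\<close> is covered by \<open>O(1/d)\<close> translates of the
  gauge ball, one for each cell of side \<open>d/12\<close> containing the value of \<open>cinner v z\<close>.\<close>

lemma koranyi_gauge_ball_volume:
  "\<exists>A>0. \<forall>z::complex^'n::finite. norm z < 1 \<longrightarrow>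
     ennreal ((1 - norm z) ^ (CARD('n) + 1)) \<le> ennreal A * emeasure lborel {v. koranyi_gauge z v < 1}"
proof -
  define n where "n = CARD('n)"
  define V where "V = unit_ball_vol (real (2 * n))"
  have V: "V > 0" by (simp add: V_def)
  define A where "A = 64 * 24 ^ n / V"
  have A: "A > 0" using V by (simp add: A_def)
  have "ennreal ((1 - norm z) ^ (n + 1)) \<le> ennreal A * emeasure lborel {v. koranyi_gauge z v < 1}"
    if z: "norm z < 1" for z :: "complex^'n"
  proof -
    define d where "d = 1 - norm z"
    have d: "d > 0" "d \<le> 1" using z by (auto simp: d_def)
    \<comment> \<open>R and h match the two parts of the gauge: points of \<open>ball 0 R\<close>
      differ by less than 2R = sqrt(d/6), and two values of \<open>cinner\<close> in one cell of
      side h differ by less than 2h = d/6.\<close>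
    define R where "R = sqrt (d / 24)"
    define h where "h = d / 12"
    define M where "M = \<lceil>R / h\<rceil>"
    have R: "R > 0" "R\<^sup>2 = d / 24" and h: "h > 0" using d by (auto simp: R_def h_def)
    have R2: "2 * R = sqrt (d / 6)"
    proof -
      have "2 * R = sqrt 4 * sqrt (d/24)" by (simp add: R_def)
      also have "\<dots> = sqrt (d / 6)" by (subst real_sqrt_mult[symmetric]) simp
      finally show ?thesis .
    qed
    define P where "P = (\<lambda>(k::int, l::int). {v \<in> ball (0::complex^'n) R. \<lfloor>Re (cinner v z) / h\<rfloor> = k \<and> \<lfloor>Im (cinner v z) / h\<rfloor> = l})"
    \<comment> \<open>For an empty cell \<open>c i\<close> is arbitrary. This is harmless:
      \<open>cov\<close> uses only cells met by the ball, and the volume of \<open>Q i\<close> does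
      not depend on its centre.\<close>
    define c where "c i = (SOME v. v \<in> P i)" for i
    define I where "I = {-M..M} \<times> {-M..M}"
    let ?E = "{v. koranyi_gauge z v < 1}"
    define Q where "Q i = {v. koranyi_gauge z (v - c i) < 1}" for i
    have same_cell: "\<bar>x - y\<bar> < h" if "\<lfloor>x / h\<rfloor> = \<lfloor>y / h\<rfloor>" for x y
    proof -
      have "\<bar>x / h - y / h\<bar> < 1" using that by linarith
      then have "\<bar>(x - y) / h\<bar> < 1" by (simp add: diff_divide_distrib)
      then show ?thesis using h by (simp add: abs_divide divide_less_eq)
    qed
    have cov: "ball 0 R \<subseteq> (\<Union>i\<in>I. Q i)"
    proof
      fix v :: "complex^'n" assume v: "v \<in> ball 0 R"
      define i where "i = (\<lfloor>Re (cinner v z) / h\<rfloor>, \<lfloor>Im (cinner v z) / h\<rfloor>)"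
      have vP: "v \<in> P i" using v by (simp add: P_def i_def)
      then have cP: "c i \<in> P i" unfolding c_def by (rule someI)
      have "norm (cinner v z) \<le> norm v * norm z" by (rule norm_cinner_le)
      also have "\<dots> \<le> norm v" using z by (simp add: mult_right_le_one_le)
      finally have "norm (cinner v z) \<le> R" using v by simp
      then have "\<bar>Re (cinner v z)\<bar> \<le> R" "\<bar>Im (cinner v z)\<bar> \<le> R"
        using abs_Re_le_cmod[of "cinner v z"] abs_Im_le_cmod[of "cinner v z"] by auto
      then have "\<bar>Re (cinner v z) / h\<bar> \<le> R / h" "\<bar>Im (cinner v z) / h\<bar> \<le> R / h"
        using h by (auto simp: abs_divide intro!: divide_right_mono)
      moreover have "- \<lceil>T\<rceil> \<le> \<lfloor>x\<rfloor> \<and> \<lfloor>x\<rfloor> \<le> \<lceil>T\<rceil>" if "\<bar>x\<bar> \<le> T" for x T :: real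
        using that by linarith
      ultimately have "i \<in> I" unfolding i_def I_def M_def by (simp del: abs_divide)
      moreover have "koranyi_gauge z (v - c i) < 1"
      proof -
        have "\<bar>Re (cinner (v - c i) z)\<bar> < h" "\<bar>Im (cinner (v - c i) z)\<bar> < h"
          using vP cP same_cell[of "Re (cinner v z)" "Re (cinner (c i) z)"] same_cell[of "Im (cinner v z)" "Im (cinner (c i) z)"]
          by (auto simp: P_def i_def cinner_diff)
        then have 1: "norm (cinner (v - c i) z) < d / 6"
          using cmod_le[of "cinner (v - c i) z"] by (simp add: h_def)
        have "norm (v - c i) \<le> norm v + norm (c i)" by (rule norm_triangle_ineq4)
        also have "\<dots> < 2 * R" using vP cP by (auto simp: P_def i_def)
        finally have 2: "norm (v - c i) < sqrt (d / 6)" by (simp add: R2)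
        show ?thesis using 1 2 d by (simp add: koranyi_gauge_def d_def[symmetric] divide_less_eq)
      qed
      ultimately show "v \<in> (\<Union>i\<in>I. Q i)" by (auto simp: Q_def)
    qed
    have Em: "?E \<in> sets borel"
      using circular_gauge_open[OF circular_gauge_koranyi[OF z]] by (rule borel_open)
    have Q: "Q i \<in> sets borel" "emeasure lborel (Q i) = emeasure lborel ?E" for i
    proof -
      have eq: "Q i = (+) (- c i) -` ?E" by (auto simp: Q_def)
      show "Q i \<in> sets borel" "emeasure lborel (Q i) = emeasure lborel ?E"
        unfolding eq by (rule emeasure_lborel_translate_vimage[OF Em])+
    qed
    have fin: "finite I" by (simp add: I_def)
    have "0 \<le> R / h" using R h by simp
    then have M0: "M \<ge> 0" unfolding M_def by linarith
    \<comment> \<open>R/h has order d^(-1/2), and there are two real coordinates. The 8 behind 64 is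
      5 + 3: twice sqrt 6 is at most 5, and the rounding costs at most 3, where 1 \<le> 1/sqrt
      d.\<close>
    have card: "real (card I) \<le> 64 / d"
    proof -
      have "real (card I) = (2 * of_int M + 1)\<^sup>2"
        using M0 by (simp add: I_def card_cartesian_product power2_eq_square)
      also have "\<dots> \<le> (2 * (R / h) + 3)\<^sup>2"
      proof (rule power_mono)
        show "2 * real_of_int M + 1 \<le> 2 * (R / h) + 3" unfolding M_def by linarith
      qed (use M0 in auto)
      also have "\<dots> \<le> (8 / sqrt d)\<^sup>2"
      proof (rule power_mono)
        have "2 * R / h * sqrt d = 2 * (sqrt 6)"
        proof -
          have "2 * R / h * sqrt d = sqrt (d/6) * sqrt d * 12 / d" by (simp add: R2 h_def)
          also have "sqrt (d/6) * sqrt d = d / sqrt 6"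
            using d by (simp add: real_sqrt_divide)
          also have "d / sqrt 6 * 12 / d = 2 * sqrt 6" using d by (simp add: field_simps)
          finally show ?thesis .
        qed
        moreover have "sqrt 6 \<le> (5/2::real)" by (rule real_le_lsqrt) (auto simp: power2_eq_square)
        moreover have "sqrt d \<le> 1" using d by simp
        moreover have "(2 * (R / h) + 3) * sqrt d = 2 * R / h * sqrt d + 3 * sqrt d"
          by (simp add: algebra_simps)
        ultimately have "(2 * (R / h) + 3) * sqrt d \<le> 8" by linarith
        then show "2 * (R / h) + 3 \<le> 8 / sqrt d" using d by (simp add: pos_le_divide_eq)
        show "0 \<le> 2 * (R / h) + 3" using R h by simp
      qed
      also have "\<dots> = 64 / d" using d by (simp add: power_divide)
      finally show ?thesis .
    qed
    have "ennreal (V * R ^ (2 * n)) = emeasure lborel (ball (0::complex^'n) R)"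
      using R by (simp add: emeasure_ball V_def n_def mult.commute)
    also have "\<dots> \<le> emeasure lborel (\<Union>i\<in>I. Q i)"
      using cov Q(1) fin by (intro emeasure_mono) (auto intro!: sets.finite_UN)
    also have "\<dots> \<le> (\<Sum>i\<in>I. emeasure lborel (Q i))"
      using Q(1) fin by (intro emeasure_subadditive_finite) auto
    also have "\<dots> = ennreal (real (card I)) * emeasure lborel ?E"
      by (simp add: Q(2) ennreal_of_nat_eq_real_of_nat)
    also have "\<dots> \<le> ennreal (64 / d) * emeasure lborel ?E"
      using card by (intro mult_right_mono ennreal_leI) auto
    finally have *: "ennreal (V * R ^ (2 * n)) \<le> ennreal (64 / d) * emeasure lborel ?E" .
    have Rn: "R ^ (2 * n) = d ^ n / 24 ^ n" by (simp only: power_mult R power_divide)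
    have "ennreal (d ^ (n + 1)) = ennreal (24 ^ n * d / V) * ennreal (V * R ^ (2 * n))"
      unfolding Rn using d V by (subst ennreal_mult[symmetric]) (auto simp: field_simps)
    also have "\<dots> \<le> ennreal (24 ^ n * d / V) * (ennreal (64 / d) * emeasure lborel ?E)"
      by (intro mult_left_mono *) auto
    also have "\<dots> = ennreal A * emeasure lborel ?E"
    proof -
      have "24 ^ n * d / V * (64 / d) = A" using d by (simp add: A_def)
      then have "ennreal (24 ^ n * d / V) * ennreal (64 / d) = ennreal A"
        using d V by (subst ennreal_mult[symmetric]) auto
      then show ?thesis by (simp add: mult.assoc[symmetric])
    qed
    finally show ?thesis by (simp add: d_def)
  qed
  with A show ?thesis by (auto simp: n_def)
qed

text \<open>The measure of \<open>nu_alpha\<close> without its normalisation and with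
  \<open>1 - norm z\<close> in place of the difference of squares;
  \<open>nu_alpha_weighted_integral\<close> shows that both give comparable integrals.\<close>

definition weighted_integral :: "real \<Rightarrow> (complex^'n::finite \<Rightarrow> real) \<Rightarrow> ennreal" where
  "weighted_integral \<alpha> u = (\<integral>\<^sup>+z. ennreal (u z * (1 - norm z) powr \<alpha>) * indicator (ball 0 1) z \<partial>lborel)"

text \<open>The sub-mean inequality over the anisotropic ball at z: its volume is at least of order
  d^(n+1), and on it the weight is comparable to d^\<alpha>. Together they give the exponent n + 1 +
  \<alpha>.\<close>

lemma holo_ball_growth_pointwise:
  assumes \<Phi>: "two_sided_type p q C \<Phi>"
  shows "\<exists>A>0. \<forall>(f :: complex^'n::finite \<Rightarrow> complex) z. holo_ball f \<longrightarrow> z \<in> ball 0 1 \<longrightarrow>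
     ennreal (\<Phi> (norm (f z))) \<le> ennreal (A * (1 - norm z) powr (-(real CARD('n) + 1 + \<alpha>))) *
        weighted_integral \<alpha> (\<lambda>z. \<Phi> (norm (f z)))"
proof -
  define n where "n = CARD('n)"
  obtain A1 where A1: "A1 > 0" and sub: "\<And>(f :: complex^'n \<Rightarrow> complex) N z. holo_ball f \<Longrightarrow> circular_gauge N \<Longrightarrow>
     (\<forall>v. N v \<le> 1 \<longrightarrow> z + v \<in> ball 0 1) \<Longrightarrow>
     ennreal (\<Phi> (norm (f z))) * emeasure lborel {v. N v < 1}
       \<le> ennreal A1 * (\<integral>\<^sup>+v. ennreal (\<Phi> (norm (f (z + v)))) * indicator {v. N v < 1} v \<partial>lborel)"
    using holo_ball_growth_submean[OF \<Phi>] by blast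
  obtain A2 where A2: "A2 > 0" and vol: "\<And>z::complex^'n. norm z < 1 \<Longrightarrow>
     ennreal ((1 - norm z) ^ (n + 1)) \<le> ennreal A2 * emeasure lborel {v. koranyi_gauge z v < 1}"
    unfolding n_def using koranyi_gauge_ball_volume by blast
  define A where "A = A1 * A2 * 4 powr \<bar>\<alpha>\<bar>"
  have A: "A > 0" using A1 A2 by (simp add: A_def)
  have g: "growth_fun \<Phi>" using \<Phi> by (simp add: two_sided_type_def)
  have "ennreal (\<Phi> (norm (f z))) \<le> ennreal (A * (1 - norm z) powr (-(real n + 1 + \<alpha>))) *
        weighted_integral \<alpha> (\<lambda>z. \<Phi> (norm (f z)))"
    if f: "holo_ball f" and z: "z \<in> ball 0 1" for f :: "complex^'n \<Rightarrow> complex" and z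
  proof -
    define d where "d = 1 - norm z"
    have d: "d > 0" using z by (auto simp: d_def)
    let ?N = "koranyi_gauge z"
    let ?E = "{v. ?N v < 1}"
    let ?W = "weighted_integral \<alpha> (\<lambda>z. \<Phi> (norm (f z)))"
    define G where "G w = ennreal (\<Phi> (norm (f w)) * (1 - norm w) powr \<alpha>) * indicator (ball 0 1) w" for w
    have N: "circular_gauge ?N" using z by (intro circular_gauge_koranyi) simp
    have nz: "norm z < 1" using z by simp
    note K = koranyi_gauge_le_1[OF nz]
    have \<Phi>fc: "continuous_on (ball 0 1) (\<lambda>z. \<Phi> (norm (f z)))"
      using g holo_ball_continuous_on[OF f] unfolding growth_fun_def
      by (intro continuous_on_compose2[of "{0..}" \<Phi> _ "\<lambda>z. norm (f z)"]) (auto intro!: continuous_intros)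
    have Gm [measurable]: "G \<in> borel_measurable borel"
    proof -
      have c: "continuous_on (ball 0 1) (\<lambda>z. \<Phi> (norm (f z)) * (1 - norm z) powr \<alpha>)"
        by (intro continuous_intros \<Phi>fc) auto
      show ?thesis using borel_measurable_shifted_indicator[OF c open_ball[of 0 1], of 0] by (simp add: G_def[abs_def])
    qed
    have pt: "ennreal (\<Phi> (norm (f (z + v)))) * indicator ?E v \<le> ennreal (4 powr \<bar>\<alpha>\<bar> * d powr (-\<alpha>)) * G (z + v)" for v
    proof (cases "v \<in> ?E")
      case True
      then have v: "?N v \<le> 1" by simp
      define r where "r = (1 - norm (z + v)) / d"
      \<comment> \<open>A range symmetric under r -> 1/r lets the single factor 4^|\<alpha>| serve
        both signs of \<alpha>.\<close>
      have r: "1/4 \<le> r" "r \<le> 4" using K[OF v] d by (auto simp: r_def d_def[symmetric] field_simps)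
      have "1 \<le> 4 powr \<bar>\<alpha>\<bar> * r powr \<alpha>"
      proof (cases "\<alpha> \<ge> 0")
        case True
        have "1 \<le> (4 * r) powr \<alpha>" using r True by (intro ge_one_powr_ge_zero) auto
        then show ?thesis using True r by (simp add: powr_mult)
      next
        case False
        have "1 \<le> (4 / r) powr (-\<alpha>)" using r False by (intro ge_one_powr_ge_zero) auto
        also have "\<dots> = 4 powr \<bar>\<alpha>\<bar> * r powr \<alpha>" using r False by (simp add: powr_divide powr_minus field_simps)
        finally show ?thesis .
      qed
      also have "\<dots> = 4 powr \<bar>\<alpha>\<bar> * d powr (-\<alpha>) * (1 - norm (z + v)) powr \<alpha>"
        using d K(1)[OF v] by (simp add: r_def powr_divide powr_minus field_simps)
      finally have "\<Phi> (norm (f (z + v))) * 1 \<le> \<Phi> (norm (f (z + v))) * (4 powr \<bar>\<alpha>\<bar> * d powr (-\<alpha>) * (1 - norm (z + v)) powr \<alpha>)"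
        by (intro mult_left_mono growth_fun_nonneg[OF g]) auto
      then have "ennreal (\<Phi> (norm (f (z + v)))) \<le> ennreal (4 powr \<bar>\<alpha>\<bar> * d powr (-\<alpha>) * (\<Phi> (norm (f (z + v))) * (1 - norm (z + v)) powr \<alpha>))"
        by (intro ennreal_leI) (simp add: mult_ac)
      also have "\<dots> = ennreal (4 powr \<bar>\<alpha>\<bar> * d powr (-\<alpha>)) * ennreal (\<Phi> (norm (f (z + v))) * (1 - norm (z + v)) powr \<alpha>)"
        by (rule ennreal_mult') simp
      finally show ?thesis using True K(1)[OF v] by (simp add: G_def)
    qed simp
    have "(\<integral>\<^sup>+v. ennreal (\<Phi> (norm (f (z + v)))) * indicator ?E v \<partial>lborel)
        \<le> (\<integral>\<^sup>+v. ennreal (4 powr \<bar>\<alpha>\<bar> * d powr (-\<alpha>)) * G (z + v) \<partial>lborel)"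
      by (intro nn_integral_mono pt)
    also have "\<dots> = ennreal (4 powr \<bar>\<alpha>\<bar> * d powr (-\<alpha>)) * (\<integral>\<^sup>+v. G (z + v) \<partial>lborel)"
      by (intro nn_integral_cmult) measurable
    also have "(\<integral>\<^sup>+v. G (z + v) \<partial>lborel) = ?W"
      by (subst nn_integral_lborel_translate[OF Gm]) (simp add: weighted_integral_def G_def[abs_def])
    finally have I: "(\<integral>\<^sup>+v. ennreal (\<Phi> (norm (f (z + v)))) * indicator ?E v \<partial>lborel) \<le> ennreal (4 powr \<bar>\<alpha>\<bar> * d powr (-\<alpha>)) * ?W" .
    let ?\<phi> = "ennreal (\<Phi> (norm (f z)))"
    let ?c = "ennreal (d powr (-(real n + 1)))"
    have "d powr (real n + 1) = d ^ (n + 1)"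
      using d powr_realpow[of d "n + 1"] by (simp add: add.commute)
    then have "d powr (-(real n + 1)) = inverse (d ^ (n + 1))"
      by (simp only: powr_minus)
    then have "d powr (-(real n + 1)) * d ^ (n + 1) = 1"
      using d by (metis left_inverse less_irrefl power_not_zero)
    then have "?c * ennreal (d ^ (n + 1)) = 1"
      using d by (subst ennreal_mult[symmetric]) auto
    then have "?\<phi> = ?c * (?\<phi> * ennreal (d ^ (n + 1)))" by (simp add: mult.left_commute)
    also have "\<dots> \<le> ?c * (?\<phi> * (ennreal A2 * emeasure lborel ?E))"
      using vol[OF nz] by (intro mult_left_mono) (auto simp: d_def)
    also have "\<dots> = ?c * ennreal A2 * (?\<phi> * emeasure lborel ?E)" by (simp add: mult_ac)
    also have "\<dots> \<le> ?c * ennreal A2 * (ennreal A1 * (ennreal (4 powr \<bar>\<alpha>\<bar> * d powr (-\<alpha>)) * ?W))"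
      using sub[OF f N] K(1) by (intro mult_left_mono order_trans[OF _ mult_left_mono[OF I]]) auto
    also have "\<dots> = ennreal (d powr (-(real n + 1)) * A2 * A1 * (4 powr \<bar>\<alpha>\<bar> * d powr (-\<alpha>))) * ?W"
      using A1 A2 by (simp add: ennreal_mult mult.assoc)
    also have "d powr (-(real n + 1)) * A2 * A1 * (4 powr \<bar>\<alpha>\<bar> * d powr (-\<alpha>)) = A * d powr (-(real n + 1 + \<alpha>))"
    proof -
      have "d powr (-(real n + 1 + \<alpha>)) = d powr (-(real n + 1)) * d powr (-\<alpha>)"
        by (simp add: powr_add[symmetric])
      then show ?thesis by (simp add: A_def mult_ac)
    qed
    finally show ?thesis by (simp add: d_def)
  qed
  with A show ?thesis by (auto simp: n_def)
qed

section \<open>Volumes of caps and the kernel integral\<close>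

text \<open>Translates of the cap \<open>S\<close> by the points \<open>(4sk + 8i\<delta>l) a\<close> are pairwise disjoint: different \<open>l\<close> are
  separated by the imaginary part of \<open>cinner z a\<close>, and for equal \<open>l\<close> the translate with the larger \<open>k\<close>
  has left the unit ball.\<close>

lemma ball_cap_volume:
  "\<exists>A>0. \<forall>(a::complex^'n::finite) \<delta> s. norm a < 1 \<longrightarrow> 0 < \<delta> \<longrightarrow> \<delta> \<le> 1/2 \<longrightarrow> 0 < s \<longrightarrow>
     emeasure lborel {z \<in> ball 0 1. norm (1 - cinner z a) < \<delta> \<and> 1 - norm z < s} \<le> ennreal (A * \<delta> ^ CARD('n) * s)"
proof -
  define n where "n = CARD('n)"
  define V where "V = unit_ball_vol (real (2 * n))"
  have V: "V > 0" by (simp add: V_def)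
  define A where "A = 32 * 16 ^ n * V"
  have A: "A > 0" using V by (simp add: A_def)
  have "emeasure lborel {z \<in> ball 0 1. norm (1 - cinner z a) < \<delta> \<and> 1 - norm z < s} \<le> ennreal (A * \<delta> ^ n * s)"
    if a: "norm a < 1" and \<delta>: "0 < \<delta>" "\<delta> \<le> 1/2" and s: "0 < s" for a :: "complex^'n" and \<delta> s
  proof -
    let ?S = "{z \<in> ball 0 1. norm (1 - cinner z a) < \<delta> \<and> 1 - norm z < s}"
    \<comment> \<open>The cap lies within 2r of a. K and L are the largest indices for which the
      real and the imaginary part of the shift stay below r, so all translates remain within 4r of
      a.\<close>
    define r where "r = sqrt \<delta>"
    have r: "r > 0" "r * r = \<delta>" using \<delta> by (auto simp: r_def)
    define K where "K = nat \<lfloor>r / (4 * s)\<rfloor>"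
    define L where "L = nat \<lfloor>1 / (8 * r)\<rfloor>"
    define I where "I = {0..K} \<times> {0..L}"
    define \<zeta> where "\<zeta> = (\<lambda>(k::nat, l::nat). Complex (4 * s * k) (8 * \<delta> * l))"
    define Q where "Q i = {z. - (\<zeta> i *s a) + z \<in> ?S}" for i
    have Sm: "?S \<in> sets borel"
    proof -
      have "open {z. norm (1 - cinner z a) < \<delta>}" "open {z::complex^'n. 1 - norm z < s}"
        by (intro open_Collect_less continuous_intros)+
      then have "open (ball 0 1 \<inter> {z. norm (1 - cinner z a) < \<delta>} \<inter> {z. 1 - norm z < s})" by auto
      also have "ball 0 1 \<inter> {z. norm (1 - cinner z a) < \<delta>} \<inter> {z. 1 - norm z < s} = ?S" by auto
      finally show ?thesis by (rule borel_open)
    qed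
    have S_Re: "1 - \<delta> < Re (cinner z a)" and S_Im: "\<bar>Im (cinner z a)\<bar> < \<delta>" if "z \<in> ?S" for z
      using that abs_Re_le_cmod[of "1 - cinner z a"] abs_Im_le_cmod[of "1 - cinner z a"] by auto
    \<comment> \<open>A point in the cap prevents a from being short. Hence a shift \<zeta> a moves
      \<open>Im (cinner z a)\<close> by at least a quarter of \<open>Im \<zeta>\<close>, and spacing
      8 \<delta> exceeds the width 2 \<delta> of the cap.\<close>
    have S_a: "1/4 \<le> (norm a)\<^sup>2" if "z \<in> ?S" for z
    proof -
      have "1/2 \<le> norm (cinner z a)" using S_Re[OF that] \<delta> complex_Re_le_cmod[of "cinner z a"] by linarith
      also have "\<dots> \<le> norm z * norm a" by (rule norm_cinner_le)
      also have "\<dots> \<le> norm a" using that by (simp add: mult_left_le_one_le)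
      finally have "(1/2)\<^sup>2 \<le> (norm a)\<^sup>2" by (intro power_mono) auto
      then show ?thesis by (simp add: power2_eq_square)
    qed
    \<comment> \<open>Moving from z' by t a adds at least t \<ge> 4s to the squared norm, which
      already exceeds 1 - 2s, so the new point leaves the unit ball.\<close>
    have radial: False if z: "z \<in> ?S" and z': "z' \<in> ?S" and e: "z = z' + of_real t *s a" and t: "t \<ge> 4 * s" for z z' t
    proof -
      have "of_real t *s a = t *\<^sub>R a" by (simp add: vec_eq_iff scaleR_conv_of_real[symmetric])
      then have "(norm z)\<^sup>2 = (norm z')\<^sup>2 + 2 * t * Re (cinner z' a) + t\<^sup>2 * (norm a)\<^sup>2"
        unfolding e Re_cinner power2_norm_eq_inner
        by (simp add: inner_add_left inner_add_right inner_commute power2_eq_square algebra_simps)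
      moreover have "2 * t * (1/2) \<le> 2 * t * Re (cinner z' a)"
        using S_Re[OF z'] \<delta> t s by (intro mult_left_mono) auto
      moreover have "0 \<le> t\<^sup>2 * (norm a)\<^sup>2" by simp
      moreover have "2 * norm z' - 1 \<le> (norm z')\<^sup>2"
        using zero_le_power2[of "norm z' - 1"] by (simp add: power2_eq_square algebra_simps)
      moreover have "1 - s < norm z'" using z' by simp
      ultimately have "1 < (norm z)\<^sup>2" using t s by linarith
      moreover have "(norm z)\<^sup>2 \<le> 1" using z by (simp add: power_le_one)
      ultimately show False by simp
    qed
    have disj: "disjoint_family_on Q I"
      unfolding disjoint_family_on_def
    proof (intro ballI impI)
      fix i j :: "nat \<times> nat" assume ij: "i \<noteq> j"
      show "Q i \<inter> Q j = {}"
      proof (rule ccontr)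
        assume "Q i \<inter> Q j \<noteq> {}"
        then obtain w where w: "w \<in> Q i" "w \<in> Q j" by auto
        obtain k l k' l' where kl: "i = (k, l)" "j = (k', l')" by (metis prod.exhaust)
        define z z' where "z = - (\<zeta> i *s a) + w" and "z' = - (\<zeta> j *s a) + w"
        have z: "z \<in> ?S" "z' \<in> ?S" using w by (auto simp: Q_def z_def z'_def)
        have e: "z = z' + (\<zeta> j - \<zeta> i) *s a" by (simp add: z_def z'_def vec_eq_iff algebra_simps)
        have "cinner z a = cinner z' a + (\<zeta> j - \<zeta> i) * of_real ((norm a)\<^sup>2)"
        proof -
          have "cinner (z' + c *s a) a = cinner z' a + c * of_real ((norm a)\<^sup>2)" for c
            by (simp add: cinner_add cinner_scale cinner_self)
          from this[of "\<zeta> j - \<zeta> i"] show ?thesis unfolding e[symmetric] .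
        qed
        then have "Im (cinner z a) - Im (cinner z' a) = Im (\<zeta> j - \<zeta> i) * (norm a)\<^sup>2" by simp
        then have "\<bar>Im (\<zeta> j - \<zeta> i)\<bar> * (norm a)\<^sup>2 < 2 * \<delta>"
          using S_Im[OF z(1)] S_Im[OF z(2)] by (simp flip: abs_mult_pos)
        moreover have "\<bar>Im (\<zeta> j - \<zeta> i)\<bar> * (1/4) \<le> \<bar>Im (\<zeta> j - \<zeta> i)\<bar> * (norm a)\<^sup>2"
          using S_a[OF z(1)] by (intro mult_left_mono) auto
        ultimately have "\<bar>Im (\<zeta> j - \<zeta> i)\<bar> < 8 * \<delta>" by linarith
        moreover have "\<bar>Im (\<zeta> j - \<zeta> i)\<bar> = 8 * \<delta> * \<bar>real l' - real l\<bar>"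
          using \<delta> by (simp add: kl \<zeta>_def abs_mult flip: right_diff_distrib)
        ultimately have "\<bar>real l' - real l\<bar> < 1" using \<delta> by simp
        then have l: "l = l'" by linarith
        then have kk: "k \<noteq> k'" using ij kl by simp
        have \<zeta>d: "\<zeta> j - \<zeta> i = of_real (4 * s * (real k' - real k))"
          by (simp add: kl l \<zeta>_def complex_eq_iff algebra_simps)
        show False
        proof (cases "k < k'")
          case True
          then have "4 * s * 1 \<le> 4 * s * (real k' - real k)" using s by (intro mult_left_mono) auto
          then show False using radial[OF z(1,2) e[unfolded \<zeta>d]] by simp
        next
          case False
          then have "4 * s * 1 \<le> 4 * s * (real k - real k')" using s kk by (intro mult_left_mono) auto
          moreover have e': "z' = z + of_real (4 * s * (real k - real k')) *s a"
            using e unfolding \<zeta>d by (simp add: vec_eq_iff algebra_simps)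
          ultimately show False by (intro radial[OF z(2,1) e']) simp
        qed
      qed
    qed
    have sub: "Q i \<subseteq> ball a (4 * r)" if i: "i \<in> I" for i
    proof
      fix w assume w: "w \<in> Q i"
      obtain k l where kl: "i = (k, l)" by (metis prod.exhaust)
      define z where "z = - (\<zeta> i *s a) + w"
      have z: "z \<in> ?S" using w by (simp add: Q_def z_def)
      have "(norm (z - a))\<^sup>2 = (norm z)\<^sup>2 + (norm a)\<^sup>2 - 2 * Re (cinner z a)"
        unfolding Re_cinner by (simp add: power2_norm_eq_inner inner_diff_left inner_diff_right inner_commute)
      moreover have "(norm z)\<^sup>2 \<le> 1" "(norm a)\<^sup>2 \<le> 1" using z a by (auto simp: power_le_one)
      ultimately have "(norm (z - a))\<^sup>2 < 2 * \<delta>" using S_Re[OF z] by linarith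
      also have "\<dots> \<le> (2 * r)\<^sup>2" using r \<delta> by (simp add: power2_eq_square)
      finally have 1: "norm (z - a) < 2 * r" by (rule power2_less_imp_less) (use r in auto)
      have "4 * s * real k \<le> r"
      proof -
        have "k \<le> K" using i by (simp add: kl I_def)
        then have "real k \<le> r / (4 * s)"
          using of_nat_floor[of "r / (4 * s)"] r s unfolding K_def by (simp add: order_trans[OF of_nat_mono])
        then show ?thesis using s by (simp add: field_simps)
      qed
      moreover have "8 * \<delta> * real l \<le> r"
      proof -
        have "l \<le> L" using i by (simp add: kl I_def)
        then have "real l \<le> 1 / (8 * r)"
          using of_nat_floor[of "1 / (8 * r)"] r unfolding L_def by (simp add: order_trans[OF of_nat_mono])
        then have "8 * \<delta> * real l \<le> 8 * \<delta> * (1 / (8 * r))" using \<delta> by (intro mult_left_mono) auto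
        also have "\<dots> = r" using r by (simp add: field_simps)
        finally show ?thesis .
      qed
      ultimately have "norm (\<zeta> i) \<le> 2 * r"
        using cmod_le[of "\<zeta> i"] s \<delta> by (simp add: kl \<zeta>_def)
      moreover have "norm (\<zeta> i *s a) \<le> norm (\<zeta> i)" using a by (simp add: mult_right_le_one_le)
      ultimately have 2: "norm (\<zeta> i *s a) \<le> 2 * r" by linarith
      have "norm (w - a) = norm ((z - a) + \<zeta> i *s a)" by (simp add: z_def)
      also have "\<dots> \<le> norm (z - a) + norm (\<zeta> i *s a)" by (rule norm_triangle_ineq)
      also have "\<dots> < 4 * r" using 1 2 by simp
      finally show "w \<in> ball a (4 * r)" by (simp add: dist_norm norm_minus_commute)
    qed
    have Q: "Q i \<in> sets borel" "emeasure lborel (Q i) = emeasure lborel ?S" for i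
    proof -
      have eq: "Q i = (+) (- (\<zeta> i *s a)) -` ?S" by (simp only: Q_def vimage_def)
      show "Q i \<in> sets borel" "emeasure lborel (Q i) = emeasure lborel ?S"
        unfolding eq by (rule emeasure_lborel_translate_vimage[OF Sm])+
    qed
    have fin: "finite I" by (simp add: I_def)
    \<comment> \<open>Index 0 is included in both ranges, so the counts are K + 1 and L + 1 and
      exceed the unrounded quotients even when K or L is 0. Their product cancels r and leaves the
      order 1/s.\<close>
    have card: "1 / (32 * s) \<le> real (card I)"
    proof -
      have "r / (4 * s) \<le> real K + 1" unfolding K_def using r s by linarith
      moreover have "1 / (8 * r) \<le> real L + 1" unfolding L_def using r by linarith
      ultimately have "r / (4 * s) * (1 / (8 * r)) \<le> (real K + 1) * (real L + 1)"
        using r s by (intro mult_mono) auto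
      then show ?thesis using r by (simp add: I_def card_cartesian_product field_simps)
    qed
    have "ennreal (1 / (32 * s)) * emeasure lborel ?S \<le> ennreal (real (card I)) * emeasure lborel ?S"
      using card by (intro mult_right_mono ennreal_leI) auto
    also have "\<dots> = (\<Sum>i\<in>I. emeasure lborel (Q i))"
      by (simp add: Q(2) ennreal_of_nat_eq_real_of_nat)
    also have "\<dots> = emeasure lborel (\<Union>i\<in>I. Q i)"
      by (rule sum_emeasure[OF _ disj fin]) (use Q(1) in auto)
    also have "\<dots> \<le> emeasure lborel (ball a (4 * r))"
      using sub by (intro emeasure_mono) auto
    also have "\<dots> = ennreal (V * (4 * r) ^ (2 * n))"
      using r by (simp add: emeasure_ball V_def n_def mult.commute)
    also have "(4 * r) ^ (2 * n) = 16 ^ n * \<delta> ^ n"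
    proof -
      have "(4 * r)\<^sup>2 = 16 * \<delta>" using r by (simp add: power2_eq_square)
      then show ?thesis by (simp only: power_mult power_mult_distrib)
    qed
    finally have *: "ennreal (1 / (32 * s)) * emeasure lborel ?S \<le> ennreal (V * (16 ^ n * \<delta> ^ n))" .
    have "ennreal (32 * s) * ennreal (1 / (32 * s)) = 1" using s by (simp add: ennreal_mult[symmetric])
    then have "emeasure lborel ?S = ennreal (32 * s) * (ennreal (1 / (32 * s)) * emeasure lborel ?S)"
      by (simp add: mult.assoc[symmetric])
    also have "\<dots> \<le> ennreal (32 * s) * ennreal (V * (16 ^ n * \<delta> ^ n))" by (intro mult_left_mono *) auto
    also have "\<dots> = ennreal (32 * s * (V * (16 ^ n * \<delta> ^ n)))"
      using s V \<delta> by (subst ennreal_mult[symmetric]) auto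
    also have "32 * s * (V * (16 ^ n * \<delta> ^ n)) = A * \<delta> ^ n * s" by (simp add: A_def)
    finally show ?thesis .
  qed
  with A show ?thesis unfolding n_def by blast
qed

section \<open>Summation over dyadic layers\<close>

lemma nn_integral_le_geometric:
  assumes pt: "\<And>z. F z = 0 \<or> (\<exists>k::nat. z \<in> E k \<and> F z \<le> c k)"
    and E: "\<And>k. E k \<in> sets M" and c: "\<And>k. c k * emeasure M (E k) \<le> ennreal (B * r ^ k)"
    and r: "0 \<le> r" "r < 1" and B: "0 \<le> B"
  shows "(\<integral>\<^sup>+z. F z \<partial>M) \<le> ennreal (B / (1 - r))"
proof -
  \<comment> \<open>A point needs just one good index, so the sets may overlap: nested sublevel
    sets, whose volumes are known, can stand in for dyadic shells.\<close>
  have "(\<integral>\<^sup>+z. F z \<partial>M) \<le> (\<integral>\<^sup>+z. (\<Sum>k. c k * indicator (E k) z) \<partial>M)"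
  proof (intro nn_integral_mono)
    fix z
    show "F z \<le> (\<Sum>k. c k * indicator (E k) z)"
    proof (cases "F z = 0")
      case False
      then obtain k where k: "z \<in> E k" "F z \<le> c k" using pt by blast
      have "F z \<le> (\<Sum>j\<in>{k}. c j * indicator (E j) z)" using k by simp
      also have "\<dots> \<le> (\<Sum>k. c k * indicator (E k) z)" by (rule sum_le_suminf) auto
      finally show ?thesis .
    qed simp
  qed
  also have "\<dots> = (\<Sum>k. \<integral>\<^sup>+z. c k * indicator (E k) z \<partial>M)"
    using E by (intro nn_integral_suminf) auto
  also have "\<dots> = (\<Sum>k. c k * emeasure M (E k))"
    using E by (simp add: nn_integral_cmult_indicator)
  also have "\<dots> \<le> (\<Sum>k. ennreal (B * r ^ k))"
    by (intro suminf_le c) auto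
  also have "\<dots> = ennreal (B / (1 - r))"
  proof (rule suminf_ennreal_eq)
    show "(\<lambda>k. B * r ^ k) sums (B / (1 - r))"
      using sums_mult[OF geometric_sums[of r], of B] r by simp
  qed (use r B in auto)
  finally show ?thesis .
qed

lemma ex_dyadic:
  fixes x :: real assumes "1 \<le> x" shows "\<exists>k::nat. 2 ^ k \<le> x \<and> x < 2 ^ (k + 1)"
proof -
  define k where "k = nat \<lfloor>log 2 x\<rfloor>"
  have l: "0 \<le> log 2 x" using assms by simp
  have "real k \<le> log 2 x" "log 2 x < real (k + 1)" unfolding k_def using l by (simp; linarith)+
  then have "2 powr real k \<le> x" "x < 2 powr real (k + 1)"
    using assms le_log_iff[of 2 x "real k"] log_less_iff[of 2 x "real (k + 1)"] by auto
  then show ?thesis by (intro exI[of _ k]) (simp only: powr_realpow zero_less_numeral)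
qed

lemma powr_dyadic_le:
  fixes h x :: real
  assumes "0 < h" "x / 2 \<le> h" "h \<le> x"
  shows "h powr \<alpha> \<le> 2 powr \<bar>\<alpha>\<bar> * x powr \<alpha>"
proof (cases "\<alpha> \<ge> 0")
  case True
  have "h powr \<alpha> \<le> x powr \<alpha>" using assms True by (intro powr_mono2) auto
  also have "\<dots> \<le> 2 powr \<bar>\<alpha>\<bar> * x powr \<alpha>" using ge_one_powr_ge_zero[of 2 "\<bar>\<alpha>\<bar>"] by (simp add: mult_le_cancel_right1)
  finally show ?thesis .
next
  case False
  have "h powr \<alpha> \<le> (x / 2) powr \<alpha>" using assms False by (intro powr_mono2') auto
  also have "\<dots> = 2 powr \<bar>\<alpha>\<bar> * x powr \<alpha>" using assms False by (simp add: powr_divide powr_minus_divide)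
  finally show ?thesis .
qed

text \<open>The layer where h is about \<delta>/2^k contributes (\<delta>/2^k)^\<alpha> times a
  volume of order A \<delta>/2^k. The ratio of successive terms is 2^-(1+\<alpha>), below 1 exactly
  because \<alpha> > -1.\<close>

lemma nn_integral_powr_dyadic:
  assumes h: "\<And>z. z \<in> S \<Longrightarrow> 0 < h z \<and> h z < \<delta>" and \<delta>: "0 < \<delta>" and \<alpha>: "\<alpha> > -1" and A: "A \<ge> 0"
    and m: "\<And>s. s > 0 \<Longrightarrow> {z \<in> S. h z < s} \<in> sets M"
    and vol: "\<And>s. s > 0 \<Longrightarrow> emeasure M {z \<in> S. h z < s} \<le> ennreal (A * s)"
  shows "(\<integral>\<^sup>+z. ennreal (h z powr \<alpha>) * indicator S z \<partial>M)
    \<le> ennreal (2 * 2 powr \<bar>\<alpha>\<bar> * A * \<delta> powr (1 + \<alpha>) / (1 - 2 powr -(1 + \<alpha>)))"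
proof (rule nn_integral_le_geometric)
  \<comment> \<open>The k-th layer only has h \<le> \<delta>/2^k, while the volume hypothesis
    concerns strict sublevel sets; the factor 2 makes room.\<close>
  let ?E = "\<lambda>k. {z \<in> S. h z < 2 * (\<delta> / 2 ^ k)}" and ?c = "\<lambda>k. ennreal (2 powr \<bar>\<alpha>\<bar> * (\<delta> / 2 ^ k) powr \<alpha>)"
  show "?E k \<in> sets M" for k by (rule m) (use \<delta> in simp)
  show "ennreal (h z powr \<alpha>) * indicator S z = 0 \<or> (\<exists>k. z \<in> ?E k \<and> ennreal (h z powr \<alpha>) * indicator S z \<le> ?c k)" for z
  proof (cases "z \<in> S")
    case True
    then have hz: "0 < h z" "h z < \<delta>" using h by auto
    then obtain k :: nat where k: "2 ^ k \<le> \<delta> / h z" "\<delta> / h z < 2 ^ (k + 1)"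
      using ex_dyadic[of "\<delta> / h z"] by auto
    have 1: "h z \<le> \<delta> / 2 ^ k" "\<delta> / 2 ^ k / 2 \<le> h z" using k hz by (auto simp: field_simps)
    have "h z powr \<alpha> \<le> 2 powr \<bar>\<alpha>\<bar> * (\<delta> / 2 ^ k) powr \<alpha>" using 1 hz by (intro powr_dyadic_le)
    moreover have "0 < \<delta> / 2 ^ k" using \<delta> by simp
    then have "h z < 2 * (\<delta> / 2 ^ k)" using 1(1) by linarith
    ultimately show ?thesis using True by (intro disjI2 exI[of _ k]) (auto intro: ennreal_leI)
  qed simp
  show "?c k * emeasure M (?E k) \<le> ennreal (2 * 2 powr \<bar>\<alpha>\<bar> * A * \<delta> powr (1 + \<alpha>) * (2 powr -(1 + \<alpha>)) ^ k)" for k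
  proof -
    have p: "(2 powr -(1 + \<alpha>)) ^ k = 1 / (2 ^ k) powr (1 + \<alpha>)"
    proof -
      have "(2 powr -(1 + \<alpha>)) ^ k = (2 powr -(1 + \<alpha>)) powr real k" by (simp add: powr_realpow)
      also have "\<dots> = (2 powr real k) powr -(1 + \<alpha>)" by (simp add: powr_powr mult.commute)
      also have "\<dots> = 1 / (2 ^ k) powr (1 + \<alpha>)" by (simp only: powr_minus_divide powr_realpow zero_less_numeral)
      finally show ?thesis .
    qed
    have "?c k * emeasure M (?E k) \<le> ?c k * ennreal (A * (2 * (\<delta> / 2 ^ k)))"
      using \<delta> by (intro mult_left_mono vol) auto
    also have "\<dots> = ennreal (2 powr \<bar>\<alpha>\<bar> * (\<delta> / 2 ^ k) powr \<alpha> * (A * (2 * (\<delta> / 2 ^ k))))"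
      using \<delta> A by (subst ennreal_mult[symmetric]) auto
    also have "2 powr \<bar>\<alpha>\<bar> * (\<delta> / 2 ^ k) powr \<alpha> * (A * (2 * (\<delta> / 2 ^ k))) = 2 * 2 powr \<bar>\<alpha>\<bar> * A * (\<delta> / 2 ^ k) powr (1 + \<alpha>)"
      using \<delta> by (simp add: powr_add)
    also have "(\<delta> / 2 ^ k) powr (1 + \<alpha>) = \<delta> powr (1 + \<alpha>) * (2 powr -(1 + \<alpha>)) ^ k"
      unfolding p using \<delta> by (simp add: powr_divide)
    finally show ?thesis by (simp only: mult.assoc)
  qed
  show "2 powr -(1 + \<alpha>) < 1" using \<alpha> powr_less_mono[of "-(1+\<alpha>)" 0 2] by simp
qed (use A in auto)

lemma ball_shell_volume:
  fixes s :: real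
  assumes s: "s > 0"
  shows "emeasure lborel {z \<in> ball (0::'a::euclidean_space) 1. 1 - norm z < s} \<le> ennreal (unit_ball_vol DIM('a) * DIM('a) * s)"
proof (cases "s \<le> 1")
  case True
  let ?m = "DIM('a)"
  have eq: "{z \<in> ball (0::'a) 1. 1 - norm z < s} = ball 0 1 - cball 0 (1 - s)" by auto
  have "emeasure lborel (ball (0::'a) 1 - cball 0 (1 - s)) = emeasure lborel (ball (0::'a) 1) - emeasure lborel (cball (0::'a) (1 - s))"
    using s True by (intro emeasure_Diff) (auto simp: emeasure_cball)
  also have "\<dots> = ennreal (unit_ball_vol ?m - unit_ball_vol ?m * (1 - s) ^ ?m)"
    using True by (simp add: emeasure_ball emeasure_cball ennreal_minus)
  also have "\<dots> \<le> ennreal (unit_ball_vol ?m * ?m * s)"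
  proof (rule ennreal_leI)
    have "1 + real ?m * (- s) \<le> (1 + (- s)) ^ ?m" using True by (intro Bernoulli_inequality) auto
    then have "1 - (1 - s) ^ ?m \<le> ?m * s" by simp
    then have "unit_ball_vol ?m * (1 - (1 - s) ^ ?m) \<le> unit_ball_vol ?m * (?m * s)" by (intro mult_left_mono) auto
    then show "unit_ball_vol ?m - unit_ball_vol ?m * (1 - s) ^ ?m \<le> unit_ball_vol ?m * ?m * s"
      by (simp add: algebra_simps)
  qed
  finally show ?thesis unfolding eq .
next
  case False
  have "emeasure lborel {z \<in> ball (0::'a) 1. 1 - norm z < s} \<le> emeasure lborel (ball (0::'a) 1)"
    by (intro emeasure_mono) auto
  also have "\<dots> = ennreal (unit_ball_vol DIM('a) * (1 * 1))" by (simp add: emeasure_ball)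
  also have "\<dots> \<le> ennreal (unit_ball_vol DIM('a) * (DIM('a) * s))"
    using False DIM_positive[where 'a='a] by (intro ennreal_leI mult_left_mono mult_mono) (auto simp: Suc_le_eq)
  finally show ?thesis by (simp add: mult.assoc)
qed

lemma weighted_integral_one_finite:
  assumes \<alpha>: "\<alpha> > -1"
  shows "weighted_integral \<alpha> (\<lambda>z::complex^'n::finite. 1) < \<infinity>"
proof -
  let ?m = "DIM(complex^'n)"
  have m: "{z \<in> ball (0::complex^'n) 1. 1 - norm z < s} \<in> sets lborel" for s
  proof -
    have "open {z::complex^'n. 1 - norm z < s}" by (intro open_Collect_less continuous_intros)
    then have "open (ball 0 1 \<inter> {z::complex^'n. 1 - norm z < s})" by auto
    also have "ball 0 1 \<inter> {z::complex^'n. 1 - norm z < s} = {z \<in> ball 0 1. 1 - norm z < s}" by auto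
    finally show ?thesis by simp
  qed
  \<comment> \<open>The bound 2 is taken because h must be strictly below \<delta>, and the centre
    of the ball has h = 1.\<close>
  have h: "0 < 1 - norm z \<and> 1 - norm z < 2" if "z \<in> ball 0 1" for z :: "complex^'n"
    using that norm_ge_zero[of z] by (simp del: norm_ge_zero)
  have "(\<integral>\<^sup>+z. ennreal ((1 - norm z) powr \<alpha>) * indicator (ball (0::complex^'n) 1) z \<partial>lborel)
    \<le> ennreal (2 * 2 powr \<bar>\<alpha>\<bar> * (unit_ball_vol ?m * ?m) * 2 powr (1 + \<alpha>) / (1 - 2 powr -(1 + \<alpha>)))"
    by (rule nn_integral_powr_dyadic[OF h _ \<alpha> _ m ball_shell_volume]) auto
  then show ?thesis unfolding weighted_integral_def by (simp add: le_less_trans[OF _ ennreal_less_top])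
qed

text \<open>On a cap \<open>1 - norm z\<close> is below \<delta>, so for small \<delta> the dyadic
  sum over the layers of the cap converges to order \<delta>^n \<delta>^(1+\<alpha>). For \<delta> >
  1/2 the total mass of the ball is already dominated, since 2 \<delta> \<ge> 1.\<close>

lemma ball_cap_weighted_volume:
  assumes \<alpha>: "\<alpha> > -1"
  shows "\<exists>A>0. \<forall>(a::complex^'n::finite) \<delta>. norm a < 1 \<longrightarrow> 0 < \<delta> \<longrightarrow>
     (\<integral>\<^sup>+z. ennreal ((1 - norm z) powr \<alpha>) * indicator {z \<in> ball 0 1. norm (1 - cinner z a) < \<delta>} z \<partial>lborel)
       \<le> ennreal (A * \<delta> powr (real CARD('n) + 1 + \<alpha>))"
proof -
  define n where "n = CARD('n)"
  define \<kappa> where "\<kappa> = real n + 1 + \<alpha>"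
  have \<kappa>: "\<kappa> > 0" using \<alpha> by (simp add: \<kappa>_def)
  obtain A0 where A0: "A0 > 0" and vol: "\<And>(a::complex^'n) \<delta> s. norm a < 1 \<Longrightarrow> 0 < \<delta> \<Longrightarrow> \<delta> \<le> 1/2 \<Longrightarrow> 0 < s \<Longrightarrow>
     emeasure lborel {z \<in> ball 0 1. norm (1 - cinner z a) < \<delta> \<and> 1 - norm z < s} \<le> ennreal (A0 * \<delta> ^ n * s)"
    unfolding n_def using ball_cap_volume by blast
  let ?W = "weighted_integral \<alpha> (\<lambda>z::complex^'n. 1)"
  obtain T where T: "?W = ennreal T" "T \<ge> 0"
    using weighted_integral_one_finite[OF \<alpha>, where 'n='n] by (cases ?W) auto
  define A1 where "A1 = 2 * 2 powr \<bar>\<alpha>\<bar> * A0 / (1 - 2 powr -(1 + \<alpha>))"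
  have A1: "A1 > 0"
    using A0 powr_less_mono[of "-(1+\<alpha>)" 0 2] \<alpha> by (simp add: A1_def)
  define A where "A = A1 + T * 2 powr \<kappa>"
  have A: "A > 0" using A1 T(2) by (simp add: A_def add_pos_nonneg)
  have "(\<integral>\<^sup>+z. ennreal ((1 - norm z) powr \<alpha>) * indicator {z \<in> ball 0 1. norm (1 - cinner z a) < \<delta>} z \<partial>lborel)
       \<le> ennreal (A * \<delta> powr \<kappa>)" if a: "norm a < 1" and \<delta>: "0 < \<delta>" for a :: "complex^'n" and \<delta>
  proof (cases "\<delta> \<le> 1/2")
    case True
    let ?S = "{z \<in> ball 0 1. norm (1 - cinner z a) < \<delta>}"
    have eq: "{z \<in> ?S. 1 - norm z < s} = {z \<in> ball 0 1. norm (1 - cinner z a) < \<delta> \<and> 1 - norm z < s}" for s by auto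
    have m: "{z \<in> ?S. 1 - norm z < s} \<in> sets lborel" for s
    proof -
      have "open {z. norm (1 - cinner z a) < \<delta>}" "open {z::complex^'n. 1 - norm z < s}"
        by (intro open_Collect_less continuous_intros)+
      then have "open (ball 0 1 \<inter> {z. norm (1 - cinner z a) < \<delta>} \<inter> {z. 1 - norm z < s})" by auto
      also have "ball 0 1 \<inter> {z. norm (1 - cinner z a) < \<delta>} \<inter> {z. 1 - norm z < s} = {z \<in> ?S. 1 - norm z < s}" by auto
      finally show ?thesis by simp
    qed
    have h: "0 < 1 - norm z \<and> 1 - norm z < \<delta>" if "z \<in> ?S" for z
    proof -
      have "norm z * norm a \<le> norm z" using a by (simp add: mult_right_le_one_le)
      then show ?thesis using that norm_one_minus_cinner_ge(2)[of z a] by auto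
    qed
    have "(\<integral>\<^sup>+z. ennreal ((1 - norm z) powr \<alpha>) * indicator ?S z \<partial>lborel)
      \<le> ennreal (2 * 2 powr \<bar>\<alpha>\<bar> * (A0 * \<delta> ^ n) * \<delta> powr (1 + \<alpha>) / (1 - 2 powr -(1 + \<alpha>)))"
    proof (rule nn_integral_powr_dyadic[OF h \<delta> \<alpha> _ m])
      show "0 \<le> A0 * \<delta> ^ n" using A0 \<delta> by simp
      show "emeasure lborel {z \<in> ?S. 1 - norm z < s} \<le> ennreal (A0 * \<delta> ^ n * s)" if "s > 0" for s
        unfolding eq using vol[OF a \<delta> True that] .
    qed
    also have "2 * 2 powr \<bar>\<alpha>\<bar> * (A0 * \<delta> ^ n) * \<delta> powr (1 + \<alpha>) / (1 - 2 powr -(1 + \<alpha>)) = A1 * (\<delta> ^ n * \<delta> powr (1 + \<alpha>))"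
      by (simp add: A1_def)
    also have "\<delta> ^ n * \<delta> powr (1 + \<alpha>) = \<delta> powr \<kappa>"
      using \<delta> by (simp add: \<kappa>_def powr_realpow[symmetric] powr_add[symmetric] add.assoc)
    also have "ennreal (A1 * \<delta> powr \<kappa>) \<le> ennreal (A * \<delta> powr \<kappa>)"
      using T by (intro ennreal_leI mult_right_mono) (auto simp: A_def)
    finally show ?thesis .
  next
    case False
    have "(\<integral>\<^sup>+z. ennreal ((1 - norm z) powr \<alpha>) * indicator {z \<in> ball 0 1. norm (1 - cinner z a) < \<delta>} z \<partial>lborel) \<le> ?W"
      unfolding weighted_integral_def by (intro nn_integral_mono) (auto simp: indicator_def)
    also have "\<dots> = ennreal (T * 1)" using T by simp
    also have "\<dots> \<le> ennreal (T * (2 * \<delta>) powr \<kappa>)"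
      using False \<kappa> T(2) by (intro ennreal_leI mult_left_mono ge_one_powr_ge_zero) auto
    also have "\<dots> = ennreal (T * 2 powr \<kappa> * \<delta> powr \<kappa>)" using \<delta> by (simp add: powr_mult mult.assoc)
    also have "\<dots> \<le> ennreal (A * \<delta> powr \<kappa>)"
      using A1 by (intro ennreal_leI mult_right_mono) (auto simp: A_def)
    finally show ?thesis .
  qed
  with A show ?thesis unfolding \<kappa>_def n_def by blast
qed

text \<open>The upper half of the Forelli--Rudin estimate.\<close>

lemma weighted_integral_kernel_le:
  assumes \<alpha>: "\<alpha> > -1" and M: "M > real CARD('n) + 1 + \<alpha>"
  shows "\<exists>A>0. \<forall>a::complex^'n::finite. norm a < 1 \<longrightarrow>
     weighted_integral \<alpha> (\<lambda>z. ((1 - norm a) / norm (1 - cinner z a)) powr M)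
       \<le> ennreal (A * (1 - norm a) powr (real CARD('n) + 1 + \<alpha>))"
proof -
  define \<kappa> where "\<kappa> = real CARD('n) + 1 + \<alpha>"
  have \<kappa>: "\<kappa> > 0" "\<kappa> < M" using \<alpha> M by (simp_all add: \<kappa>_def)
  obtain A0 where A0: "A0 > 0" and vol: "\<And>(a::complex^'n) \<delta>. norm a < 1 \<Longrightarrow> 0 < \<delta> \<Longrightarrow>
     (\<integral>\<^sup>+z. ennreal ((1 - norm z) powr \<alpha>) * indicator {z \<in> ball 0 1. norm (1 - cinner z a) < \<delta>} z \<partial>lborel)
       \<le> ennreal (A0 * \<delta> powr \<kappa>)"
    unfolding \<kappa>_def using ball_cap_weighted_volume[OF \<alpha>] by blast
  \<comment> \<open>Where |1 - cinner z a| is about 2^k d, the integrand is at most 2^(-kM) and the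
    cap has weighted volume of order (2^k d)^\<kappa>; r is the ratio of successive terms.\<close>
  define r where "r = 2 powr (\<kappa> - M)"
  have r: "0 < r" "r < 1" using \<kappa> powr_less_mono[of "\<kappa> - M" 0 2] by (auto simp: r_def)
  define A where "A = A0 * 2 powr \<kappa> / (1 - r)"
  have A: "A > 0" using A0 r by (simp add: A_def)
  have "weighted_integral \<alpha> (\<lambda>z. ((1 - norm a) / norm (1 - cinner z a)) powr M) \<le> ennreal (A * (1 - norm a) powr \<kappa>)"
    if a: "norm a < 1" for a :: "complex^'n"
  proof -
    define d where "d = 1 - norm a"
    have d: "d > 0" using a by (simp add: d_def)
    have [measurable]: "ball (0::complex^'n) 1 \<in> sets borel" by simp
    have wm: "(\<lambda>z::complex^'n. ennreal ((1 - norm z) powr \<alpha>) * indicator (ball 0 1) z) \<in> borel_measurable lborel"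
      by measurable
    let ?\<mu> = "density lborel (\<lambda>z::complex^'n. ennreal ((1 - norm z) powr \<alpha>) * indicator (ball 0 1) z)"
    let ?E = "\<lambda>k::nat. {z \<in> ball 0 1. norm (1 - cinner z a) < 2 ^ (k + 1) * d}"
    have E: "?E k \<in> sets borel" for k
    proof -
      have "open {z. norm (1 - cinner z a) < 2 ^ (k + 1) * d}" by (intro open_Collect_less continuous_intros)
      then have "open (ball 0 1 \<inter> {z. norm (1 - cinner z a) < 2 ^ (k + 1) * d})" by auto
      also have "ball 0 1 \<inter> {z. norm (1 - cinner z a) < 2 ^ (k + 1) * d} = ?E k" by auto
      finally show ?thesis by (rule borel_open)
    qed
    have km: "(\<lambda>z. (d / norm (1 - cinner z a)) powr M) \<in> borel_measurable borel"
    proof -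
      have "(\<lambda>z. norm (1 - cinner z a)) \<in> borel_measurable borel"
        by (intro borel_measurable_continuous_onI continuous_intros)
      then show ?thesis by measurable
    qed
    have "weighted_integral \<alpha> (\<lambda>z. (d / norm (1 - cinner z a)) powr M)
       = (\<integral>\<^sup>+z. ennreal ((d / norm (1 - cinner z a)) powr M) * indicator (ball 0 1) z \<partial>?\<mu>)"
    proof -
      have m: "(\<lambda>z. ennreal ((d / norm (1 - cinner z a)) powr M) * indicator (ball 0 1) z) \<in> borel_measurable lborel"
        using km by measurable
      show ?thesis
        unfolding weighted_integral_def nn_integral_density[OF wm m]
        by (intro nn_integral_cong) (simp add: ennreal_mult indicator_def mult.commute)
    qed
    also have "\<dots> \<le> ennreal (A0 * 2 powr \<kappa> * d powr \<kappa> / (1 - r))"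
    proof (rule nn_integral_le_geometric)
      let ?c = "\<lambda>k::nat. ennreal ((1 / 2 ^ k) powr M)"
      show "ennreal ((d / norm (1 - cinner z a)) powr M) * indicator (ball 0 1) z = 0 \<or>
         (\<exists>k. z \<in> ?E k \<and> ennreal ((d / norm (1 - cinner z a)) powr M) * indicator (ball 0 1) z \<le> ?c k)" for z
      proof (cases "z \<in> ball 0 1")
        case True
        then have ge: "d \<le> norm (1 - cinner z a)" using norm_one_minus_cinner_ge(1)[of z a] by (simp add: d_def)
        then have "1 \<le> norm (1 - cinner z a) / d" using d by simp
        then obtain k :: nat where k: "2 ^ k \<le> norm (1 - cinner z a) / d" "norm (1 - cinner z a) / d < 2 ^ (k + 1)"
          using ex_dyadic by blast
        have "norm (1 - cinner z a) < 2 ^ (k + 1) * d" using k(2) d by (simp add: pos_divide_less_eq)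
        moreover have "(d / norm (1 - cinner z a)) powr M \<le> (1 / 2 ^ k) powr M"
        proof (rule powr_mono2)
          have "2 ^ k * d \<le> norm (1 - cinner z a)" using k(1) d by (simp add: pos_le_divide_eq)
          then show "d / norm (1 - cinner z a) \<le> 1 / 2 ^ k" using d ge by (simp add: divide_simps mult.commute)
        qed (use d \<kappa> in auto)
        ultimately show ?thesis using True by (intro disjI2 exI[of _ k]) (auto intro: ennreal_leI)
      qed simp
      show "?E k \<in> sets ?\<mu>" for k unfolding sets_density sets_lborel by (rule E)
      show "?c k * emeasure ?\<mu> (?E k) \<le> ennreal (A0 * 2 powr \<kappa> * d powr \<kappa> * r ^ k)" for k
      proof -
        have "emeasure ?\<mu> (?E k) = (\<integral>\<^sup>+z. ennreal ((1 - norm z) powr \<alpha>) * indicator (ball 0 1) z * indicator (?E k) z \<partial>lborel)"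
          by (intro emeasure_density[OF wm]) (simp only: sets_lborel E)
        also have "\<dots> = (\<integral>\<^sup>+z. ennreal ((1 - norm z) powr \<alpha>) * indicator (?E k) z \<partial>lborel)"
          by (intro nn_integral_cong) (auto simp: indicator_def)
        also have "\<dots> \<le> ennreal (A0 * (2 ^ (k + 1) * d) powr \<kappa>)"
          using d by (intro vol[OF a]) simp
        finally have "?c k * emeasure ?\<mu> (?E k) \<le> ?c k * ennreal (A0 * (2 ^ (k + 1) * d) powr \<kappa>)"
          by (intro mult_left_mono) auto
        also have "\<dots> = ennreal ((1 / 2 ^ k) powr M * (A0 * (2 ^ (k + 1) * d) powr \<kappa>))"
          using A0 by (subst ennreal_mult[symmetric]) auto
        also have "(1 / 2 ^ k) powr M * (A0 * (2 ^ (k + 1) * d) powr \<kappa>) = A0 * 2 powr \<kappa> * d powr \<kappa> * r ^ k"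
        proof -
          have 1: "(1 / 2 ^ k) powr M = 2 powr (- M * real k)"
          proof -
            have "(1 / 2 ^ k :: real) = 2 powr (- real k)"
              by (simp add: powr_minus_divide powr_realpow)
            then have "(1 / 2 ^ k) powr M = 2 powr (- real k * M)" by (simp only: powr_powr)
            then show ?thesis by (simp add: mult.commute)
          qed
          have 2: "(2 ^ (k + 1) * d) powr \<kappa> = 2 powr (\<kappa> * real k) * 2 powr \<kappa> * d powr \<kappa>"
          proof -
            have "(2 ^ (k + 1) :: real) powr \<kappa> = (2 powr real (k + 1)) powr \<kappa>"
              by (simp only: powr_realpow zero_less_numeral)
            also have "\<dots> = 2 powr (\<kappa> * real k + \<kappa>)"
              unfolding powr_powr by (simp add: algebra_simps)
            also have "\<dots> = 2 powr (\<kappa> * real k) * 2 powr \<kappa>" by (rule powr_add)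
            finally show ?thesis by (simp only: powr_mult)
          qed
          have 3: "r ^ k = 2 powr (- M * real k) * 2 powr (\<kappa> * real k)"
          proof -
            have "r ^ k = r powr real k" using r by (simp add: powr_realpow)
            also have "\<dots> = 2 powr ((\<kappa> - M) * real k)" by (simp add: r_def powr_powr)
            also have "(\<kappa> - M) * real k = - M * real k + \<kappa> * real k" by (simp add: algebra_simps)
            finally show ?thesis by (simp only: powr_add)
          qed
          show ?thesis unfolding 1 2 3 by (simp only: mult_ac)
        qed
        finally show ?thesis .
      qed
    qed (use r A0 in auto)
    also have "A0 * 2 powr \<kappa> * d powr \<kappa> / (1 - r) = A * d powr \<kappa>" by (simp add: A_def)
    finally show ?thesis by (simp add: d_def)
  qed
  with A show ?thesis unfolding \<kappa>_def by blast
qed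

section \<open>Modulars and Luxemburg quasi-norms\<close>

lemma borel_measurable_restrict_ball:
  fixes u :: "'a::euclidean_space \<Rightarrow> real"
  assumes "continuous_on (ball 0 1) u"
  shows "u \<in> borel_measurable (restrict_space lborel (ball 0 1))"
proof -
  have "sets (restrict_space lborel (ball (0::'a) 1)) = sets (restrict_space borel (ball 0 1))"
    by (intro sets_restrict_space_cong) simp
  then have "borel_measurable (restrict_space lborel (ball (0::'a) 1)) = borel_measurable (restrict_space borel (ball 0 1))"
    by (intro measurable_cong_sets) auto
  then show ?thesis using borel_measurable_continuous_on_restrict[OF assms] by auto
qed

lemma borel_measurable_nu_alpha:
  fixes u :: "complex^'n::finite \<Rightarrow> real"
  assumes "continuous_on (ball 0 1) u"
  shows "(\<lambda>z. ennreal (u z)) \<in> borel_measurable (nu_alpha \<alpha>)"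
  using borel_measurable_restrict_ball[OF assms] unfolding nu_alpha_def Let_def by simp

lemma space_nu_alpha: "space (nu_alpha \<alpha>) = ball 0 1"
  by (simp add: nu_alpha_def Let_def space_restrict_space)

lemma weighted_integral_mono:
  assumes "\<And>z. z \<in> ball 0 1 \<Longrightarrow> u z * (1 - norm z) powr \<alpha> \<le> v z * (1 - norm z) powr \<beta>"
  shows "weighted_integral \<alpha> u \<le> weighted_integral \<beta> v"
  unfolding weighted_integral_def
  by (intro nn_integral_mono) (auto simp: indicator_def intro!: ennreal_leI assms)

lemma borel_measurable_weighted:
  fixes u :: "complex^'n::finite \<Rightarrow> real"
  assumes "continuous_on (ball 0 1) u"
  shows "(\<lambda>z. ennreal (u z * (1 - norm z) powr \<alpha>) * indicator (ball 0 1) z) \<in> borel_measurable borel"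
proof -
  have c: "continuous_on (ball 0 1) (\<lambda>z. u z * (1 - norm z) powr \<alpha>)"
    by (intro continuous_intros assms) auto
  show ?thesis using borel_measurable_shifted_indicator[OF c open_ball[of 0 1], of 0] by simp
qed

lemma weighted_integral_cmult:
  fixes u :: "complex^'n::finite \<Rightarrow> real"
  assumes "continuous_on (ball 0 1) u" "0 \<le> c"
  shows "weighted_integral \<alpha> (\<lambda>z. c * u z) = ennreal c * weighted_integral \<alpha> u"
proof -
  have "weighted_integral \<alpha> (\<lambda>z. c * u z) = (\<integral>\<^sup>+z. ennreal c * (ennreal (u z * (1 - norm z) powr \<alpha>) * indicator (ball 0 1) z) \<partial>lborel)"
    unfolding weighted_integral_def
    using assms(2) by (intro nn_integral_cong) (simp add: ennreal_mult' mult.assoc)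
  then show ?thesis
    unfolding weighted_integral_def
    using borel_measurable_weighted[OF assms(1)] by (simp add: nn_integral_cmult)
qed

text \<open>The two weights differ by (1 + |z|)^\<alpha>, which lies between 2^-|\<alpha>| and
  2^|\<alpha>|, and by the normalising constant.\<close>

lemma nu_alpha_weighted_integral:
  assumes \<alpha>: "\<alpha> > -1"
  shows "\<exists>k>0. \<forall>u::complex^'n::finite \<Rightarrow> real. continuous_on (ball 0 1) u \<longrightarrow> (\<forall>z\<in>ball 0 1. 0 \<le> u z) \<longrightarrow>
     (\<integral>\<^sup>+z. ennreal (u z) \<partial>nu_alpha \<alpha>) \<le> ennreal k * weighted_integral \<alpha> u \<and>
     weighted_integral \<alpha> u \<le> ennreal k * (\<integral>\<^sup>+z. ennreal (u z) \<partial>nu_alpha \<alpha>)"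
proof -
  let ?B = "ball (0::complex^'n) 1"
  let ?R = "restrict_space lborel ?B"
  define w where "w z = (1 - (norm z)\<^sup>2) powr \<alpha>" for z :: "complex^'n"
  define K where "K = 2 powr \<bar>\<alpha>\<bar>"
  have K: "K > 0" by (simp add: K_def)
  have wK: "w z \<le> K * (1 - norm z) powr \<alpha>" and Kw: "(1 - norm z) powr \<alpha> \<le> K * w z" if "z \<in> ?B" for z
  proof -
    have z: "norm z < 1" using that by simp
    have eq: "w z = (1 - norm z) powr \<alpha> * (1 + norm z) powr \<alpha>"
      by (simp add: w_def powr_mult[symmetric] power2_eq_square algebra_simps)
    have b: "(1 + norm z) powr \<beta> \<le> K" if "\<beta> \<le> \<bar>\<alpha>\<bar>" for \<beta>
    proof -
      have "(1 + norm z) powr \<beta> \<le> (1 + norm z) powr \<bar>\<alpha>\<bar>" using that by (intro powr_mono) auto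
      also have "\<dots> \<le> 2 powr \<bar>\<alpha>\<bar>" using z by (intro powr_mono2) auto
      finally show ?thesis by (simp add: K_def)
    qed
    have "(1 - norm z) powr \<alpha> * (1 + norm z) powr \<alpha> \<le> (1 - norm z) powr \<alpha> * K"
      by (intro mult_left_mono b) auto
    then show "w z \<le> K * (1 - norm z) powr \<alpha>" by (simp add: eq mult.commute)
    have "1 + norm z > 0" using norm_ge_zero[of z] by linarith
    then have "(1 - norm z) powr \<alpha> = w z * (1 + norm z) powr (-\<alpha>)"
      by (simp add: eq powr_minus)
    also have "\<dots> \<le> w z * K" by (intro mult_left_mono b) (auto simp: w_def)
    finally show "(1 - norm z) powr \<alpha> \<le> K * w z" by (simp add: mult.commute)
  qed
  have wc: "continuous_on ?B w"
  proof -
    have "1 - (norm z)\<^sup>2 \<noteq> 0" if "z \<in> ?B" for z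
      using that abs_square_less_1[of "norm z"] by simp
    then show ?thesis unfolding w_def by (intro continuous_intros) auto
  qed
  have wm: "w \<in> borel_measurable ?R" by (rule borel_measurable_restrict_ball[OF wc])
  have Bm: "?B \<inter> space lborel \<in> sets lborel" by simp
  \<comment> \<open>That \<open>?I\<close> is finite and nonzero matters: \<open>enn2real\<close>
    sends infinity to 0, and in either degenerate case 1/0 = 0 would turn \<open>nu_alpha\<close>
    into the zero measure.\<close>
  let ?I = "\<integral>\<^sup>+z. ennreal (w z) \<partial>?R"
  have I_eq: "?I = (\<integral>\<^sup>+z. ennreal (w z) * indicator ?B z \<partial>lborel)"
    by (rule nn_integral_restrict_space[OF Bm])
  have c1: "continuous_on ?B (\<lambda>z. 1)" by simp
  have "?I \<le> weighted_integral \<alpha> (\<lambda>z::complex^'n. K * 1)"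
    unfolding I_eq weighted_integral_def using wK
    by (intro nn_integral_mono) (auto simp: indicator_def intro!: ennreal_leI)
  also have "\<dots> = ennreal K * weighted_integral \<alpha> (\<lambda>z::complex^'n. 1)"
    by (rule weighted_integral_cmult[OF c1]) (use K in simp)
  also have "\<dots> < \<infinity>" using weighted_integral_one_finite[OF \<alpha>, where 'n='n] by (simp add: ennreal_mult_less_top)
  finally have fin: "?I < \<infinity>" .
  have "?I \<noteq> 0"
  proof
    assume I0: "?I = 0"
    let ?F = "\<lambda>z. ennreal (w z) * indicator ?B z"
    have Fm [measurable]: "?F \<in> borel_measurable lborel"
      using borel_measurable_shifted_indicator[OF wc open_ball[of 0 1], of 0] by simp
    have "?B \<subseteq> {z \<in> space lborel. ?F z \<noteq> 0}"
    proof
      fix z assume z: "z \<in> ?B"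
      then have "0 < 1 - (norm z)\<^sup>2" by (simp add: abs_square_less_1)
      then have "w z > 0" by (simp add: w_def)
      then show "z \<in> {z \<in> space lborel. ?F z \<noteq> 0}" using z by simp
    qed
    moreover have "{z \<in> space lborel. ?F z \<noteq> 0} \<in> sets lborel" by measurable
    ultimately have "emeasure lborel ?B \<le> emeasure lborel {z \<in> space lborel. ?F z \<noteq> 0}"
      by (rule emeasure_mono)
    also have "\<dots> = 0" using I0 unfolding I_eq nn_integral_0_iff[OF Fm] .
    finally show False using unit_ball_vol_pos[of "real CARD('n) * 2"] by (simp add: emeasure_ball)
  qed
  then obtain i where i: "?I = ennreal i" "i > 0"
    using fin by (cases ?I) (auto simp: less_le)
  define c where "c = 1 / i"
  have c: "c > 0" using i by (simp add: c_def)
  have nu: "nu_alpha \<alpha> = density ?R (\<lambda>z. ennreal (c * w z))"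
    using i unfolding nu_alpha_def Let_def w_def[symmetric] by (simp add: c_def)
  define k where "k = max (c * K) (K / c)"
  have k: "k > 0" using c K by (simp add: k_def less_max_iff_disj)
  have nu_int: "(\<integral>\<^sup>+z. ennreal (u z) \<partial>nu_alpha \<alpha>) = (\<integral>\<^sup>+z. ennreal (c * w z * u z) * indicator ?B z \<partial>lborel)"
    if u: "continuous_on ?B u" for u
  proof -
    have "(\<integral>\<^sup>+z. ennreal (u z) \<partial>nu_alpha \<alpha>) = (\<integral>\<^sup>+z. ennreal (c * w z) * ennreal (u z) \<partial>?R)"
      unfolding nu using wm borel_measurable_restrict_ball[OF u] by (intro nn_integral_density) auto
    also have "\<dots> = (\<integral>\<^sup>+z. ennreal (c * w z) * ennreal (u z) * indicator ?B z \<partial>lborel)"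
      by (rule nn_integral_restrict_space[OF Bm])
    also have "\<dots> = (\<integral>\<^sup>+z. ennreal (c * w z * u z) * indicator ?B z \<partial>lborel)"
      using c by (intro nn_integral_cong) (simp add: ennreal_mult' w_def)
    finally show ?thesis .
  qed
  have "(\<integral>\<^sup>+z. ennreal (u z) \<partial>nu_alpha \<alpha>) \<le> ennreal k * weighted_integral \<alpha> u \<and>
     weighted_integral \<alpha> u \<le> ennreal k * (\<integral>\<^sup>+z. ennreal (u z) \<partial>nu_alpha \<alpha>)"
    if u: "continuous_on ?B u" and u0: "\<And>z. z \<in> ?B \<Longrightarrow> 0 \<le> u z" for u
  proof
    have "(\<integral>\<^sup>+z. ennreal (u z) \<partial>nu_alpha \<alpha>) \<le> weighted_integral \<alpha> (\<lambda>z. c * K * u z)"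
      unfolding nu_int[OF u] weighted_integral_def
    proof (intro nn_integral_mono)
      fix z
      show "ennreal (c * w z * u z) * indicator ?B z \<le> ennreal (c * K * u z * (1 - norm z) powr \<alpha>) * indicator ?B z"
      proof (cases "z \<in> ?B")
        case True
        have "(c * u z) * w z \<le> (c * u z) * (K * (1 - norm z) powr \<alpha>)"
          using c u0[OF True] by (intro mult_left_mono wK True) auto
        then show ?thesis using True by (simp add: ennreal_leI mult_ac)
      qed simp
    qed
    also have "\<dots> = ennreal (c * K) * weighted_integral \<alpha> u"
      using c K by (intro weighted_integral_cmult u) auto
    also have "\<dots> \<le> ennreal k * weighted_integral \<alpha> u"
      by (intro mult_right_mono ennreal_leI) (auto simp: k_def)
    finally show "(\<integral>\<^sup>+z. ennreal (u z) \<partial>nu_alpha \<alpha>) \<le> ennreal k * weighted_integral \<alpha> u" .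
    have u': "continuous_on ?B (\<lambda>z. K / c * u z)" by (intro continuous_intros u)
    have "weighted_integral \<alpha> u \<le> (\<integral>\<^sup>+z. ennreal (K / c * u z) \<partial>nu_alpha \<alpha>)"
      unfolding nu_int[OF u'] weighted_integral_def
    proof (intro nn_integral_mono)
      fix z
      show "ennreal (u z * (1 - norm z) powr \<alpha>) * indicator ?B z \<le> ennreal (c * w z * (K / c * u z)) * indicator ?B z"
      proof (cases "z \<in> ?B")
        case True
        have "u z * (1 - norm z) powr \<alpha> \<le> u z * (K * w z)"
          using u0[OF True] by (intro mult_left_mono Kw True) auto
        also have "\<dots> = c * w z * (K / c * u z)" using c by simp
        finally show ?thesis using True by (simp add: ennreal_leI)
      qed simp
    qed
    also have "\<dots> = (\<integral>\<^sup>+z. ennreal (K / c) * ennreal (u z) \<partial>nu_alpha \<alpha>)"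
      using c K by (intro nn_integral_cong ennreal_mult') simp
    also have "\<dots> = ennreal (K / c) * (\<integral>\<^sup>+z. ennreal (u z) \<partial>nu_alpha \<alpha>)"
      by (intro nn_integral_cmult borel_measurable_nu_alpha u)
    also have "\<dots> \<le> ennreal k * (\<integral>\<^sup>+z. ennreal (u z) \<partial>nu_alpha \<alpha>)"
      by (intro mult_right_mono ennreal_leI) (auto simp: k_def)
    finally show "weighted_integral \<alpha> u \<le> ennreal k * (\<integral>\<^sup>+z. ennreal (u z) \<partial>nu_alpha \<alpha>)" .
  qed
  with k show ?thesis by blast
qed

section \<open>Inverses of growth functions\<close>

lemma growth_fun_ginv:
  assumes g: "growth_fun \<Phi>" and u: "0 \<le> u"
  shows "0 \<le> ginv \<Phi> u" "\<Phi> (ginv \<Phi> u) = u"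
proof -
  let ?S = "{t. 0 \<le> t \<and> u \<le> \<Phi> t}"
  have "u \<in> \<Phi> ` {0..}" using g u by (simp add: growth_fun_def)
  then obtain t where t: "0 \<le> t" "\<Phi> t = u" by auto
  then have ne: "?S \<noteq> {}" by auto
  have bd: "bdd_below ?S" by (rule bdd_belowI[of _ 0]) auto
  \<comment> \<open>The infimum is attained, since continuity makes the set closed. So
    \<open>ginv\<close> is a right inverse of \<Phi> even where \<Phi> has flat pieces.\<close>
  have "closed (\<Phi> -` {u..} \<inter> {0..})"
    using g continuous_on_closed_vimage[of "{0..}" \<Phi>] by (simp add: growth_fun_def)
  also have "\<Phi> -` {u..} \<inter> {0..} = ?S" by auto
  finally have "Inf ?S \<in> ?S" by (intro closed_contains_Inf ne bd)
  then have in_S: "0 \<le> ginv \<Phi> u" "u \<le> \<Phi> (ginv \<Phi> u)" by (auto simp: ginv_def)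
  moreover have "ginv \<Phi> u \<le> t" unfolding ginv_def using t bd by (intro cInf_lower) auto
  then have "\<Phi> (ginv \<Phi> u) \<le> u" using growth_fun_mono[OF g in_S(1)] t by auto
  ultimately show "0 \<le> ginv \<Phi> u" "\<Phi> (ginv \<Phi> u) = u" by auto
qed

lemma ginv_le:
  assumes "0 \<le> t" "u \<le> \<Phi> t" shows "ginv \<Phi> u \<le> t"
  unfolding ginv_def using assms by (intro cInf_lower bdd_belowI[of _ 0]) auto

lemma ginv_pos: "growth_fun \<Phi> \<Longrightarrow> 0 < u \<Longrightarrow> 0 < ginv \<Phi> u"
  using growth_fun_ginv[of \<Phi> u] growth_fun_zero[of \<Phi>] by (cases "ginv \<Phi> u = 0") auto

lemma ginv_mono: "growth_fun \<Phi> \<Longrightarrow> 0 \<le> u \<Longrightarrow> u \<le> v \<Longrightarrow> ginv \<Phi> u \<le> ginv \<Phi> v"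
  using growth_fun_ginv[of \<Phi> v] by (intro ginv_le) auto

text \<open>Moves a constant from outside \<Phi> to outside its inverse. If x exceeds y =
  \<open>ginv \<Phi> u\<close>, lower type with factor y/x compares \<Phi>(y) = u with \<Phi>(x)
  \<le> B u and bounds (x/y)^p by C B.\<close>

lemma two_sided_type_le_ginv:
  assumes \<Phi>: "two_sided_type p q C \<Phi>" and x: "0 \<le> x" and u: "0 < u" and B: "1 \<le> B" and le: "\<Phi> x \<le> B * u"
  shows "x \<le> (C * B) powr (1 / p) * ginv \<Phi> u"
proof -
  define y where "y = ginv \<Phi> u"
  have g: "growth_fun \<Phi>" and p: "p > 0" and C: "C \<ge> 1"
    and lo: "\<And>s t. s > 0 \<Longrightarrow> 0 < t \<Longrightarrow> t \<le> 1 \<Longrightarrow> \<Phi> (s * t) \<le> C * t powr p * \<Phi> s"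
    using \<Phi> by (auto simp: two_sided_type_def)
  have y: "y > 0" "\<Phi> y = u" unfolding y_def using ginv_pos[OF g u] growth_fun_ginv[OF g, of u] u by auto
  have CB: "1 \<le> C * B" using mult_mono[of 1 C 1 B] C B by simp
  have "x \<le> (C * B) powr (1 / p) * y"
  proof (cases "x \<le> y")
    case True
    have "1 \<le> (C * B) powr (1 / p)" using CB p by (intro ge_one_powr_ge_zero) auto
    then have "1 * y \<le> (C * B) powr (1 / p) * y" using y by (intro mult_right_mono) auto
    then show ?thesis using True by simp
  next
    case False
    then have x0: "x > 0" using y by simp
    have "\<Phi> (x * (y / x)) \<le> C * (y / x) powr p * \<Phi> x"
      using x0 y False by (intro lo) auto
    also have "\<dots> \<le> C * (y / x) powr p * (B * u)" using C le by (intro mult_left_mono) auto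
    finally have "u * 1 \<le> u * (C * B * (y / x) powr p)" using x0 y by (simp add: mult_ac)
    then have "1 \<le> C * B * (y / x) powr p" using u by (simp only: mult_le_cancel_left_pos)
    then have "(x / y) powr p \<le> C * B" using x0 y by (simp add: powr_divide field_simps)
    then have "((x / y) powr p) powr (1 / p) \<le> (C * B) powr (1 / p)" using p by (intro powr_mono2) auto
    then have "x / y \<le> (C * B) powr (1 / p)" using x0 y p by (simp add: powr_powr)
    then show ?thesis using y by (simp add: pos_divide_le_eq)
  qed
  then show ?thesis by (simp add: y_def)
qed

text \<open>M solves C M^-p = 1/B. This plays the part of convexity: a constant in front of \<Phi>
  is traded for a dilation of its argument.\<close>

lemma two_sided_type_shrink:
  assumes \<Phi>: "two_sided_type p q C \<Phi>" and B: "1 \<le> B"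
  shows "\<exists>M\<ge>1. \<forall>s\<ge>0. \<Phi> (s / M) \<le> 1 / B * \<Phi> s"
proof -
  have g: "growth_fun \<Phi>" and p: "p > 0" and C: "C \<ge> 1"
    and lo: "\<And>s t. s > 0 \<Longrightarrow> 0 < t \<Longrightarrow> t \<le> 1 \<Longrightarrow> \<Phi> (s * t) \<le> C * t powr p * \<Phi> s"
    using \<Phi> by (auto simp: two_sided_type_def)
  define M where "M = (C * B) powr (1 / p)"
  have CB: "1 \<le> C * B" using mult_mono[of 1 C 1 B] C B by simp
  have M: "M \<ge> 1" unfolding M_def using CB p by (intro ge_one_powr_ge_zero) auto
  have Mp: "(1 / M) powr p = 1 / (C * B)"
    using CB p by (simp add: M_def powr_divide powr_powr)
  have "\<Phi> (s / M) \<le> 1 / B * \<Phi> s" if "s \<ge> 0" for s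
  proof (cases "s = 0")
    case False
    have "\<Phi> (s * (1 / M)) \<le> C * (1 / M) powr p * \<Phi> s" using lo[of s "1 / M"] False that M by auto
    also have "C * (1 / M) powr p = 1 / B" using C by (simp add: Mp)
    finally show ?thesis by simp
  qed (simp add: growth_fun_zero[OF g])
  with M show ?thesis by blast
qed

section \<open>Modulars and quasi-norms\<close>

definition modular :: "(real \<Rightarrow> real) \<Rightarrow> real \<Rightarrow> (complex^'n::finite \<Rightarrow> complex) \<Rightarrow> real \<Rightarrow> ennreal" where
  "modular \<Phi> \<alpha> f r = (\<integral>\<^sup>+z. ennreal (\<Phi> (norm (f z) / r)) \<partial>nu_alpha \<alpha>)"


lemma growth_fun_continuous_norm:
  assumes "growth_fun \<Phi>" "holo_ball f" "r > 0"
  shows "continuous_on (ball 0 1) (\<lambda>z. \<Phi> (norm (f z) / r))"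
  using assms(1,3) holo_ball_continuous_on[OF assms(2)] unfolding growth_fun_def
  by (intro continuous_on_compose2[of "{0..}" \<Phi> _ "\<lambda>z. norm (f z) / r"]) (auto intro!: continuous_intros)

text \<open>M is the same for all f, so a uniform modular bound becomes a uniform quasi-norm
  bound.\<close>

lemma modular_scale:
  assumes \<Phi>: "two_sided_type p q C \<Phi>" and B: "1 \<le> B"
  shows "\<exists>M\<ge>1. \<forall>(f :: complex^'n::finite \<Rightarrow> complex) r. holo_ball f \<longrightarrow> 0 < r \<longrightarrow> modular \<Phi> \<alpha> f r \<le> ennreal B \<longrightarrow>
     modular \<Phi> \<alpha> f (M * r) \<le> 1"
proof -
  obtain M where M: "M \<ge> 1" "\<And>s. s \<ge> 0 \<Longrightarrow> \<Phi> (s / M) \<le> 1 / B * \<Phi> s"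
    using two_sided_type_shrink[OF \<Phi> B] by blast
  have g: "growth_fun \<Phi>" using \<Phi> by (simp add: two_sided_type_def)
  have "modular \<Phi> \<alpha> f (M * r) \<le> 1"
    if f: "holo_ball f" and r: "0 < r" and le: "modular \<Phi> \<alpha> f r \<le> ennreal B" for f :: "complex^'n \<Rightarrow> complex" and r
  proof -
    have "modular \<Phi> \<alpha> f (M * r) \<le> (\<integral>\<^sup>+z. ennreal (1 / B) * ennreal (\<Phi> (norm (f z) / r)) \<partial>nu_alpha \<alpha>)"
      unfolding modular_def
    proof (intro nn_integral_mono)
      fix z
      have "\<Phi> (norm (f z) / (M * r)) \<le> 1 / B * \<Phi> (norm (f z) / r)"
        using M(2)[of "norm (f z) / r"] r by (simp add: mult.commute)
      then have "ennreal (\<Phi> (norm (f z) / (M * r))) \<le> ennreal (1 / B * \<Phi> (norm (f z) / r))" by (rule ennreal_leI)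
      also have "\<dots> = ennreal (1 / B) * ennreal (\<Phi> (norm (f z) / r))"
        using B by (intro ennreal_mult') simp
      finally show "ennreal (\<Phi> (norm (f z) / (M * r))) \<le> ennreal (1 / B) * ennreal (\<Phi> (norm (f z) / r))"
        .
    qed
    also have "\<dots> = ennreal (1 / B) * modular \<Phi> \<alpha> f r"
      unfolding modular_def
      by (intro nn_integral_cmult borel_measurable_nu_alpha growth_fun_continuous_norm g f r)
    also have "\<dots> \<le> ennreal (1 / B) * ennreal B" by (intro mult_left_mono le) auto
    also have "\<dots> = 1" using B by (simp add: ennreal_mult[symmetric])
    finally show ?thesis .
  qed
  with M(1) show ?thesis by blast
qed

lemma lux_norm_alt: "lux_norm \<Phi> \<alpha> f = Inf {r. 0 < r \<and> modular \<Phi> \<alpha> f r \<le> 1}"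
  by (simp add: lux_norm_def modular_def)

lemma orlicz_bergman_alt: "orlicz_bergman \<Phi> \<alpha> = {f. holo_ball f \<and> modular \<Phi> \<alpha> f 1 < \<infinity>}"
  by (simp add: orlicz_bergman_def modular_def)

lemma lux_norm_le:
  assumes "0 < r" "modular \<Phi> \<alpha> f r \<le> 1" shows "lux_norm \<Phi> \<alpha> f \<le> r"
  unfolding lux_norm_alt using assms by (intro cInf_lower bdd_belowI[of _ 0]) auto

text \<open>Gives meaning to the infimum in the Luxemburg quasi-norm, since \<open>Inf\<close> of an
  empty set of reals carries no information.\<close>

lemma orlicz_bergman_ex_modular_le_1:
  fixes f :: "complex^'n::finite \<Rightarrow> complex"
  assumes \<Phi>: "two_sided_type p q C \<Phi>" and f: "f \<in> orlicz_bergman \<Phi> \<alpha>"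
  shows "{r. 0 < r \<and> modular \<Phi> \<alpha> f r \<le> 1} \<noteq> {}"
proof -
  have h: "holo_ball f" "modular \<Phi> \<alpha> f 1 < \<infinity>" using f by (auto simp: orlicz_bergman_alt)
  then obtain x where x: "modular \<Phi> \<alpha> f 1 = ennreal x" "x \<ge> 0" by (cases "modular \<Phi> \<alpha> f 1") auto
  then have "modular \<Phi> \<alpha> f 1 \<le> ennreal (max 1 x)" by (simp add: ennreal_leI)
  moreover obtain M where "M \<ge> 1" and M: "\<And>(f :: complex^'n \<Rightarrow> complex) r. holo_ball f \<Longrightarrow> 0 < r \<Longrightarrow>
      modular \<Phi> \<alpha> f r \<le> ennreal (max 1 x) \<Longrightarrow> modular \<Phi> \<alpha> f (M * r) \<le> 1"
    using modular_scale[OF \<Phi> max.cobounded1[of 1 x]] by blast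
  ultimately have "0 < M \<and> modular \<Phi> \<alpha> f M \<le> 1" using M[OF h(1), of 1] by simp
  then show ?thesis by blast
qed

lemma lux_norm_less_ex_modular:
  assumes \<Phi>: "two_sided_type p q C \<Phi>" and f: "f \<in> orlicz_bergman \<Phi> \<alpha>" and less: "lux_norm \<Phi> \<alpha> f < R"
  shows "\<exists>r. 0 < r \<and> r < R \<and> modular \<Phi> \<alpha> f r \<le> 1"
  using cInf_lessD[OF orlicz_bergman_ex_modular_le_1[OF \<Phi> f]] less unfolding lux_norm_alt by blast

lemma modular_le_1_imp_orlicz_bergman:
  assumes \<Phi>: "two_sided_type p q C \<Phi>" and f: "holo_ball f" and r: "0 < r" and le: "modular \<Phi> \<alpha> f r \<le> 1"
  shows "f \<in> orlicz_bergman \<Phi> \<alpha>"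
proof -
  have g: "growth_fun \<Phi>" and C: "C \<ge> 1"
    and up: "\<And>s t. s > 0 \<Longrightarrow> t \<ge> 1 \<Longrightarrow> \<Phi> (s * t) \<le> C * t powr q * \<Phi> s"
    using \<Phi> by (auto simp: two_sided_type_def)
  \<comment> \<open>The maximum with 1 keeps the dilation factor admissible for upper type when r <
    1.\<close>
  let ?c = "C * max r 1 powr q"
  have "modular \<Phi> \<alpha> f 1 \<le> (\<integral>\<^sup>+z. ennreal ?c * ennreal (\<Phi> (norm (f z) / r)) \<partial>nu_alpha \<alpha>)"
    unfolding modular_def
  proof (intro nn_integral_mono)
    fix z
    have "\<Phi> (norm (f z)) \<le> ?c * \<Phi> (norm (f z) / r)"
    proof (cases "f z = 0")
      case False
      have "norm (f z) = norm (f z) / r * r" using r by simp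
      also have "\<dots> \<le> norm (f z) / r * max r 1" using r by (intro mult_left_mono) auto
      finally have "\<Phi> (norm (f z)) \<le> \<Phi> (norm (f z) / r * max r 1)" by (intro growth_fun_mono[OF g]) auto
      also have "\<dots> \<le> ?c * \<Phi> (norm (f z) / r)" using False r by (intro up) auto
      finally show ?thesis .
    qed (simp add: growth_fun_zero[OF g])
    then have "ennreal (\<Phi> (norm (f z))) \<le> ennreal (?c * \<Phi> (norm (f z) / r))" by (rule ennreal_leI)
    also have "\<dots> = ennreal ?c * ennreal (\<Phi> (norm (f z) / r))" using C by (intro ennreal_mult') auto
    finally show "ennreal (\<Phi> (norm (f z) / 1)) \<le> ennreal ?c * ennreal (\<Phi> (norm (f z) / r))" by simp
  qed
  also have "\<dots> = ennreal ?c * modular \<Phi> \<alpha> f r"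
    unfolding modular_def
    by (intro nn_integral_cmult borel_measurable_nu_alpha growth_fun_continuous_norm g f r)
  also have "\<dots> \<le> ennreal ?c * 1" by (intro mult_left_mono le) auto
  also have "\<dots> < \<infinity>" by simp
  finally show ?thesis using f by (simp add: orlicz_bergman_alt)
qed

lemma holo_ball_mult:
  fixes f g :: "complex^'n::finite \<Rightarrow> complex"
  assumes "holo_ball f" "holo_ball g"
  shows "holo_ball (\<lambda>z. f z * g z)"
  unfolding holo_ball_def
proof
  fix z :: "complex^'n" assume z: "z \<in> ball 0 1"
  obtain L where L: "(f has_derivative L) (at z)" "\<And>c w. L (c *s w) = c * L w"
    using assms(1) z unfolding holo_ball_def by blast
  obtain M where M: "(g has_derivative M) (at z)" "\<And>c w. M (c *s w) = c * M w"
    using assms(2) z unfolding holo_ball_def by blast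
  have "((\<lambda>z. f z * g z) has_derivative (\<lambda>h. f z * M h + L h * g z)) (at z)"
    by (rule has_derivative_mult[OF L(1) M(1)])
  then show "\<exists>N. ((\<lambda>z. f z * g z) has_derivative N) (at z) \<and> (\<forall>c w. N (c *s w) = c * N w)"
    by (rule exI[where x = "\<lambda>h. f z * M h + L h * g z", OF conjI]) (auto simp: L(2) M(2) algebra_simps)
qed

lemma holo_ball_const: "holo_ball (\<lambda>z. c)"
  unfolding holo_ball_def by (intro ballI exI[of _ "\<lambda>h. 0"]) auto

text \<open>The growth estimate for f/r bounds \<Phi>(|f(z)|/r) by a constant times
  d^-(n+1+\<alpha>); lower type takes the constant through the inverse.\<close>

lemma modular_le_1_pointwise:
  assumes \<Phi>: "two_sided_type p q C \<Phi>" and \<alpha>: "\<alpha> > -1"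
  shows "\<exists>B\<ge>1. \<forall>(f :: complex^'n::finite \<Rightarrow> complex) r z. holo_ball f \<longrightarrow> 0 < r \<longrightarrow> modular \<Phi> \<alpha> f r \<le> 1 \<longrightarrow> z \<in> ball 0 1 \<longrightarrow>
     norm (f z) / r \<le> B * ginv \<Phi> ((1 / (1 - norm z)) powr (real CARD('n) + 1 + \<alpha>))"
proof -
  define \<kappa> where "\<kappa> = real CARD('n) + 1 + \<alpha>"
  have g: "growth_fun \<Phi>" and p: "p > 0" and C: "C \<ge> 1" using \<Phi> by (auto simp: two_sided_type_def)
  obtain A where A: "A > 0" and pt: "\<And>(f :: complex^'n \<Rightarrow> complex) z. holo_ball f \<Longrightarrow> z \<in> ball 0 1 \<Longrightarrow>
     ennreal (\<Phi> (norm (f z))) \<le> ennreal (A * (1 - norm z) powr (-\<kappa>)) * weighted_integral \<alpha> (\<lambda>z. \<Phi> (norm (f z)))"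
    using holo_ball_growth_pointwise[OF \<Phi>, of \<alpha>] unfolding \<kappa>_def by blast
  obtain k where k: "k > 0" and W: "\<And>u::complex^'n \<Rightarrow> real. continuous_on (ball 0 1) u \<Longrightarrow> (\<forall>z\<in>ball 0 1. 0 \<le> u z) \<Longrightarrow>
     weighted_integral \<alpha> u \<le> ennreal k * (\<integral>\<^sup>+z. ennreal (u z) \<partial>nu_alpha \<alpha>)"
    using nu_alpha_weighted_integral[OF \<alpha>] by blast
  define B where "B = (C * max 1 (A * k)) powr (1 / p)"
  have "1 \<le> C * max 1 (A * k)" using mult_mono[of 1 C 1 "max 1 (A * k)"] C by simp
  then have B: "1 \<le> B" unfolding B_def using p by (intro ge_one_powr_ge_zero) auto
  have "norm (f z) / r \<le> B * ginv \<Phi> ((1 / (1 - norm z)) powr \<kappa>)"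
    if f: "holo_ball f" and r: "0 < r" and le: "modular \<Phi> \<alpha> f r \<le> 1" and z: "z \<in> ball 0 1"
    for f :: "complex^'n \<Rightarrow> complex" and r z
  proof -
    define h where "h w = f w * of_real (1 / r)" for w
    have h: "holo_ball h" unfolding h_def by (intro holo_ball_mult f holo_ball_const)
    have nh: "norm (h w) = norm (f w) / r" for w using r by (simp add: h_def norm_mult norm_divide)
    have d: "1 - norm z > 0" using z by simp
    have "weighted_integral \<alpha> (\<lambda>w. \<Phi> (norm (h w))) \<le> ennreal k * modular \<Phi> \<alpha> f r"
      unfolding modular_def nh
      by (intro W growth_fun_continuous_norm[OF g f r] ballI growth_fun_nonneg[OF g]) (use r in simp)
    also have "\<dots> \<le> ennreal k * 1" by (intro mult_left_mono le) auto
    finally have wk: "weighted_integral \<alpha> (\<lambda>w. \<Phi> (norm (h w))) \<le> ennreal k" by simp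
    have "ennreal (\<Phi> (norm (h z))) \<le> ennreal (A * (1 - norm z) powr (-\<kappa>)) * ennreal k"
      by (rule order_trans[OF pt[OF h z] mult_left_mono[OF wk]]) simp
    also have "\<dots> = ennreal (A * (1 - norm z) powr (-\<kappa>) * k)"
      using A k by (intro ennreal_mult[symmetric]) auto
    finally have "\<Phi> (norm (h z)) \<le> A * (1 - norm z) powr (-\<kappa>) * k"
      using A k by (simp add: ennreal_le_iff)
    also have "\<dots> = A * k * (1 / (1 - norm z)) powr \<kappa>"
      using d by (simp add: powr_divide powr_minus_divide)
    also have "\<dots> \<le> max 1 (A * k) * (1 / (1 - norm z)) powr \<kappa>" by (intro mult_right_mono) auto
    finally have "norm (h z) \<le> B * ginv \<Phi> ((1 / (1 - norm z)) powr \<kappa>)"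
      unfolding B_def using d by (intro two_sided_type_le_ginv[OF \<Phi>]) auto
    then show ?thesis by (simp add: nh)
  qed
  with B show ?thesis unfolding \<kappa>_def by blast
qed

section \<open>Test functions and necessity\<close>

lemma holo_ball_cinner_compose:
  fixes a :: "complex^'n::finite"
  assumes F: "F holomorphic_on ball 0 1" and a: "norm a < 1"
  shows "holo_ball (\<lambda>z. F (cinner z a))"
  unfolding holo_ball_def
proof
  fix z :: "complex^'n" assume z: "z \<in> ball 0 1"
  have "norm (cinner z a) \<le> norm z * norm a" by (rule norm_cinner_le)
  also have "\<dots> \<le> norm z" using a by (simp add: mult_right_le_one_le)
  finally have "cinner z a \<in> ball 0 1" using z by simp
  then obtain D where "(F has_field_derivative D) (at (cinner z a))"
    using F by (metis field_differentiable_def holomorphic_on_imp_differentiable_at open_ball)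
  then have F': "(F has_derivative (*) D) (at (cinner z a))" by (simp add: has_field_derivative_def)
  have sc: "r *\<^sub>R v = of_real r *s v" for r and v :: "complex^'n"
    by (simp add: vec_eq_iff scaleR_conv_of_real[symmetric])
  have "bounded_linear (\<lambda>v. cinner v a)"
    by (rule bounded_linear_intro[of _ "norm a"])
      (auto simp: cinner_add sc cinner_scale scaleR_conv_of_real intro: norm_cinner_le)
  then have "((\<lambda>v. cinner v a) has_derivative (\<lambda>v. cinner v a)) (at z)"
    by (rule bounded_linear_imp_has_derivative)
  then have "((\<lambda>v. F (cinner v a)) has_derivative (\<lambda>v. D * cinner v a)) (at z)"
    using F' by (rule has_derivative_compose[where g = F])
  then show "\<exists>L. ((\<lambda>z. F (cinner z a)) has_derivative L) (at z) \<and> (\<forall>c w. L (c *s w) = c * L w)"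
    by (rule exI[where x = "\<lambda>v. D * cinner v a", OF conjI]) (auto simp: cinner_scale)
qed

text \<open>With t(z) = d/|1 - cinner z a| \<le> 1 and \<Phi>(y) = d^-\<kappa>, lower type gives
  \<Phi>(y t^m) \<le> C t^(mp) d^-\<kappa>. The kernel integral of t^(mp) is of order d^\<kappa>, so
  the modular is bounded independently of a.\<close>

lemma kernel_test_functions:
  assumes \<Phi>: "two_sided_type p q C \<Phi>" and \<alpha>: "\<alpha> > -1"
  shows "\<exists>c>0. \<exists>M>0. \<forall>a::complex^'n::finite. norm a < 1 \<longrightarrow> (\<exists>f\<in>orlicz_bergman \<Phi> \<alpha>. lux_norm \<Phi> \<alpha> f \<le> M \<and>
     c * ginv \<Phi> ((1 / (1 - norm a)) powr (real CARD('n) + 1 + \<alpha>)) \<le> norm (f a))"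
proof -
  define \<kappa> where "\<kappa> = real CARD('n) + 1 + \<alpha>"
  have g: "growth_fun \<Phi>" and p: "p > 0" and C: "C \<ge> 1"
    and lo: "\<And>s t. s > 0 \<Longrightarrow> 0 < t \<Longrightarrow> t \<le> 1 \<Longrightarrow> \<Phi> (s * t) \<le> C * t powr p * \<Phi> s"
    using \<Phi> by (auto simp: two_sided_type_def)
  \<comment> \<open>Lower type turns the power m into mp, which must exceed \<kappa> for the kernel
    estimate. An integer m keeps the test function free of complex powers.\<close>
  obtain m :: nat where m: "\<kappa> / p < real m" using reals_Archimedean2 by blast
  then have mp: "real m * p > \<kappa>" using p by (simp add: pos_divide_less_eq)
  obtain A where A: "A > 0" and ker: "\<And>a::complex^'n. norm a < 1 \<Longrightarrow>
     weighted_integral \<alpha> (\<lambda>z. ((1 - norm a) / norm (1 - cinner z a)) powr (real m * p)) \<le> ennreal (A * (1 - norm a) powr \<kappa>)"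
    using weighted_integral_kernel_le[OF \<alpha>, of "real m * p"] mp unfolding \<kappa>_def by blast
  obtain k where k: "k > 0" and W: "\<And>u::complex^'n \<Rightarrow> real. continuous_on (ball 0 1) u \<Longrightarrow> (\<forall>z\<in>ball 0 1. 0 \<le> u z) \<Longrightarrow>
     (\<integral>\<^sup>+z. ennreal (u z) \<partial>nu_alpha \<alpha>) \<le> ennreal k * weighted_integral \<alpha> u"
    using nu_alpha_weighted_integral[OF \<alpha>] by blast
  define B where "B = max 1 (k * (C * A))"
  obtain M where M: "M \<ge> 1" and scale: "\<And>(f :: complex^'n \<Rightarrow> complex) r. holo_ball f \<Longrightarrow> 0 < r \<Longrightarrow>
      modular \<Phi> \<alpha> f r \<le> ennreal B \<Longrightarrow> modular \<Phi> \<alpha> f (M * r) \<le> 1"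
    using modular_scale[OF \<Phi>, of B] unfolding B_def by (metis max.cobounded1)
  have "\<exists>f\<in>orlicz_bergman \<Phi> \<alpha>. lux_norm \<Phi> \<alpha> f \<le> M \<and> (1 / 2 ^ m) * ginv \<Phi> ((1 / (1 - norm a)) powr \<kappa>) \<le> norm (f a)"
    if a: "norm a < 1" for a :: "complex^'n"
  proof -
    define d where "d = 1 - norm a"
    have d: "d > 0" using a by (simp add: d_def)
    define y where "y = ginv \<Phi> ((1 / d) powr \<kappa>)"
    have y: "y > 0" "\<Phi> y = (1 / d) powr \<kappa>"
      unfolding y_def using d by (auto intro!: ginv_pos g growth_fun_ginv)
    define f where "f z = of_real y * (of_real d / (1 - cinner z a)) ^ m" for z
    have f: "holo_ball f"
      unfolding f_def
      by (rule holo_ball_cinner_compose[of "\<lambda>w. of_real y * (of_real d / (1 - w)) ^ m"])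
        (use a in \<open>auto intro!: holomorphic_intros\<close>)
    define t where "t z = d / norm (1 - cinner z a)" for z
    have t: "0 < t z" "t z \<le> 1" "norm (1 - cinner z a) \<ge> d" if "z \<in> ball 0 1" for z
    proof -
      show ge: "norm (1 - cinner z a) \<ge> d"
        using norm_one_minus_cinner_ge(1)[of z a] that by (simp add: d_def)
      then have "norm (1 - cinner z a) > 0" using d by linarith
      then show "0 < t z" "t z \<le> 1" using d ge by (simp_all add: t_def)
    qed
    have nf: "norm (f z) = y * t z ^ m" for z
      using y d by (simp add: f_def t_def norm_mult norm_power norm_divide)
    have pt: "\<Phi> (norm (f z)) \<le> C * (1 / d) powr \<kappa> * t z powr (real m * p)" if z: "z \<in> ball 0 1" for z
    proof -
      have "\<Phi> (y * t z ^ m) \<le> C * (t z ^ m) powr p * \<Phi> y"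
        using t[OF z] y by (intro lo) (auto intro: power_le_one)
      also have "(t z ^ m) powr p = t z powr (real m * p)"
        using t[OF z] by (simp add: powr_realpow[symmetric] powr_powr)
      finally show ?thesis by (simp add: nf y mult_ac)
    qed
    have tc: "continuous_on (ball 0 1) (\<lambda>z. t z powr (real m * p))"
      unfolding t_def using t(3) d by (intro continuous_intros) force+
    have "modular \<Phi> \<alpha> f 1 \<le> ennreal k * weighted_integral \<alpha> (\<lambda>z. \<Phi> (norm (f z) / 1))"
      unfolding modular_def
      by (intro W growth_fun_continuous_norm[OF g f] ballI growth_fun_nonneg[OF g]) auto
    also have "weighted_integral \<alpha> (\<lambda>z. \<Phi> (norm (f z) / 1)) \<le> weighted_integral \<alpha> (\<lambda>z. C * (1 / d) powr \<kappa> * t z powr (real m * p))"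
      by (intro weighted_integral_mono mult_right_mono) (use pt in auto)
    also have "\<dots> = ennreal (C * (1 / d) powr \<kappa>) * weighted_integral \<alpha> (\<lambda>z. t z powr (real m * p))"
      using C by (intro weighted_integral_cmult tc) auto
    also have "\<dots> \<le> ennreal (C * (1 / d) powr \<kappa>) * ennreal (A * d powr \<kappa>)"
      unfolding t_def d_def by (intro mult_left_mono ker a) auto
    also have "\<dots> = ennreal (C * (1 / d) powr \<kappa> * (A * d powr \<kappa>))"
      using C A by (intro ennreal_mult[symmetric]) auto
    also have "C * (1 / d) powr \<kappa> * (A * d powr \<kappa>) = C * A" using d by (simp add: powr_divide)
    finally have "modular \<Phi> \<alpha> f 1 \<le> ennreal k * ennreal (C * A)" by (simp add: mult_left_mono)
    also have "\<dots> = ennreal (k * (C * A))" using k C A by (intro ennreal_mult[symmetric]) auto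
    also have "\<dots> \<le> ennreal B" by (intro ennreal_leI) (simp add: B_def)
    finally have mod: "modular \<Phi> \<alpha> f 1 \<le> ennreal B" .
    have "f \<in> orlicz_bergman \<Phi> \<alpha>"
      unfolding orlicz_bergman_alt using f le_less_trans[OF mod ennreal_less_top] by simp
    moreover have "lux_norm \<Phi> \<alpha> f \<le> M"
      using scale[OF f _ mod] M by (intro lux_norm_le) auto
    \<comment> \<open>At z = a the denominator is 1 - |a|^2 = d (1 + |a|) \<le> 2d, hence t(a) \<ge>
      1/2.\<close>
    moreover have "(1 / 2 ^ m) * y \<le> norm (f a)"
    proof -
      have "norm (1 - cinner a a) = \<bar>1 - (norm a)\<^sup>2\<bar>"
        unfolding cinner_self by (metis norm_of_real of_real_1 of_real_diff)
      also have "1 - (norm a)\<^sup>2 = d * (1 + norm a)" by (simp add: d_def power2_eq_square algebra_simps)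
      also have "\<bar>d * (1 + norm a)\<bar> = d * (1 + norm a)" using d by (simp add: abs_mult)
      also have "\<dots> \<le> d * 2" using d a by (intro mult_left_mono) auto
      finally have "norm (1 - cinner a a) \<le> d * 2" .
      moreover have "0 < norm (1 - cinner a a)" by (rule less_le_trans[OF d t(3)]) (use a in simp)
      ultimately have "1 / 2 \<le> t a" unfolding t_def by (subst pos_le_divide_eq) auto
      then have "(1 / 2) ^ m \<le> t a ^ m" by (intro power_mono) auto
      then have "y * (1 / 2) ^ m \<le> y * t a ^ m" using y by (intro mult_left_mono) auto
      then show ?thesis by (simp add: nf power_divide)
    qed
    ultimately show ?thesis unfolding y_def d_def by blast
  qed
  then show ?thesis using M unfolding \<kappa>_def by (intro exI[of _ "1 / 2 ^ m"] exI[of _ M] conjI) auto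
qed

lemma multipliers_growth_bound:
  fixes g :: "complex^'n::finite \<Rightarrow> complex"
  assumes \<Phi>1: "two_sided_type p1 q1 C1 \<Phi>1" and \<Phi>2: "two_sided_type p2 q2 C2 \<Phi>2"
    and \<alpha>: "\<alpha> > -1" and \<beta>: "\<beta> > -1" and g: "g \<in> multipliers \<Phi>1 \<alpha> \<Phi>2 \<beta>"
  shows "\<exists>K>0. \<forall>a\<in>ball 0 1. norm (g a) \<le> K * mult_gamma \<Phi>1 \<Phi>2 \<alpha> \<beta> CARD('n) (1 / (1 - norm a))"
proof -
  let ?n = "real CARD('n)"
  obtain c M where c: "c > 0" and M: "M > 0" and test: "\<And>a::complex^'n. norm a < 1 \<Longrightarrow> (\<exists>f\<in>orlicz_bergman \<Phi>1 \<alpha>. lux_norm \<Phi>1 \<alpha> f \<le> M \<and>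
     c * ginv \<Phi>1 ((1 / (1 - norm a)) powr (?n + 1 + \<alpha>)) \<le> norm (f a))"
    using kernel_test_functions[OF \<Phi>1 \<alpha>] by blast
  obtain B where B: "B \<ge> 1" and pt: "\<And>(f :: complex^'n \<Rightarrow> complex) r z. holo_ball f \<Longrightarrow> 0 < r \<Longrightarrow> modular \<Phi>2 \<beta> f r \<le> 1 \<Longrightarrow> z \<in> ball 0 1 \<Longrightarrow>
     norm (f z) / r \<le> B * ginv \<Phi>2 ((1 / (1 - norm z)) powr (?n + 1 + \<beta>))"
    using modular_le_1_pointwise[OF \<Phi>2 \<beta>] by blast
  obtain D where D: "D > 0" and mul: "\<And>f. f \<in> orlicz_bergman \<Phi>1 \<alpha> \<Longrightarrow> (\<lambda>z. f z * g z) \<in> orlicz_bergman \<Phi>2 \<beta> \<and>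
      lux_norm \<Phi>2 \<beta> (\<lambda>z. f z * g z) \<le> D * lux_norm \<Phi>1 \<alpha> f"
    using g unfolding multipliers_def by blast
  \<comment> \<open>Strictly above the quasi-norm of every tested product, so a scale r < R with
    modular at most 1 exists without the infimum being attained.\<close>
  define R where "R = D * M + 1"
  have R: "R > 0" using D M by (simp add: R_def add_pos_pos)
  have "norm (g a) \<le> (R * B / c) * mult_gamma \<Phi>1 \<Phi>2 \<alpha> \<beta> CARD('n) (1 / (1 - norm a))" if a: "a \<in> ball 0 1" for a
  proof -
    define s1 where "s1 = ginv \<Phi>1 ((1 / (1 - norm a)) powr (?n + 1 + \<alpha>))"
    define s2 where "s2 = ginv \<Phi>2 ((1 / (1 - norm a)) powr (?n + 1 + \<beta>))"
    have g1: "growth_fun \<Phi>1" "growth_fun \<Phi>2" using \<Phi>1 \<Phi>2 by (auto simp: two_sided_type_def)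
    have s: "s1 > 0" "s2 > 0" unfolding s1_def s2_def using a by (auto intro!: ginv_pos g1)
    obtain f where f: "f \<in> orlicz_bergman \<Phi>1 \<alpha>" "lux_norm \<Phi>1 \<alpha> f \<le> M" "c * s1 \<le> norm (f a)"
      using test[of a] a unfolding s1_def by auto
    have fg: "(\<lambda>z. f z * g z) \<in> orlicz_bergman \<Phi>2 \<beta>" using mul[OF f(1)] by blast
    have "lux_norm \<Phi>2 \<beta> (\<lambda>z. f z * g z) \<le> D * M"
      using mul[OF f(1)] mult_left_mono[OF f(2), of D] D by linarith
    then have "lux_norm \<Phi>2 \<beta> (\<lambda>z. f z * g z) < R" by (simp add: R_def)
    then obtain r where r: "0 < r" "r < R" "modular \<Phi>2 \<beta> (\<lambda>z. f z * g z) r \<le> 1"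
      using lux_norm_less_ex_modular[OF \<Phi>2 fg] by blast
    have "norm (f a * g a) / r \<le> B * s2"
      unfolding s2_def using fg by (intro pt r a) (auto simp: orlicz_bergman_alt)
    then have "norm (f a) * norm (g a) \<le> r * (B * s2)" using r by (simp add: norm_mult field_simps)
    also have "\<dots> \<le> R * (B * s2)" using r B s by (intro mult_right_mono) auto
    finally have "c * s1 * norm (g a) \<le> R * (B * s2)"
      using mult_right_mono[OF f(3), of "norm (g a)"] by simp
    moreover have "mult_gamma \<Phi>1 \<Phi>2 \<alpha> \<beta> CARD('n) (1 / (1 - norm a)) = s2 / s1"
      by (simp add: mult_gamma_def s1_def s2_def)
    moreover have "norm (g a) \<le> R * (B * s2) / (c * s1)" if "c * s1 * norm (g a) \<le> R * (B * s2)"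
      using that c s by (subst pos_le_divide_eq) (auto simp: mult.commute)
    ultimately show ?thesis by (simp add: mult.assoc)
  qed
  moreover have "R * B / c > 0" using R B c by simp
  ultimately show ?thesis by blast
qed

text \<open>Taking \<open>a = b\<close> in the second tilde condition forces \<open>\<Phi> s\<close> to be comparable to a power of \<open>s\<close>
  on \<open>[1,\<infinity>)\<close>.\<close>

lemma tilde_power_like:
  assumes "inL_tilde \<Phi> \<or> inU_tilde \<Phi>"
  shows "\<exists>r>0. \<exists>A\<ge>1. (\<forall>s\<ge>1. s powr r \<le> A * \<Phi> s) \<and> (\<forall>s\<ge>1. \<Phi> s \<le> A * s powr r) \<and>
     (\<forall>y>0. \<forall>t\<ge>1. \<Phi> (y * t) \<le> A * t powr r * \<Phi> y)"
proof -
  have "\<exists>r>0. \<exists>A\<ge>1. (\<forall>s\<ge>1. s powr r \<le> A * \<Phi> s) \<and> (\<forall>s\<ge>1. \<Phi> s \<le> A * s powr r)"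
    using assms
  proof
    assume "inL_tilde \<Phi>"
    then obtain p C3 where p: "classL p \<Phi>" and C3: "C3 > 0"
      and a2: "\<And>a b. 1 \<le> a \<Longrightarrow> 1 \<le> b \<Longrightarrow> \<Phi> (a / b) \<le> C3 * a powr p / \<Phi> b"
      unfolding inL_tilde_def by blast
    obtain C where C: "two_sided_type p 1 C \<Phi>" using classL_two_sided_type[OF p] by blast
    have one: "\<Phi> 1 = 1" using p by (simp add: classL_def growth_fun_def)
    have "s powr p \<le> max C C3 * \<Phi> s" if s: "s \<ge> 1" for s
    proof -
      have "\<Phi> (s * (1 / s)) \<le> C * (1 / s) powr p * \<Phi> s" using s by (intro two_sided_type_lower[OF C]) auto
      then have "s powr p \<le> C * \<Phi> s" using s by (simp add: one powr_divide field_simps)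
      also have "\<dots> \<le> max C C3 * \<Phi> s" using C s by (intro mult_right_mono) (auto simp: two_sided_type_def less_imp_le)
      finally show ?thesis .
    qed
    moreover have "\<Phi> s \<le> max C C3 * s powr p" if s: "s \<ge> 1" for s
    proof -
      have "\<Phi> s > 0" using C s by (auto simp: two_sided_type_def)
      then have "\<Phi> s \<le> C3 * s powr p" using a2[OF s s] s by (simp add: one field_simps)
      also have "\<dots> \<le> max C C3 * s powr p" by (intro mult_right_mono) auto
      finally show ?thesis .
    qed
    moreover have "p > 0" "1 \<le> max C C3" using C by (auto simp: two_sided_type_def)
    ultimately show ?thesis by blast
  next
    assume "inU_tilde \<Phi>"
    then obtain q C2 where q: "classU q \<Phi>" and C2: "C2 > 0"
      and a2: "\<And>a b. 1 \<le> a \<Longrightarrow> 1 \<le> b \<Longrightarrow> \<Phi> (a / b) \<le> C2 * \<Phi> a / b powr q"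
      unfolding inU_tilde_def by blast
    obtain C where C: "two_sided_type 1 q C \<Phi>" using classU_two_sided_type[OF q] by blast
    have one: "\<Phi> 1 = 1" using q by (simp add: classU_def growth_fun_def)
    have "\<Phi> s \<le> max C C2 * s powr q" if s: "s \<ge> 1" for s
    proof -
      have "\<Phi> (1 * s) \<le> C * s powr q * \<Phi> 1" using s by (intro two_sided_type_upper[OF C]) auto
      also have "\<dots> \<le> max C C2 * s powr q" by (simp add: one mult_right_mono)
      finally show ?thesis by simp
    qed
    moreover have "s powr q \<le> max C C2 * \<Phi> s" if s: "s \<ge> 1" for s
    proof -
      have "s powr q \<le> C2 * \<Phi> s" using a2[OF s s] s by (simp add: one field_simps)
      also have "\<dots> \<le> max C C2 * \<Phi> s" using C s by (intro mult_right_mono) (auto simp: two_sided_type_def less_imp_le)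
      finally show ?thesis .
    qed
    moreover have "q > 0" "1 \<le> max C C2" using C by (auto simp: two_sided_type_def)
    ultimately show ?thesis by blast
  qed
  then obtain r A where r: "r > 0" and A: "A \<ge> 1" and lo: "\<And>s. s \<ge> 1 \<Longrightarrow> s powr r \<le> A * \<Phi> s" and up: "\<And>s. s \<ge> 1 \<Longrightarrow> \<Phi> s \<le> A * s powr r"
    by blast
  obtain C1 where C1: "C1 > 0" and a1: "\<And>s t. 0 < s \<Longrightarrow> s \<le> 1 \<Longrightarrow> 1 \<le> t \<Longrightarrow> \<Phi> (s * t) \<le> C1 * \<Phi> s * \<Phi> t"
    using assms unfolding inL_tilde_def inU_tilde_def cond_a1_def by blast
  have g: "growth_fun \<Phi>" using assms unfolding inL_tilde_def inU_tilde_def classL_def classU_def by blast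
  define A' where "A' = max (A * A) (C1 * A)"
  have AA: "A \<le> A'" using A mult_left_mono[of 1 A A] by (simp add: A'_def le_max_iff_disj)
  have \<Phi>0: "0 \<le> \<Phi> y" if "y > 0" for y using growth_fun_nonneg[OF g] that by simp
  \<comment> \<open>For y \<le> 1 condition (a1) splits the product and only \<Phi>(t) is compared
    with a power. For y > 1 both y t and y lie in the range of the power bounds, and the common
    exponent lets y^r be turned back into \<Phi>(y).\<close>
  have "\<Phi> (y * t) \<le> A' * t powr r * \<Phi> y" if y: "y > 0" and t: "t \<ge> 1" for y t
  proof (cases "y \<le> 1")
    case True
    have "\<Phi> (y * t) \<le> C1 * \<Phi> y * \<Phi> t" using a1[OF y True t] .
    also have "\<dots> \<le> C1 * \<Phi> y * (A * t powr r)" using C1 \<Phi>0[OF y] by (intro mult_left_mono up t) auto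
    also have "\<dots> = (C1 * A) * (t powr r * \<Phi> y)" by simp
    also have "\<dots> \<le> A' * (t powr r * \<Phi> y)" using \<Phi>0[OF y] by (intro mult_right_mono) (auto simp: A'_def)
    finally show ?thesis by (simp only: mult.assoc)
  next
    case False
    have "1 * 1 \<le> y * t" using False t by (intro mult_mono) auto
    then have "\<Phi> (y * t) \<le> A * (y * t) powr r" using up[of "y * t"] by simp
    also have "\<dots> = A * t powr r * y powr r" by (simp add: powr_mult)
    also have "\<dots> \<le> A * t powr r * (A * \<Phi> y)" using False A by (intro mult_left_mono lo) auto
    also have "\<dots> = (A * A) * (t powr r * \<Phi> y)" by simp
    also have "\<dots> \<le> A' * (t powr r * \<Phi> y)" using \<Phi>0[OF y] by (intro mult_right_mono) (auto simp: A'_def)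
    finally show ?thesis by (simp only: mult.assoc)
  qed
  moreover have "s powr r \<le> A' * \<Phi> s" if "s \<ge> 1" for s
    using lo[OF that] mult_right_mono[OF AA \<Phi>0[of s]] that by linarith
  moreover have "\<Phi> s \<le> A' * s powr r" if "s \<ge> 1" for s
    using up[OF that] mult_right_mono[OF AA, of "s powr r"] by simp
  moreover have "A' \<ge> 1" using A AA by simp
  ultimately show ?thesis using r by blast
qed

section \<open>Sufficiency\<close>

lemma growth_bound_imp_multiplier:
  fixes g :: "complex^'n::finite \<Rightarrow> complex"
  assumes \<Phi>1: "two_sided_type p1 q1 C1 \<Phi>1" and \<Phi>2: "two_sided_type p2 q2 C2 \<Phi>2"
    and tilde: "inL_tilde \<Phi>2 \<or> inU_tilde \<Phi>2"
    and ratio: "mono_on {0<..} (\<lambda>t. \<Phi>2 t / \<Phi>1 t)"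
    and \<alpha>: "\<alpha> > -1" and \<beta>: "\<beta> > -1"
    and c: "c > 0" and \<gamma>c: "\<And>t. t \<ge> 1 \<Longrightarrow> c \<le> mult_gamma \<Phi>1 \<Phi>2 \<alpha> \<beta> CARD('n) t"
    and g: "holo_ball g" and K: "K > 0"
    and bound: "\<And>z. z \<in> ball 0 1 \<Longrightarrow> norm (g z) \<le> K * mult_gamma \<Phi>1 \<Phi>2 \<alpha> \<beta> CARD('n) (1 / (1 - norm z))"
  shows "g \<in> multipliers \<Phi>1 \<alpha> \<Phi>2 \<beta>"
proof -
  let ?n = "real CARD('n)"
  let ?\<gamma> = "mult_gamma \<Phi>1 \<Phi>2 \<alpha> \<beta> CARD('n)"
  have g1: "growth_fun \<Phi>1" and g2: "growth_fun \<Phi>2" and pos1: "\<And>s. s > 0 \<Longrightarrow> \<Phi>1 s > 0" and pos2: "\<And>s. s > 0 \<Longrightarrow> \<Phi>2 s > 0"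
    using \<Phi>1 \<Phi>2 by (auto simp: two_sided_type_def)
  have one: "\<Phi>1 1 = 1" "\<Phi>2 1 = 1" using g1 g2 by (simp_all add: growth_fun_def)
  obtain r A where r: "r > 0" and A: "A \<ge> 1" and lo: "\<And>s. s \<ge> 1 \<Longrightarrow> s powr r \<le> A * \<Phi>2 s"
    and up: "\<And>s. s \<ge> 1 \<Longrightarrow> \<Phi>2 s \<le> A * s powr r"
    and dil: "\<And>y t. y > 0 \<Longrightarrow> t \<ge> 1 \<Longrightarrow> \<Phi>2 (y * t) \<le> A * t powr r * \<Phi>2 y"
    using tilde_power_like[OF tilde] by blast
  obtain B where B: "B \<ge> 1" and pt: "\<And>(f :: complex^'n \<Rightarrow> complex) r z. holo_ball f \<Longrightarrow> 0 < r \<Longrightarrow> modular \<Phi>1 \<alpha> f r \<le> 1 \<Longrightarrow> z \<in> ball 0 1 \<Longrightarrow>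
     norm (f z) / r \<le> B * ginv \<Phi>1 ((1 / (1 - norm z)) powr (?n + 1 + \<alpha>))"
    using modular_le_1_pointwise[OF \<Phi>1 \<alpha>] by blast
  obtain k1 where k1: "k1 > 0" and W1: "\<And>u::complex^'n \<Rightarrow> real. continuous_on (ball 0 1) u \<Longrightarrow> (\<forall>z\<in>ball 0 1. 0 \<le> u z) \<Longrightarrow>
     weighted_integral \<alpha> u \<le> ennreal k1 * (\<integral>\<^sup>+z. ennreal (u z) \<partial>nu_alpha \<alpha>)"
    using nu_alpha_weighted_integral[OF \<alpha>] by blast
  obtain k2 where k2: "k2 > 0" and W2: "\<And>u::complex^'n \<Rightarrow> real. continuous_on (ball 0 1) u \<Longrightarrow> (\<forall>z\<in>ball 0 1. 0 \<le> u z) \<Longrightarrow>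
     (\<integral>\<^sup>+z. ennreal (u z) \<partial>nu_alpha \<beta>) \<le> ennreal k2 * weighted_integral \<beta> u"
    using nu_alpha_weighted_integral[OF \<beta>] by blast
  \<comment> \<open>Flat pieces of \<Phi>1 or \<Phi>2 may put the inverse at 1 below 1, while the
    power bounds start at 1. Dividing s1 by a1 and s2 by a2 brings them into that range.\<close>
  define a1 where "a1 = ginv \<Phi>1 1"
  define a2 where "a2 = ginv \<Phi>2 1"
  have a1: "0 < a1" "a1 \<le> 1" unfolding a1_def using one by (auto intro!: ginv_pos g1 ginv_le)
  have a2: "0 < a2" "a2 \<le> 1" unfolding a2_def using one by (auto intro!: ginv_pos g2 ginv_le)
  \<comment> \<open>With c' \<le> min 1 c, the factor h = \<gamma>/c' is both at least 1, as the
    dilation bound requires, and at least \<gamma>, as the bound on g requires.\<close>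
  define c' where "c' = min 1 c"
  have c': "0 < c'" "c' \<le> 1" "c' \<le> c" using c by (auto simp: c'_def)
  define D where "D = A * (A * (1 / (c' * a1)) powr r * (A * A))"
  have D: "D > 0" using A c' a1 by (simp add: D_def)
  have pointwise: "\<Phi>2 (norm (f z * g z) / (B * K * \<mu>)) * (1 - norm z) powr \<beta> \<le> D * \<Phi>1 (norm (f z) / \<mu>) * (1 - norm z) powr \<alpha>"
    if f: "holo_ball f" and \<mu>: "\<mu> > 0" and m: "modular \<Phi>1 \<alpha> f \<mu> \<le> 1" and z: "z \<in> ball 0 1"
    for f :: "complex^'n \<Rightarrow> complex" and \<mu> z
  proof (cases "f z = 0")
    case True
    then show ?thesis by (simp add: growth_fun_zero[OF g1] growth_fun_zero[OF g2])
  next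
    case False
    define d where "d = 1 - norm z"
    have d: "d > 0" "d \<le> 1" using z by (auto simp: d_def)
    have d1: "1 \<le> 1 / d" using d by simp
    define T1 where "T1 = (1 / d) powr (?n + 1 + \<alpha>)"
    define T2 where "T2 = (1 / d) powr (?n + 1 + \<beta>)"
    have T: "1 \<le> T1" "1 \<le> T2" unfolding T1_def T2_def using d1 \<alpha> \<beta> by (auto intro!: ge_one_powr_ge_zero)
    define s1 where "s1 = ginv \<Phi>1 T1"
    define s2 where "s2 = ginv \<Phi>2 T2"
    have s1: "a1 \<le> s1" "\<Phi>1 s1 = T1" unfolding s1_def a1_def using T by (auto intro!: ginv_mono g1 growth_fun_ginv)
    have s2: "a2 \<le> s2" "\<Phi>2 s2 = T2" unfolding s2_def a2_def using T by (auto intro!: ginv_mono g2 growth_fun_ginv)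
    have s0: "s1 > 0" "s2 > 0" using s1 s2 a1 a2 by auto
    define \<gamma> where "\<gamma> = ?\<gamma> (1 / d)"
    have \<gamma>: "\<gamma> = s2 / s1" by (simp add: \<gamma>_def mult_gamma_def s1_def s2_def T1_def T2_def)
    have \<gamma>ge: "c' \<le> \<gamma>" using \<gamma>c[OF d1] c' by (simp add: \<gamma>_def)
    have \<gamma>0: "\<gamma> > 0" using \<gamma> s0 by simp
    \<comment> \<open>Dividing by B puts u below s1, where the monotone ratio \<Phi>2/\<Phi>1 can be
      compared with its value at s1.\<close>
    define u where "u = norm (f z) / \<mu> / B"
    have u0: "u > 0" using False \<mu> B by (simp add: u_def)
    have us: "u \<le> s1"
    proof -
      have "norm (f z) / \<mu> \<le> s1 * B"
        using pt[OF f \<mu> m z] by (simp add: s1_def T1_def d_def mult.commute)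
      then show ?thesis unfolding u_def using B by (subst pos_divide_le_eq) auto
    qed
    define h where "h = \<gamma> / c'"
    have h: "1 \<le> h" "\<gamma> \<le> h" using \<gamma>ge \<gamma>0 c' by (auto simp: h_def field_simps)
    have "norm (f z * g z) / (B * K * \<mu>) = u * (norm (g z) / K)"
      using B K \<mu> by (simp add: u_def norm_mult)
    also have "\<dots> \<le> u * h"
    proof (intro mult_left_mono)
      have "norm (g z) / K \<le> \<gamma>" using bound[OF z] K by (simp add: \<gamma>_def d_def pos_divide_le_eq mult.commute)
      then show "norm (g z) / K \<le> h" using h by simp
    qed (use u0 in simp)
    finally have "\<Phi>2 (norm (f z * g z) / (B * K * \<mu>)) \<le> \<Phi>2 (u * h)"
      using B K \<mu> by (intro growth_fun_mono[OF g2]) auto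
    also have "\<dots> \<le> A * h powr r * \<Phi>2 u" by (rule dil[OF u0 h(1)])
    also have "\<dots> \<le> A * h powr r * (\<Phi>1 u * \<Phi>2 s1 / T1)"
    proof (intro mult_left_mono)
      have "\<Phi>2 u / \<Phi>1 u \<le> \<Phi>2 s1 / \<Phi>1 s1"
        using mono_onD[OF ratio, of u s1] u0 s0 us by simp
      then show "\<Phi>2 u \<le> \<Phi>1 u * \<Phi>2 s1 / T1" using pos1[OF u0] by (simp add: s1 pos_divide_le_eq mult.commute)
    qed (use A in auto)
    also have "\<dots> = A * (h powr r * \<Phi>2 s1) * (\<Phi>1 u / T1)" by simp
    \<comment> \<open>The cancellation of \<gamma>: h^r \<Phi>2(s1) is bounded by a multiple of (h
      s1)^r = (s2/c')^r, and s2^r by a multiple of \<Phi>2(s2) = T2.\<close>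
    also have "\<dots> \<le> A * (A * (1 / (c' * a1)) powr r * (A * A) * T2) * (\<Phi>1 u / T1)"
    proof (intro mult_right_mono mult_left_mono)
      have "\<Phi>2 s1 \<le> \<Phi>2 (s1 / a1)"
        using a1 s0 by (intro growth_fun_mono[OF g2]) (auto simp: pos_le_divide_eq mult_left_le)
      also have "\<dots> \<le> A * (s1 / a1) powr r" using a1 s1 by (intro up) (simp add: pos_le_divide_eq)
      finally have "h powr r * \<Phi>2 s1 \<le> h powr r * (A * (s1 / a1) powr r)" by (intro mult_left_mono) auto
      also have "\<dots> = A * (h * (s1 / a1)) powr r" by (simp only: powr_mult mult.left_commute)
      also have "h * (s1 / a1) = 1 / (c' * a1) * s2" using s0 by (simp add: h_def \<gamma>)
      also have "A * (1 / (c' * a1) * s2) powr r = A * (1 / (c' * a1)) powr r * s2 powr r" by (simp only: powr_mult mult.assoc)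
      also have "\<dots> \<le> A * (1 / (c' * a1)) powr r * (A * A * T2)"
      proof (intro mult_left_mono)
        have "(s2 / a2) powr r \<le> A * \<Phi>2 (s2 / a2)" using a2 s2 by (intro lo) (simp add: pos_le_divide_eq)
        also have "\<dots> \<le> A * (A * (1 / a2) powr r * \<Phi>2 s2)"
          using dil[OF s0(2), of "1 / a2"] a2 A by (intro mult_left_mono) auto
        finally have "(s2 / a2) powr r * a2 powr r \<le> A * (A * (1 / a2) powr r * \<Phi>2 s2) * a2 powr r"
          by (intro mult_right_mono) auto
        moreover have "(s2 / a2) powr r * a2 powr r = s2 powr r" "(1 / a2) powr r * a2 powr r = 1"
          using a2 by (simp_all add: powr_mult[symmetric])
        ultimately show "s2 powr r \<le> A * A * T2" by (simp add: s2 mult_ac)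
      qed (use A in auto)
      finally show "h powr r * \<Phi>2 s1 \<le> A * (1 / (c' * a1)) powr r * (A * A) * T2" by (simp only: mult.assoc)
    qed (use A T pos1[OF u0] in auto)
    also have "\<dots> = D * (T2 / T1) * \<Phi>1 u" by (simp add: D_def)
    also have "\<dots> \<le> D * (T2 / T1) * \<Phi>1 (norm (f z) / \<mu>)"
    proof (intro mult_left_mono growth_fun_mono[OF g1])
      have "u * 1 \<le> u * B" using u0 B by (intro mult_left_mono) auto
      then show "u \<le> norm (f z) / \<mu>" using B by (simp add: u_def)
    qed (use u0 D T in auto)
    finally have "\<Phi>2 (norm (f z * g z) / (B * K * \<mu>)) * d powr \<beta> \<le> D * (T2 / T1) * \<Phi>1 (norm (f z) / \<mu>) * d powr \<beta>"
      by (intro mult_right_mono) auto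
    also have "\<dots> = D * \<Phi>1 (norm (f z) / \<mu>) * (T2 / T1 * d powr \<beta>)" by simp
    \<comment> \<open>The common part n + 1 of the exponents drops out and the weight \<beta>
      becomes the weight \<alpha>.\<close>
    also have "T2 / T1 * d powr \<beta> = d powr \<alpha>"
    proof -
      have "T2 / T1 = (1 / d) powr (\<beta> - \<alpha>)" by (simp add: T1_def T2_def powr_diff[symmetric])
      also have "\<dots> = d powr (\<alpha> - \<beta>)" using d powr_minus_divide[of d "\<beta> - \<alpha>"] by (simp add: powr_divide)
      finally show ?thesis by (simp add: powr_add[symmetric])
    qed
    finally show ?thesis by (simp add: d_def)
  qed
  define B2 where "B2 = max 1 (k2 * (D * k1))"
  obtain M where M: "M \<ge> 1" and scale: "\<And>(f :: complex^'n \<Rightarrow> complex) r. holo_ball f \<Longrightarrow> 0 < r \<Longrightarrow>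
      modular \<Phi>2 \<beta> f r \<le> ennreal B2 \<Longrightarrow> modular \<Phi>2 \<beta> f (M * r) \<le> 1"
    using modular_scale[OF \<Phi>2, of B2] unfolding B2_def by (metis max.cobounded1)
  define E where "E = M * (B * K)"
  have E: "E > 0" using M B K by (simp add: E_def)
  have mod2: "modular \<Phi>2 \<beta> (\<lambda>z. f z * g z) (E * \<mu>) \<le> 1"
    if f: "holo_ball f" and \<mu>: "\<mu> > 0" and m: "modular \<Phi>1 \<alpha> f \<mu> \<le> 1" for f :: "complex^'n \<Rightarrow> complex" and \<mu>
  proof -
    have fg: "holo_ball (\<lambda>z. f z * g z)" by (rule holo_ball_mult[OF f g])
    have R: "B * K * \<mu> > 0" using B K \<mu> by simp
    have c1: "continuous_on (ball 0 1) (\<lambda>z. \<Phi>1 (norm (f z) / \<mu>))" by (rule growth_fun_continuous_norm[OF g1 f \<mu>])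
    have "modular \<Phi>2 \<beta> (\<lambda>z. f z * g z) (B * K * \<mu>) \<le> ennreal k2 * weighted_integral \<beta> (\<lambda>z. \<Phi>2 (norm (f z * g z) / (B * K * \<mu>)))"
      unfolding modular_def
      by (intro W2 growth_fun_continuous_norm[OF g2 fg R] ballI growth_fun_nonneg[OF g2]) (use R in simp)
    also have "weighted_integral \<beta> (\<lambda>z. \<Phi>2 (norm (f z * g z) / (B * K * \<mu>))) \<le> weighted_integral \<alpha> (\<lambda>z. D * \<Phi>1 (norm (f z) / \<mu>))"
      by (intro weighted_integral_mono pointwise[OF f \<mu> m])
    also have "\<dots> = ennreal D * weighted_integral \<alpha> (\<lambda>z. \<Phi>1 (norm (f z) / \<mu>))"
      using D by (intro weighted_integral_cmult c1) simp
    also have "weighted_integral \<alpha> (\<lambda>z. \<Phi>1 (norm (f z) / \<mu>)) \<le> ennreal k1 * modular \<Phi>1 \<alpha> f \<mu>"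
      unfolding modular_def
      by (intro W1 c1 ballI growth_fun_nonneg[OF g1]) (use \<mu> in simp)
    also have "\<dots> \<le> ennreal k1 * 1" by (intro mult_left_mono m) auto
    finally have "modular \<Phi>2 \<beta> (\<lambda>z. f z * g z) (B * K * \<mu>) \<le> ennreal k2 * (ennreal D * (ennreal k1 * 1))"
      by (simp add: mult_left_mono)
    also have "\<dots> = ennreal (k2 * (D * k1))" using k1 k2 D by (simp add: ennreal_mult)
    also have "\<dots> \<le> ennreal B2" by (intro ennreal_leI) (simp add: B2_def)
    finally have "modular \<Phi>2 \<beta> (\<lambda>z. f z * g z) (M * (B * K * \<mu>)) \<le> 1" by (rule scale[OF fg R])
    then show ?thesis by (simp add: E_def mult.assoc)
  qed
  have "(\<lambda>z. f z * g z) \<in> orlicz_bergman \<Phi>2 \<beta> \<and> lux_norm \<Phi>2 \<beta> (\<lambda>z. f z * g z) \<le> E * lux_norm \<Phi>1 \<alpha> f"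
    if fA: "f \<in> orlicz_bergman \<Phi>1 \<alpha>" for f
  proof
    have f: "holo_ball f" using fA by (simp add: orlicz_bergman_alt)
    have ne: "{r. 0 < r \<and> modular \<Phi>1 \<alpha> f r \<le> 1} \<noteq> {}" by (rule orlicz_bergman_ex_modular_le_1[OF \<Phi>1 fA])
    then obtain \<mu> where "0 < \<mu>" "modular \<Phi>1 \<alpha> f \<mu> \<le> 1" by blast
    then show "(\<lambda>z. f z * g z) \<in> orlicz_bergman \<Phi>2 \<beta>"
      using mod2[OF f] E by (intro modular_le_1_imp_orlicz_bergman[OF \<Phi>2 holo_ball_mult[OF f g], of "E * \<mu>"]) auto
    \<comment> \<open>Each admissible scale \<mu> for f makes E \<mu> admissible for the product;
      dividing by E lets the infimum be taken over \<mu>.\<close>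
    have "lux_norm \<Phi>2 \<beta> (\<lambda>z. f z * g z) / E \<le> lux_norm \<Phi>1 \<alpha> f"
      unfolding lux_norm_alt[of \<Phi>1]
    proof (rule cInf_greatest[OF ne])
      fix \<mu> assume "\<mu> \<in> {r. 0 < r \<and> modular \<Phi>1 \<alpha> f r \<le> 1}"
      then have "lux_norm \<Phi>2 \<beta> (\<lambda>z. f z * g z) \<le> E * \<mu>"
        using mod2[OF f] E by (intro lux_norm_le) auto
      then show "lux_norm \<Phi>2 \<beta> (\<lambda>z. f z * g z) / E \<le> \<mu>" using E by (simp add: pos_divide_le_eq mult.commute)
    qed
    then show "lux_norm \<Phi>2 \<beta> (\<lambda>z. f z * g z) \<le> E * lux_norm \<Phi>1 \<alpha> f"
      using E by (simp add: pos_divide_le_eq mult.commute)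
  qed
  then show ?thesis unfolding multipliers_def using g E by blast
qed

text \<open>The maximum principle on the complex line through 0 and z: on its circle of radius
  \<rho> every point has norm \<rho>, so g is bounded there by \<eta>(\<rho>), which tends to
  0.\<close>

lemma holo_ball_zero_of_boundary_decay:
  fixes g :: "complex^'n::finite \<Rightarrow> complex"
  assumes g: "holo_ball g" and lim: "(\<eta> \<longlongrightarrow> 0) (at_left 1)"
    and le: "\<And>z. z \<in> ball 0 1 \<Longrightarrow> norm (g z) \<le> \<eta> (norm z)" and z: "z \<in> ball 0 1"
  shows "g z = 0"
proof -
  \<comment> \<open>For z = 0 any unit vector serves, with \<zeta> = 0.\<close>
  obtain e :: "complex^'n" and \<zeta> :: complex where e: "norm e = 1" "z = \<zeta> *s e"
  proof (cases "z = 0")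
    case True
    then show ?thesis using that[of "axis undefined 1" 0] by (simp add: norm_axis_1)
  next
    case False
    then show ?thesis
      using that[of "of_real (1 / norm z) *s z" "of_real (norm z)"] by (simp add: vector_smult_assoc norm_divide flip: of_real_mult)
  qed
  have "norm (g z) \<le> \<epsilon>" if \<epsilon>: "\<epsilon> > 0" for \<epsilon>
  proof -
    have "eventually (\<lambda>t. \<eta> t < \<epsilon>) (at_left 1)" using order_tendstoD(2)[OF lim \<epsilon>] .
    then obtain b where b: "b < 1" "\<And>t. b < t \<Longrightarrow> t < 1 \<Longrightarrow> \<eta> t < \<epsilon>"
      unfolding eventually_at_left_field by blast
    obtain \<rho> where \<rho>: "max (max b (norm z)) 0 < \<rho>" "\<rho> < 1"
      using dense[of "max (max b (norm z)) 0" 1] b z by auto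
    have in_ball: "0 + w *s e \<in> ball 0 1" if "w \<in> cball 0 \<rho>" for w using that e \<rho> by simp
    have hol: "(\<lambda>w. g (0 + w *s e)) holomorphic_on cball 0 \<rho>"
      by (rule holo_ball_slice[OF g in_ball])
    have "norm (g (0 + \<zeta> *s e)) \<le> \<epsilon>"
    proof (rule maximum_modulus_frontier[where S = "ball 0 \<rho>" and f = "\<lambda>w. g (0 + w *s e)"])
      show "(\<lambda>w. g (0 + w *s e)) holomorphic_on interior (ball 0 \<rho>)"
        using holomorphic_on_subset[OF hol] by auto
      show "continuous_on (closure (ball 0 \<rho>)) (\<lambda>w. g (0 + w *s e))"
        using holomorphic_on_imp_continuous_on[OF hol] \<rho> by simp
      show "norm (g (0 + w *s e)) \<le> \<epsilon>" if "w \<in> frontier (ball 0 \<rho>)" for w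
      proof -
        have w: "norm w = \<rho>" using that \<rho> by simp
        then have "norm (g (0 + w *s e)) \<le> \<eta> (norm (0 + w *s e))" by (intro le in_ball) simp
        also have "\<dots> = \<eta> \<rho>" using w e by simp
        also have "\<dots> < \<epsilon>" using b(2) \<rho> by simp
        finally show ?thesis by simp
      qed
      show "\<zeta> \<in> ball 0 \<rho>" using e \<rho> by simp
    qed simp
    then show ?thesis by (simp add: e)
  qed
  then show ?thesis using field_le_epsilon[of "norm (g z)" 0] by simp
qed

text \<open>The easy inclusion of the third case. Values of g off the ball do not matter: the
  modular sees only the ball, and differentiability at its points is local.\<close>

lemma zero_on_ball_multiplier:
  fixes g :: "complex^'n::finite \<Rightarrow> complex"
  assumes \<Phi>1: "two_sided_type p1 q1 C1 \<Phi>1" and \<Phi>2: "two_sided_type p2 q2 C2 \<Phi>2"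
    and g: "\<And>z. z \<in> ball 0 1 \<Longrightarrow> g z = 0"
  shows "g \<in> multipliers \<Phi>1 \<alpha> \<Phi>2 \<beta>"
proof -
  have holo: "holo_ball h" if "\<And>z. z \<in> ball 0 1 \<Longrightarrow> h z = 0" for h :: "complex^'n \<Rightarrow> complex"
    unfolding holo_ball_def
  proof
    fix z :: "complex^'n" assume z: "z \<in> ball 0 1"
    have "(h has_derivative (\<lambda>_. 0)) (at z)"
      by (rule has_derivative_transform_within_open[OF has_derivative_const[of 0] open_ball z]) (use that in auto)
    then show "\<exists>L. (h has_derivative L) (at z) \<and> (\<forall>c w. L (c *s w) = c * L w)" by auto
  qed
  have z0: "\<Phi>2 0 = 0" using \<Phi>2 growth_fun_zero by (simp add: two_sided_type_def)
  have mod: "modular \<Phi>2 \<beta> (\<lambda>z. f z * g z) r = 0" for f r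
  proof -
    have "modular \<Phi>2 \<beta> (\<lambda>z. f z * g z) r = (\<integral>\<^sup>+z. 0 \<partial>(nu_alpha \<beta> :: (complex^'n) measure))"
      unfolding modular_def by (intro nn_integral_cong) (simp add: space_nu_alpha g z0)
    then show ?thesis by simp
  qed
  have "(\<lambda>z. f z * g z) \<in> orlicz_bergman \<Phi>2 \<beta> \<and> lux_norm \<Phi>2 \<beta> (\<lambda>z. f z * g z) \<le> 1 * lux_norm \<Phi>1 \<alpha> f"
    if f: "f \<in> orlicz_bergman \<Phi>1 \<alpha>" for f
  proof
    show "(\<lambda>z. f z * g z) \<in> orlicz_bergman \<Phi>2 \<beta>"
      using holo[of "\<lambda>z. f z * g z"] g by (simp add: orlicz_bergman_alt mod)
    \<comment> \<open>Every positive scale is admissible for the zero product, so its quasi-norm is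
      0; non-negativity on the other side needs a nonempty set of scales.\<close>
    have "lux_norm \<Phi>2 \<beta> (\<lambda>z. f z * g z) = Inf {0<..}"
      unfolding lux_norm_alt mod by (simp add: greaterThan_def)
    moreover have "0 \<le> lux_norm \<Phi>1 \<alpha> f"
      unfolding lux_norm_alt by (intro cInf_greatest orlicz_bergman_ex_modular_le_1[OF \<Phi>1 f]) auto
    ultimately show "lux_norm \<Phi>2 \<beta> (\<lambda>z. f z * g z) \<le> 1 * lux_norm \<Phi>1 \<alpha> f" by simp
  qed
  then show ?thesis unfolding multipliers_def using holo[of g] g zero_less_one by blast
qed

theorem theorem1p5:
  fixes \<Phi>1 \<Phi>2 :: "real \<Rightarrow> real" and \<alpha> \<beta> :: real
  assumes "inL \<Phi>1 \<or> inU \<Phi>1"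
    and "inL_tilde \<Phi>2 \<or> inU_tilde \<Phi>2"
    and "mono_on {0<..} (\<lambda>t. \<Phi>2 t / \<Phi>1 t)"
    and "\<alpha> > -1" and "\<beta> > -1"
  shows "(mono_on {1..} (mult_gamma \<Phi>1 \<Phi>2 \<alpha> \<beta> CARD('n)) \<longrightarrow>
            (multipliers \<Phi>1 \<alpha> \<Phi>2 \<beta> :: (complex^'n::finite \<Rightarrow> complex) set)
              = H_infty_omega (\<lambda>s. mult_gamma \<Phi>1 \<Phi>2 \<alpha> \<beta> CARD('n) (1 / s)))
       \<and> ((\<exists>c C. 0 < c \<and> 0 < C \<and> (\<forall>t\<ge>1. c \<le> mult_gamma \<Phi>1 \<Phi>2 \<alpha> \<beta> CARD('n) t
                 \<and> mult_gamma \<Phi>1 \<Phi>2 \<alpha> \<beta> CARD('n) t \<le> C)) \<longrightarrow>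
            (multipliers \<Phi>1 \<alpha> \<Phi>2 \<beta> :: (complex^'n \<Rightarrow> complex) set) = H_infty)
       \<and> ((antimono_on {1..} (mult_gamma \<Phi>1 \<Phi>2 \<alpha> \<beta> CARD('n)) \<and>
             (mult_gamma \<Phi>1 \<Phi>2 \<alpha> \<beta> CARD('n) \<longlongrightarrow> 0) at_top) \<longrightarrow>
            (multipliers \<Phi>1 \<alpha> \<Phi>2 \<beta> :: (complex^'n \<Rightarrow> complex) set) = {g. \<forall>z\<in>ball 0 1. g z = 0})"
proof -
  let ?\<gamma> = "mult_gamma \<Phi>1 \<Phi>2 \<alpha> \<beta> CARD('n)"
  let ?M = "multipliers \<Phi>1 \<alpha> \<Phi>2 \<beta> :: (complex^'n \<Rightarrow> complex) set"
  have types: "\<exists>p q C. two_sided_type p q C \<Phi>" if "inL \<Phi> \<or> inU \<Phi>" for \<Phi>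
    using that classL_two_sided_type classU_two_sided_type unfolding inL_def inU_def by blast
  obtain p1 q1 C1 where \<Phi>1: "two_sided_type p1 q1 C1 \<Phi>1" using types[OF assms(1)] by blast
  have "inL \<Phi>2 \<or> inU \<Phi>2" using assms(2) unfolding inL_tilde_def inU_tilde_def inL_def inU_def by blast
  then obtain p2 q2 C2 where \<Phi>2: "two_sided_type p2 q2 C2 \<Phi>2" using types by blast
  have \<gamma>_pos: "0 < ?\<gamma> t" if "t \<ge> 1" for t
    using that \<Phi>1 \<Phi>2 unfolding mult_gamma_def two_sided_type_def
    by (intro divide_pos_pos ginv_pos) auto
  have ge1: "1 \<le> 1 / (1 - norm z)" if "z \<in> ball 0 1" for z :: "complex^'n" using that by simp
  note necessary = multipliers_growth_bound[OF \<Phi>1 \<Phi>2 assms(4,5)]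
  note sufficient = growth_bound_imp_multiplier[OF \<Phi>1 \<Phi>2 assms(2,3,4,5)]
  have holo: "holo_ball g" if "g \<in> ?M" for g using that by (simp add: multipliers_def)
  have i: "?M = H_infty_omega (\<lambda>s. ?\<gamma> (1 / s))" if mono: "mono_on {1..} ?\<gamma>"
  proof (intro equalityI subsetI)
    fix g assume g: "g \<in> ?M"
    then obtain K where K: "K > 0" "\<And>z. z \<in> ball 0 1 \<Longrightarrow> norm (g z) \<le> K * ?\<gamma> (1 / (1 - norm z))"
      using necessary by blast
    have "norm (g z) / ?\<gamma> (1 / (1 - norm z)) \<le> K" if "z \<in> ball 0 1" for z
      using K(2)[OF that] \<gamma>_pos[OF ge1[OF that]] by (simp add: pos_divide_le_eq)
    then show "g \<in> H_infty_omega (\<lambda>s. ?\<gamma> (1 / s))"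
      unfolding H_infty_omega_def using holo[OF g] by blast
  next
    fix g :: "complex^'n \<Rightarrow> complex" assume "g \<in> H_infty_omega (\<lambda>s. ?\<gamma> (1 / s))"
    then obtain C where g: "holo_ball g" and C: "\<And>z. z \<in> ball 0 1 \<Longrightarrow> norm (g z) / ?\<gamma> (1 / (1 - norm z)) \<le> C"
      unfolding H_infty_omega_def by blast
    show "g \<in> ?M"
    \<comment> \<open>Monotonicity makes \<gamma>(1) > 0 a lower bound of \<gamma>; the maximum with
      1 only secures a positive constant.\<close>
    proof (rule sufficient[where c = "?\<gamma> 1" and K = "max 1 C"])
      show "?\<gamma> 1 \<le> ?\<gamma> t" if "t \<ge> 1" for t using mono_onD[OF mono, of 1 t] that by simp
      show "norm (g z) \<le> max 1 C * ?\<gamma> (1 / (1 - norm z))" if "z \<in> ball 0 1" for z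
      proof -
        have "norm (g z) / ?\<gamma> (1 / (1 - norm z)) \<le> max 1 C" using C[OF that] by simp
        then show ?thesis using \<gamma>_pos[OF ge1[OF that]] by (simp only: pos_divide_le_eq)
      qed
    qed (use \<gamma>_pos g in auto)
  qed
  have ii: "?M = H_infty" if c: "0 < c" "0 < C" "\<And>t. t \<ge> 1 \<Longrightarrow> c \<le> ?\<gamma> t" "\<And>t. t \<ge> 1 \<Longrightarrow> ?\<gamma> t \<le> C" for c C
  proof (intro equalityI subsetI)
    fix g assume g: "g \<in> ?M"
    then obtain K where K: "K > 0" "\<And>z. z \<in> ball 0 1 \<Longrightarrow> norm (g z) \<le> K * ?\<gamma> (1 / (1 - norm z))"
      using necessary by blast
    have "norm (g z) \<le> K * C" if "z \<in> ball 0 1" for z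
      using K(2)[OF that] mult_left_mono[OF c(4)[OF ge1[OF that]], of K] K(1) by linarith
    then show "g \<in> H_infty" unfolding H_infty_def using holo[OF g] by blast
  next
    fix g :: "complex^'n \<Rightarrow> complex" assume "g \<in> H_infty"
    then obtain B where g: "holo_ball g" and B: "\<And>z. z \<in> ball 0 1 \<Longrightarrow> norm (g z) \<le> B"
      unfolding H_infty_def by blast
    show "g \<in> ?M"
    proof (rule sufficient[where c = c and K = "max 1 B / c"])
      show "norm (g z) \<le> max 1 B / c * ?\<gamma> (1 / (1 - norm z))" if "z \<in> ball 0 1" for z
      proof -
        have "norm (g z) \<le> max 1 B / c * c" using B[OF that] c by simp
        also have "\<dots> \<le> max 1 B / c * ?\<gamma> (1 / (1 - norm z))"
          using c by (intro mult_left_mono c(3) ge1 that) auto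
        finally show ?thesis .
      qed
    qed (use c g in \<open>auto intro!: divide_pos_pos\<close>)
  qed
  have iii: "?M = {g. \<forall>z\<in>ball 0 1. g z = 0}" if lim: "(?\<gamma> \<longlongrightarrow> 0) at_top"
  proof (intro equalityI subsetI)
    fix g assume g: "g \<in> ?M"
    then obtain K where K: "K > 0" "\<And>z. z \<in> ball 0 1 \<Longrightarrow> norm (g z) \<le> K * ?\<gamma> (1 / (1 - norm z))"
      using necessary by blast
    \<comment> \<open>Transfers the limit at infinity to the boundary through t -> 1/(1 - t), giving
      the majorant of g as a function of \<open>norm z\<close>.\<close>
    have "filterlim (\<lambda>t::real. 1 - t) (at_right 0) (at_left 1)"
      by (rule tendsto_imp_filterlim_at_right) (auto intro!: tendsto_eq_intros simp: eventually_at_filter)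
    then have "filterlim (\<lambda>t::real. 1 / (1 - t)) at_top (at_left 1)"
      using filterlim_compose[OF filterlim_inverse_at_top_right] by (simp add: inverse_eq_divide)
    then have "((\<lambda>t. K * ?\<gamma> (1 / (1 - t))) \<longlongrightarrow> K * 0) (at_left 1)"
      by (intro tendsto_mult tendsto_const filterlim_compose[OF lim])
    then have "((\<lambda>t. K * ?\<gamma> (1 / (1 - t))) \<longlongrightarrow> 0) (at_left 1)" by simp
    then have "g z = 0" if "z \<in> ball 0 1" for z
      by (rule holo_ball_zero_of_boundary_decay[OF holo[OF g] _ K(2) that])
    then show "g \<in> {g. \<forall>z\<in>ball 0 1. g z = 0}" by blast
  next
    fix g :: "complex^'n \<Rightarrow> complex" assume "g \<in> {g. \<forall>z\<in>ball 0 1. g z = 0}"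
    then show "g \<in> ?M" by (intro zero_on_ball_multiplier[OF \<Phi>1 \<Phi>2]) auto
  qed
  show ?thesis using i ii iii by blast
qed

end
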